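(* Let $\mathfrak g=\mathfrak{sp}_{2l}(\Bbbk)$, $l\ge 1$, and let $\vartheta$ be an automorphism of $\mathfrak g$ of finite odd order. Then $\operatorname{ind}\mathfrak g_{(0)}=\operatorname{ind}\mathfrak g=l$.
   Context: $\Bbbk$ is an algebraically closed field of characteristic $0$. The index $\operatorname{ind}\mathfrak q$ of a Lie algebra $\mathfrak q$ is the minimal dimension of the stabilisers $\mathfrak q^\xi$, $\xi\in\mathfrak q^*$, for the coadjoint representation. Periodic contraction. Let $\vartheta$ be an automorphism of $\mathfrak g$ of order $m$, $\zeta$ a fixed primitive $m$-th root of unity, and $\mathfrak g=\bigoplus_{i=0}^{m-1}\mathfrak g_i$, where $\mathfrak g_i$ is the $\zeta^i$-eigenspace of $\vartheta$. The $\vartheta$-contraction $\mathfrak g_{(0)}$ is the vector space $\mathfrak g$ with the Lie bracket $[\ ,\,]_{(0)}$ defined for $x\in\mathfrak g_i$, $y\in\mathfrak g_j$ ($0\le i,j\le m-1$) by $[x,y]_{(0)}=[x,y]$ if $i+j\le m-1$ and $[x,y]_{(0)}=0$ if $i+j>m-1$. *)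

theory Defs
  imports "HOL-Analysis.Analysis" "HOL-Computational_Algebra.Polynomial"
begin

section \<open>Lie algebras, coadjoint stabilisers and the index\<close>

text \<open>A Lie algebra is carried by a subspace \<open>L\<close> of an ambient vector space. The bracket is
  only constrained on \<open>L\<close>.\<close>

locale lie_algebra = vector_space scale
  for scale :: "'k::field \<Rightarrow> 'v::ab_group_add \<Rightarrow> 'v" (infixr \<open>\<cdot>\<close> 75) +
  fixes L :: "'v set" and br :: "'v \<Rightarrow> 'v \<Rightarrow> 'v"
  assumes subspace_L: "subspace L"
    and br_closed: "\<lbrakk>x \<in> L; y \<in> L\<rbrakk> \<Longrightarrow> br x y \<in> L"
    and br_add_left: "\<lbrakk>x \<in> L; x' \<in> L; y \<in> L\<rbrakk> \<Longrightarrow> br (x + x') y = br x y + br x' y"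
    and br_add_right: "\<lbrakk>x \<in> L; y \<in> L; y' \<in> L\<rbrakk> \<Longrightarrow> br x (y + y') = br x y + br x y'"
    and br_scale_left: "\<lbrakk>x \<in> L; y \<in> L\<rbrakk> \<Longrightarrow> br (c \<cdot> x) y = c \<cdot> br x y"
    and br_scale_right: "\<lbrakk>x \<in> L; y \<in> L\<rbrakk> \<Longrightarrow> br x (c \<cdot> y) = c \<cdot> br x y"
    and br_alternating: "x \<in> L \<Longrightarrow> br x x = 0"
    and jacobi: "\<lbrakk>x \<in> L; y \<in> L; z \<in> L\<rbrakk>
      \<Longrightarrow> br x (br y z) + br y (br z x) + br z (br x y) = 0"
begin

text \<open>Linear functionals on \<open>L\<close>, represented by functions on the ambient type whose values outside
  \<open>L\<close> are irrelevant.\<close>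

definition dual :: "('v \<Rightarrow> 'k) set" where
  "dual = {\<xi>. (\<forall>x\<in>L. \<forall>y\<in>L. \<xi> (x + y) = \<xi> x + \<xi> y) \<and> (\<forall>c. \<forall>x\<in>L. \<xi> (c \<cdot> x) = c * \<xi> x)}"

definition coadjoint :: "'v \<Rightarrow> ('v \<Rightarrow> 'k) \<Rightarrow> 'v \<Rightarrow> 'k" where
  "coadjoint x \<xi> = (\<lambda>y. - \<xi> (br x y))"

definition stabiliser :: "('v \<Rightarrow> 'k) \<Rightarrow> 'v set" where
  "stabiliser \<xi> = {x \<in> L. \<forall>y\<in>L. coadjoint x \<xi> y = 0}"

definition index :: nat where
  "index = (LEAST d. \<exists>\<xi>\<in>dual. d = dim (stabiliser \<xi>))"


section \<open>Periodic automorphisms and their contractions\<close>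

definition automorphism :: "('v \<Rightarrow> 'v) \<Rightarrow> bool" where
  "automorphism \<theta> \<longleftrightarrow> bij_betw \<theta> L L
     \<and> (\<forall>x\<in>L. \<forall>y\<in>L. \<theta> (x + y) = \<theta> x + \<theta> y)
     \<and> (\<forall>c. \<forall>x\<in>L. \<theta> (c \<cdot> x) = c \<cdot> \<theta> x)
     \<and> (\<forall>x\<in>L. \<forall>y\<in>L. \<theta> (br x y) = br (\<theta> x) (\<theta> y))"

definition has_order :: "('v \<Rightarrow> 'v) \<Rightarrow> nat \<Rightarrow> bool" where
  "has_order \<theta> m \<longleftrightarrow> 0 < m \<and> (\<forall>x\<in>L. (\<theta> ^^ m) x = x)
     \<and> (\<forall>k. 0 < k \<and> k < m \<longrightarrow> (\<exists>x\<in>L. (\<theta> ^^ k) x \<noteq> x))"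

definition eigenspace :: "('v \<Rightarrow> 'v) \<Rightarrow> 'k \<Rightarrow> nat \<Rightarrow> 'v set" where
  "eigenspace \<theta> \<zeta> i = {x \<in> L. \<theta> x = \<zeta> ^ i \<cdot> x}"

text \<open>The \<open>i\<close>-th component of \<open>x\<close> in the decomposition of \<open>L\<close> into the eigenspaces of indices
  \<open>0, \<dots>, m - 1\<close>; well defined by \<open>component_unique\<close> and \<open>component_decomposition\<close> below.\<close>

definition component :: "('v \<Rightarrow> 'v) \<Rightarrow> nat \<Rightarrow> 'k \<Rightarrow> nat \<Rightarrow> 'v \<Rightarrow> 'v" where
  "component \<theta> m \<zeta> i x =
     (THE y. \<exists>c. (\<forall>j<m. c j \<in> eigenspace \<theta> \<zeta> j) \<and> x = (\<Sum>j<m. c j) \<and> y = c i)"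

text \<open>The bilinear extension of the rule for homogeneous elements; see
  \<open>contraction_homogeneous\<close> below.\<close>

definition contraction :: "('v \<Rightarrow> 'v) \<Rightarrow> nat \<Rightarrow> 'k \<Rightarrow> 'v \<Rightarrow> 'v \<Rightarrow> 'v" where
  "contraction \<theta> m \<zeta> x y =
     (\<Sum>i<m. \<Sum>j<m. if i + j \<le> m - 1 then br (component \<theta> m \<zeta> i x) (component \<theta> m \<zeta> j y) else 0)"

end

definition primitive_root :: "'k::field \<Rightarrow> nat \<Rightarrow> bool" where
  "primitive_root \<zeta> m \<longleftrightarrow> 0 < m \<and> \<zeta> ^ m = 1 \<and> (\<forall>k. 0 < k \<and> k < m \<longrightarrow> \<zeta> ^ k \<noteq> 1)"

lemma primitive_root_nz: "primitive_root \<zeta> m \<Longrightarrow> \<zeta> \<noteq> 0"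
  by (auto simp: primitive_root_def power_0_left)

lemma primitive_root_sum:
  fixes \<zeta> :: "'k::field"
  assumes "primitive_root \<zeta> m" "i < m" "j < m"
  shows "(\<Sum>k<m. inverse (\<zeta> ^ (j * k)) * \<zeta> ^ (i * k)) = (if i = j then of_nat m else 0)"
proof (cases "i = j")
  case True
  then show ?thesis using primitive_root_nz[OF assms(1)] by simp
next
  case False
  define q where "q = \<zeta> ^ i / \<zeta> ^ j"
  have nz: "\<zeta> \<noteq> 0" using primitive_root_nz[OF assms(1)] .
  have m1: "\<zeta> ^ m = 1" using assms(1) by (simp add: primitive_root_def)
  have "q \<noteq> 1"
  proof
    assume "q = 1"
    then have eq: "\<zeta> ^ i = \<zeta> ^ j" using nz by (simp add: q_def)
    have *: "\<zeta> ^ (b - a) = 1" if "a \<le> b" "\<zeta> ^ a = \<zeta> ^ b" for a b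
      using that nz by (simp add: power_diff)
    have "\<zeta> ^ (max i j - min i j) = 1"
      using *[of i j, OF _ eq] *[of j i, OF _ eq[symmetric]]
      by (cases "i \<le> j") (simp_all add: max_def min_def)
    moreover have "0 < max i j - min i j" "max i j - min i j < m" using False assms by auto
    ultimately show False using assms(1) by (auto simp: primitive_root_def)
  qed
  moreover have "q ^ m = 1"
    by (simp add: q_def power_divide power_mult[symmetric] mult.commute[of _ m])
       (simp add: power_mult m1 nz)
  ultimately have "(\<Sum>k<m. q ^ k) = 0" by (simp add: sum_gp_strict)
  moreover have "(\<Sum>k<m. inverse (\<zeta> ^ (j * k)) * \<zeta> ^ (i * k)) = (\<Sum>k<m. q ^ k)"
    by (intro sum.cong refl)
       (simp only: q_def power_divide power_mult[symmetric], simp only: divide_inverse_commute)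
  ultimately show ?thesis using False by simp
qed

lemma primitive_root_power_mod:
  assumes "primitive_root \<zeta> m" shows "\<zeta> ^ (n mod m) = \<zeta> ^ n"
proof -
  have "\<zeta> ^ n = \<zeta> ^ (m * (n div m) + n mod m)" by simp
  also have "\<dots> = \<zeta> ^ (n mod m)"
    using assms unfolding power_add power_mult by (simp add: primitive_root_def)
  finally show ?thesis ..
qed

context lie_algebra
begin

lemma br_zero_left: "y \<in> L \<Longrightarrow> br 0 y = 0"
  using br_scale_left[of 0 y 0] subspace_0[OF subspace_L] by simp

lemma br_zero_right: "x \<in> L \<Longrightarrow> br x 0 = 0"
  using br_scale_right[of x 0 0] subspace_0[OF subspace_L] by simp

lemma br_sum_left:
  "\<lbrakk>\<And>i. i \<in> A \<Longrightarrow> f i \<in> L; y \<in> L\<rbrakk> \<Longrightarrow> br (\<Sum>i\<in>A. f i) y = (\<Sum>i\<in>A. br (f i) y)"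
  by (induction A rule: infinite_finite_induct)
     (auto simp: br_zero_left br_add_left subspace_sum[OF subspace_L])

lemma br_sum_right:
  "\<lbrakk>\<And>i. i \<in> A \<Longrightarrow> f i \<in> L; x \<in> L\<rbrakk> \<Longrightarrow> br x (\<Sum>i\<in>A. f i) = (\<Sum>i\<in>A. br x (f i))"
  by (induction A rule: infinite_finite_induct)
     (auto simp: br_zero_right br_add_right subspace_sum[OF subspace_L])

end

locale periodic_lie_algebra = lie_algebra scale L br
  for scale :: "'k::field_char_0 \<Rightarrow> 'v::ab_group_add \<Rightarrow> 'v" (infixr \<open>\<cdot>\<close> 75) and L br +
  fixes \<theta> :: "'v \<Rightarrow> 'v" and m :: nat and \<zeta> :: 'k
  assumes auto\<theta>: "automorphism \<theta>" and order\<theta>: "has_order \<theta> m" and prim: "primitive_root \<zeta> m"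
begin

abbreviation "eig \<equiv> eigenspace \<theta> \<zeta>"
abbreviation "cpt \<equiv> component \<theta> m \<zeta>"
abbreviation "br0 \<equiv> contraction \<theta> m \<zeta>"

lemma m_pos: "0 < m" using order\<theta> by (simp add: has_order_def)

lemma \<theta>_closed: "x \<in> L \<Longrightarrow> \<theta> x \<in> L"
  using auto\<theta> by (auto simp: automorphism_def bij_betw_def)

lemma \<theta>_add: "\<lbrakk>x \<in> L; y \<in> L\<rbrakk> \<Longrightarrow> \<theta> (x + y) = \<theta> x + \<theta> y"
  and \<theta>_scale: "x \<in> L \<Longrightarrow> \<theta> (c \<cdot> x) = c \<cdot> \<theta> x"
  and \<theta>_br: "\<lbrakk>x \<in> L; y \<in> L\<rbrakk> \<Longrightarrow> \<theta> (br x y) = br (\<theta> x) (\<theta> y)"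
  using auto\<theta> by (auto simp: automorphism_def)

lemma \<theta>_zero: "\<theta> 0 = 0"
  using \<theta>_scale[of 0 0] subspace_0[OF subspace_L] by simp

lemma \<theta>_sum: "(\<And>i. i \<in> A \<Longrightarrow> f i \<in> L) \<Longrightarrow> \<theta> (\<Sum>i\<in>A. f i) = (\<Sum>i\<in>A. \<theta> (f i))"
  by (induction A rule: infinite_finite_induct)
     (auto simp: \<theta>_zero \<theta>_add subspace_sum[OF subspace_L])

lemma pow_closed: "x \<in> L \<Longrightarrow> (\<theta> ^^ k) x \<in> L"
  by (induction k) (auto simp: \<theta>_closed)

lemma pow_add: "\<lbrakk>x \<in> L; y \<in> L\<rbrakk> \<Longrightarrow> (\<theta> ^^ k) (x + y) = (\<theta> ^^ k) x + (\<theta> ^^ k) y"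
  by (induction k) (auto simp: \<theta>_add pow_closed)

lemma pow_scale: "x \<in> L \<Longrightarrow> (\<theta> ^^ k) (c \<cdot> x) = c \<cdot> (\<theta> ^^ k) x"
  by (induction k) (auto simp: \<theta>_scale pow_closed)

lemma pow_sum: "(\<And>i. i \<in> A \<Longrightarrow> f i \<in> L) \<Longrightarrow> (\<theta> ^^ k) (\<Sum>i\<in>A. f i) = (\<Sum>i\<in>A. (\<theta> ^^ k) (f i))"
  by (induction k) (auto simp: \<theta>_sum pow_closed)

lemma eig_L: "x \<in> eig i \<Longrightarrow> x \<in> L" by (simp add: eigenspace_def)

lemma pow_eig: "x \<in> eig i \<Longrightarrow> (\<theta> ^^ k) x = \<zeta> ^ (i * k) \<cdot> x"
  by (induction k) (auto simp: eigenspace_def \<theta>_scale power_add mult.commute)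

lemma eig_subspace: "subspace (eig i)"
  unfolding subspace_def eigenspace_def
  using subspace_L
  by (auto simp: \<theta>_zero \<theta>_add \<theta>_scale scale_right_distrib subspace_0 subspace_add
      subspace_scale mult.commute)

lemma eig_br:
  assumes "x \<in> eig i" "y \<in> eig j" shows "br x y \<in> eig ((i + j) mod m)"
proof -
  have xy: "x \<in> L" "y \<in> L" "\<theta> x = \<zeta> ^ i \<cdot> x" "\<theta> y = \<zeta> ^ j \<cdot> y"
    using assms by (auto simp: eigenspace_def)
  have "\<theta> (br x y) = \<zeta> ^ (i + j) \<cdot> br x y"
    using xy by (simp add: \<theta>_br br_scale_left br_scale_right subspace_scale[OF subspace_L]
        power_add mult.commute)
  then show ?thesis using xy by (simp add: eigenspace_def br_closed primitive_root_power_mod[OF prim])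
qed

definition proj :: "nat \<Rightarrow> 'v \<Rightarrow> 'v" where
  "proj i x = inverse (of_nat m) \<cdot> (\<Sum>k<m. inverse (\<zeta> ^ (i * k)) \<cdot> (\<theta> ^^ k) x)"

lemma proj_L: "x \<in> L \<Longrightarrow> proj i x \<in> L"
  unfolding proj_def
  by (intro subspace_scale[OF subspace_L] subspace_sum[OF subspace_L] pow_closed)

lemma proj_sum:
  assumes "x \<in> L" shows "(\<Sum>i<m. proj i x) = x"
proof -
  have geo: "(\<Sum>i<m. inverse (\<zeta> ^ (i * k))) = (if k = 0 then of_nat m else 0)" if "k < m" for k
    using primitive_root_sum[OF prim m_pos that] by (cases "k = 0") (simp_all add: mult.commute)
  have "(\<Sum>i<m. proj i x)
      = inverse (of_nat m) \<cdot> (\<Sum>i<m. \<Sum>k<m. inverse (\<zeta> ^ (i * k)) \<cdot> (\<theta> ^^ k) x)"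
    by (simp add: proj_def scale_sum_right)
  also have "(\<Sum>i<m. \<Sum>k<m. inverse (\<zeta> ^ (i * k)) \<cdot> (\<theta> ^^ k) x)
      = (\<Sum>k<m. (\<Sum>i<m. inverse (\<zeta> ^ (i * k))) \<cdot> (\<theta> ^^ k) x)"
    by (subst sum.swap) (simp add: scale_sum_left)
  also have "\<dots> = (\<Sum>k<m. if k = 0 then of_nat m \<cdot> x else 0)"
    by (intro sum.cong) (auto simp: geo)
  also have "\<dots> = of_nat m \<cdot> x" using m_pos by simp
  finally show ?thesis using m_pos by simp
qed

lemma proj_eig:
  assumes x: "x \<in> L" shows "proj i x \<in> eig i"
proof -
  let ?f = "\<lambda>k. inverse (\<zeta> ^ (i * k)) \<cdot> (\<theta> ^^ k) x"
  have nz: "\<zeta> \<noteq> 0" by (rule primitive_root_nz[OF prim])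
  have fL: "?f k \<in> L" for k by (intro subspace_scale[OF subspace_L] pow_closed x)
  have fm: "?f m = ?f 0"
    using order\<theta> prim x
    by (simp add: has_order_def primitive_root_def power_mult mult.commute[of i])
  have step: "\<theta> (?f k) = \<zeta> ^ i \<cdot> ?f (Suc k)" for k
    using x nz by (simp add: \<theta>_scale pow_closed power_add field_simps)
  have "\<theta> (\<Sum>k<m. ?f k) = (\<Sum>k<m. \<zeta> ^ i \<cdot> ?f (Suc k))"
    by (subst \<theta>_sum) (simp_all only: fL step)
  also have "\<dots> = \<zeta> ^ i \<cdot> (\<Sum>k<m. ?f (Suc k))" by (rule scale_sum_right[symmetric])
  also have "(\<Sum>k<m. ?f (Suc k)) = (\<Sum>k<m. ?f k)"
  proof -
    have "?f 0 + (\<Sum>k<m. ?f (Suc k)) = (\<Sum>k<Suc m. ?f k)"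
      by (rule sum.lessThan_Suc_shift[symmetric])
    also have "\<dots> = (\<Sum>k<m. ?f k) + ?f m" by (rule sum.lessThan_Suc)
    finally show ?thesis using fm by (simp only: add.commute add_left_cancel)
  qed
  finally have *: "\<theta> (\<Sum>k<m. ?f k) = \<zeta> ^ i \<cdot> (\<Sum>k<m. ?f k)" .
  have "(\<Sum>k<m. ?f k) \<in> eig i"
    unfolding eigenspace_def using * subspace_sum[OF subspace_L, of "{..<m}" ?f] fL by blast
  then show ?thesis unfolding proj_def by (rule subspace_scale[OF eig_subspace])
qed

lemma proj_of_sum:
  assumes c: "\<forall>j<m. c j \<in> eig j" and i: "i < m"
  shows "proj i (\<Sum>j<m. c j) = c i"
proof -
  have cL: "j < m \<Longrightarrow> c j \<in> L" for j using c eig_L by blast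
  have "(\<Sum>k<m. inverse (\<zeta> ^ (i * k)) \<cdot> (\<theta> ^^ k) (\<Sum>j<m. c j))
      = (\<Sum>k<m. \<Sum>j<m. (inverse (\<zeta> ^ (i * k)) * \<zeta> ^ (j * k)) \<cdot> c j)"
  proof (intro sum.cong refl)
    fix k
    have "(\<theta> ^^ k) (\<Sum>j<m. c j) = (\<Sum>j<m. (\<theta> ^^ k) (c j))" by (rule pow_sum) (simp add: cL)
    also have "\<dots> = (\<Sum>j<m. \<zeta> ^ (j * k) \<cdot> c j)"
      using c by (intro sum.cong refl) (simp add: pow_eig)
    finally show "inverse (\<zeta> ^ (i * k)) \<cdot> (\<theta> ^^ k) (\<Sum>j<m. c j)
        = (\<Sum>j<m. (inverse (\<zeta> ^ (i * k)) * \<zeta> ^ (j * k)) \<cdot> c j)"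
      by (simp add: scale_sum_right)
  qed
  also have "\<dots> = (\<Sum>j<m. (\<Sum>k<m. inverse (\<zeta> ^ (i * k)) * \<zeta> ^ (j * k)) \<cdot> c j)"
    by (subst sum.swap) (simp add: scale_sum_left)
  also have "\<dots> = (\<Sum>j<m. if j = i then of_nat m \<cdot> c i else 0)"
    using i by (intro sum.cong refl) (simp add: primitive_root_sum[OF prim])
  also have "\<dots> = of_nat m \<cdot> c i" using i by simp
  finally show ?thesis using m_pos by (simp add: proj_def)
qed

lemma comp_eq_proj:
  assumes "x \<in> L" "i < m" shows "cpt i x = proj i x"
  unfolding component_def
proof (rule the_equality)
  show "\<exists>c. (\<forall>j<m. c j \<in> eig j) \<and> x = (\<Sum>j<m. c j) \<and> proj i x = c i"
    using proj_sum[OF assms(1)] proj_eig[OF assms(1)] by metis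
next
  fix y assume "\<exists>c. (\<forall>j<m. c j \<in> eig j) \<and> x = (\<Sum>j<m. c j) \<and> y = c i"
  then show "y = proj i x" using proj_of_sum assms(2) by metis
qed

lemma component_decomposition:
  assumes "x \<in> L"
  shows "x = (\<Sum>i<m. cpt i x)" and "i < m \<Longrightarrow> cpt i x \<in> eig i"
  using assms by (simp_all add: comp_eq_proj proj_sum proj_eig)

lemma component_unique:
  assumes "\<forall>j<m. c j \<in> eig j" "i < m" shows "cpt i (\<Sum>j<m. c j) = c i"
  using assms
  by (subst comp_eq_proj) (auto intro!: subspace_sum[OF subspace_L] proj_of_sum dest: eig_L)

lemma comp_L: "\<lbrakk>x \<in> L; i < m\<rbrakk> \<Longrightarrow> cpt i x \<in> L"
  using component_decomposition(2) eig_L by blast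

lemma comp_add: "\<lbrakk>x \<in> L; y \<in> L; i < m\<rbrakk> \<Longrightarrow> cpt i (x + y) = cpt i x + cpt i y"
  by (simp add: comp_eq_proj subspace_add[OF subspace_L] proj_def pow_add scale_right_distrib
      sum.distrib)

lemma comp_scale: "\<lbrakk>x \<in> L; i < m\<rbrakk> \<Longrightarrow> cpt i (a \<cdot> x) = a \<cdot> cpt i x"
  by (simp add: comp_eq_proj subspace_scale[OF subspace_L] proj_def pow_scale scale_sum_right
      mult_ac)

lemma comp_homogeneous:
  assumes "x \<in> eig i" "i < m" "j < m" shows "cpt j x = (if j = i then x else 0)"
proof -
  have "\<forall>k<m. (if k = i then x else 0) \<in> eig k"
    using assms subspace_0[OF eig_subspace] by auto
  from component_unique[OF this \<open>j < m\<close>] show ?thesis using assms by simp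
qed

lemma contraction_homogeneous:
  assumes "x \<in> eig i" "y \<in> eig j" "i < m" "j < m"
  shows "br0 x y = (if i + j \<le> m - 1 then br x y else 0)"
proof -
  have "(if k + l \<le> m - 1 then br (cpt k x) (cpt l y) else 0)
      = (if k = i then if l = j then if i + j \<le> m - 1 then br x y else 0 else 0 else 0)"
    if "k < m" "l < m" for k l
    using that assms
    by (simp add: comp_homogeneous eig_L br_zero_left br_zero_right subspace_0[OF subspace_L])
  then have "br0 x y
      = (\<Sum>k<m. \<Sum>l<m. if k = i then if l = j then if i + j \<le> m - 1 then br x y else 0 else 0 else 0)"
    unfolding contraction_def by (intro sum.cong) auto
  also have "\<dots> = (\<Sum>k<m. if k = i then if i + j \<le> m - 1 then br x y else 0 else 0)"
    using assms by (intro sum.cong) auto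
  also have "\<dots> = (if i + j \<le> m - 1 then br x y else 0)" using assms by simp
  finally show ?thesis .
qed

lemma br0_closed: "\<lbrakk>x \<in> L; y \<in> L\<rbrakk> \<Longrightarrow> br0 x y \<in> L"
  unfolding contraction_def
  by (intro subspace_sum[OF subspace_L]) (auto simp: br_closed comp_L subspace_0[OF subspace_L])

lemma br0_add_left: "\<lbrakk>x \<in> L; x' \<in> L; y \<in> L\<rbrakk> \<Longrightarrow> br0 (x + x') y = br0 x y + br0 x' y"
  unfolding contraction_def sum.distrib[symmetric]
  by (intro sum.cong) (auto simp: comp_add br_add_left comp_L)

lemma br0_add_right: "\<lbrakk>x \<in> L; y \<in> L; y' \<in> L\<rbrakk> \<Longrightarrow> br0 x (y + y') = br0 x y + br0 x y'"
  unfolding contraction_def sum.distrib[symmetric]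
  by (intro sum.cong) (auto simp: comp_add br_add_right comp_L)

lemma br0_scale_left: "\<lbrakk>x \<in> L; y \<in> L\<rbrakk> \<Longrightarrow> br0 (a \<cdot> x) y = a \<cdot> br0 x y"
  unfolding contraction_def scale_sum_right
  by (intro sum.cong) (auto simp: comp_scale br_scale_left comp_L)

lemma br0_scale_right: "\<lbrakk>x \<in> L; y \<in> L\<rbrakk> \<Longrightarrow> br0 x (a \<cdot> y) = a \<cdot> br0 x y"
  unfolding contraction_def scale_sum_right
  by (intro sum.cong) (auto simp: comp_scale br_scale_right comp_L)

lemma br_anti:
  assumes "x \<in> L" "y \<in> L" shows "br x y = - br y x"
proof -
  have xy: "x + y \<in> L" by (rule subspace_add[OF subspace_L assms])
  have "0 = br (x + y) (x + y)" using br_alternating[OF xy] by simp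
  also have "\<dots> = br x (x + y) + br y (x + y)" using assms xy by (rule br_add_left)
  also have "\<dots> = br x y + br y x" using assms by (simp add: br_add_right br_alternating)
  finally show ?thesis by (simp add: eq_neg_iff_add_eq_0)
qed

lemma br0_anti:
  assumes "x \<in> L" "y \<in> L" shows "br0 x y = - br0 y x"
proof -
  have "br0 x y = (\<Sum>j<m. \<Sum>i<m. if i + j \<le> m - 1 then br (cpt i x) (cpt j y) else 0)"
    unfolding contraction_def by (rule sum.swap)
  also have "\<dots> = (\<Sum>j<m. \<Sum>i<m. - (if j + i \<le> m - 1 then br (cpt j y) (cpt i x) else 0))"
  proof (intro sum.cong refl)
    fix i j assume "j \<in> {..<m}" "i \<in> {..<m}"
    then have "br (cpt i x) (cpt j y) = - br (cpt j y) (cpt i x)"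
      by (intro br_anti comp_L) (simp_all add: assms)
    then show "(if i + j \<le> m - 1 then br (cpt i x) (cpt j y) else 0)
        = - (if j + i \<le> m - 1 then br (cpt j y) (cpt i x) else 0)"
      by (simp only: add.commute[of j i]) simp
  qed
  also have "\<dots> = - br0 y x" by (simp add: contraction_def sum_negf)
  finally show ?thesis .
qed

lemma br0_alternating:
  assumes "x \<in> L" shows "br0 x x = 0"
proof -
  have "br0 x x + br0 x x = 0" using br0_anti[OF assms assms] by (simp add: eq_neg_iff_add_eq_0)
  then have "(2::'k) \<cdot> br0 x x = 0" using scale_left_distrib[of 1 1 "br0 x x"] by simp
  then show ?thesis by simp
qed

lemma br0_sum_left:
  "\<lbrakk>\<And>i. i \<in> A \<Longrightarrow> f i \<in> L; y \<in> L\<rbrakk> \<Longrightarrow> br0 (\<Sum>i\<in>A. f i) y = (\<Sum>i\<in>A. br0 (f i) y)"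
  using br0_scale_left[of 0 y 0] subspace_0[OF subspace_L]
  by (induction A rule: infinite_finite_induct)
     (auto simp: br0_add_left subspace_sum[OF subspace_L])

lemma br0_sum_right:
  "\<lbrakk>\<And>i. i \<in> A \<Longrightarrow> f i \<in> L; x \<in> L\<rbrakk> \<Longrightarrow> br0 x (\<Sum>i\<in>A. f i) = (\<Sum>i\<in>A. br0 x (f i))"
  using br0_scale_right[of x 0 0] subspace_0[OF subspace_L]
  by (induction A rule: infinite_finite_induct)
     (auto simp: br0_add_right subspace_sum[OF subspace_L])

lemma br0_br0_homogeneous:
  assumes "x \<in> eig i" "y \<in> eig j" "z \<in> eig k" "i < m" "j < m" "k < m"
  shows "br0 x (br0 y z) = (if i + j + k \<le> m - 1 then br x (br y z) else 0)"
proof (cases "j + k \<le> m - 1")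
  case True
  then have lt: "j + k < m" using m_pos by linarith
  then have "br y z \<in> eig (j + k)" using eig_br[OF assms(2,3)] by simp
  then show ?thesis
    using contraction_homogeneous[OF assms(1) _ assms(4) lt] contraction_homogeneous[OF assms(2,3,5,6)]
      True by (simp add: add.assoc)
next
  case False
  then show ?thesis
    using contraction_homogeneous[OF assms(2,3,5,6)] br0_scale_right[of x 0 0]
      subspace_0[OF subspace_L] eig_L[OF assms(1)] by simp
qed

lemma br0_br0_expand:
  assumes "x \<in> L" "y \<in> L" "z \<in> L"
  shows "br0 x (br0 y z)
    = (\<Sum>i<m. \<Sum>j<m. \<Sum>k<m. br0 (cpt i x) (br0 (cpt j y) (cpt k z)))"
proof -
  have "br0 y z = br0 (\<Sum>j<m. cpt j y) (\<Sum>k<m. cpt k z)"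
    using component_decomposition(1) assms by simp
  also have "\<dots> = (\<Sum>j<m. br0 (cpt j y) (\<Sum>k<m. cpt k z))"
    by (rule br0_sum_left) (auto intro!: subspace_sum[OF subspace_L] comp_L assms)
  also have "\<dots> = (\<Sum>j<m. \<Sum>k<m. br0 (cpt j y) (cpt k z))"
    by (intro sum.cong refl br0_sum_right) (auto intro!: comp_L assms)
  finally have yz: "br0 y z = (\<Sum>j<m. \<Sum>k<m. br0 (cpt j y) (cpt k z))" .
  have "br0 x (br0 y z) = br0 (\<Sum>i<m. cpt i x) (br0 y z)"
    using component_decomposition(1) assms by simp
  also have "\<dots> = (\<Sum>i<m. br0 (cpt i x) (br0 y z))"
    by (rule br0_sum_left) (auto intro!: comp_L br0_closed assms)
  also have "\<dots> = (\<Sum>i<m. \<Sum>j<m. \<Sum>k<m. br0 (cpt i x) (br0 (cpt j y) (cpt k z)))"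
  proof (intro sum.cong refl)
    fix i assume i: "i \<in> {..<m}"
    have "br0 (cpt i x) (br0 y z) = (\<Sum>j<m. br0 (cpt i x) (\<Sum>k<m. br0 (cpt j y) (cpt k z)))"
      unfolding yz using i
      by (intro br0_sum_right) (auto intro!: subspace_sum[OF subspace_L] comp_L br0_closed assms)
    also have "\<dots> = (\<Sum>j<m. \<Sum>k<m. br0 (cpt i x) (br0 (cpt j y) (cpt k z)))"
      using i by (intro sum.cong refl br0_sum_right) (auto intro!: comp_L br0_closed assms)
    finally show "br0 (cpt i x) (br0 y z)
        = (\<Sum>j<m. \<Sum>k<m. br0 (cpt i x) (br0 (cpt j y) (cpt k z)))" .
  qed
  finally show ?thesis .
qed

lemma br0_jacobi:
  assumes "x \<in> L" "y \<in> L" "z \<in> L"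
  shows "br0 x (br0 y z) + br0 y (br0 z x) + br0 z (br0 x y) = 0"
proof -
  let ?t = "\<lambda>x y z i j k. br0 (cpt i x) (br0 (cpt j y) (cpt k z))"
  have 2: "br0 y (br0 z x) = (\<Sum>i<m. \<Sum>j<m. \<Sum>k<m. ?t y z x j k i)"
  proof -
    have "br0 y (br0 z x) = (\<Sum>j<m. \<Sum>k<m. \<Sum>i<m. ?t y z x j k i)"
      using br0_br0_expand assms by simp
    also have "\<dots> = (\<Sum>j<m. \<Sum>i<m. \<Sum>k<m. ?t y z x j k i)"
      by (intro sum.cong refl sum.swap)
    also have "\<dots> = (\<Sum>i<m. \<Sum>j<m. \<Sum>k<m. ?t y z x j k i)" by (rule sum.swap)
    finally show ?thesis .
  qed
  have 3: "br0 z (br0 x y) = (\<Sum>i<m. \<Sum>j<m. \<Sum>k<m. ?t z x y k i j)"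
  proof -
    have "br0 z (br0 x y) = (\<Sum>k<m. \<Sum>i<m. \<Sum>j<m. ?t z x y k i j)"
      using br0_br0_expand assms by simp
    also have "\<dots> = (\<Sum>i<m. \<Sum>k<m. \<Sum>j<m. ?t z x y k i j)" by (rule sum.swap)
    also have "\<dots> = (\<Sum>i<m. \<Sum>j<m. \<Sum>k<m. ?t z x y k i j)"
      by (intro sum.cong refl sum.swap)
    finally show ?thesis .
  qed
  have *: "?t x y z i j k + ?t y z x j k i + ?t z x y k i j = 0"
    if "i < m" "j < m" "k < m" for i j k
  proof -
    have e: "cpt i x \<in> eig i" "cpt j y \<in> eig j" "cpt k z \<in> eig k"
      using component_decomposition(2) assms that by auto
    show ?thesis
      using br0_br0_homogeneous[OF e that] br0_br0_homogeneous[OF e(2,3,1) that(2,3,1)]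
        br0_br0_homogeneous[OF e(3,1,2) that(3,1,2)] jacobi[OF e[THEN eig_L]]
      by (simp add: add_ac)
  qed
  have "br0 x (br0 y z) + br0 y (br0 z x) + br0 z (br0 x y)
      = (\<Sum>i<m. \<Sum>j<m. \<Sum>k<m. ?t x y z i j k + ?t y z x j k i + ?t z x y k i j)"
    unfolding 2 3 br0_br0_expand[OF assms] by (simp add: sum.distrib)
  also have "\<dots> = 0" using * by simp
  finally show ?thesis .
qed

theorem lie_algebra_contraction: "lie_algebra scale L br0"
  by unfold_locales
     (auto simp: subspace_L br0_closed br0_add_left br0_add_right br0_scale_left br0_scale_right
       br0_alternating br0_jacobi)

end


section \<open>The symplectic Lie algebra\<close>

definition mat_scale :: "'k::times \<Rightarrow> 'k^'n^'m \<Rightarrow> 'k^'n^'m" where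
  "mat_scale c A = (\<chi> i. c *s (A $ i))"

text \<open>The standard alternating form on \<open>\<bbbk>\<^bsup>2l\<^esup>\<close> with \<open>l = CARD('n)\<close>: the index type \<open>'n + 'n\<close>
  splits the coordinates into two blocks of size \<open>l\<close>.\<close>

definition symplectic_form :: "'k::comm_ring_1 ^ ('n::finite + 'n) ^ ('n + 'n)" where
  "symplectic_form = (\<chi> i j. case (i, j) of
      (Inl a, Inr b) \<Rightarrow> if a = b then 1 else 0
    | (Inr a, Inl b) \<Rightarrow> if a = b then - 1 else 0
    | _ \<Rightarrow> 0)"

definition sp_algebra :: "('k::comm_ring_1 ^ ('n::finite + 'n) ^ ('n + 'n)) set" where
  "sp_algebra = {X. transpose X ** symplectic_form + symplectic_form ** X = 0}"

definition commutator :: "'k::ring_1 ^ 'n ^ 'n \<Rightarrow> 'k ^ 'n ^ 'n \<Rightarrow> 'k ^ 'n ^ 'n" where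
  "commutator X Y = X ** Y - Y ** X"

lemma mat_mul_add_left: "((A::'k::ring_1^'n^'m) + B) ** C = A ** C + B ** C"
  by (simp add: vec_eq_iff matrix_matrix_mult_def sum.distrib distrib_right)

lemma mat_mul_diff_left: "((A::'k::ring_1^'n^'m) - B) ** C = A ** C - B ** C"
  by (simp add: vec_eq_iff matrix_matrix_mult_def sum_subtractf left_diff_distrib)

lemma mat_mul_diff_right: "(A::'k::ring_1^'n^'m) ** (B - C) = A ** B - A ** C"
  by (simp add: vec_eq_iff matrix_matrix_mult_def sum_subtractf right_diff_distrib)

lemma mat_mul_scale_left: "mat_scale c (A::'k::comm_ring_1^'n^'m) ** B = mat_scale c (A ** B)"
  by (simp add: vec_eq_iff matrix_matrix_mult_def mat_scale_def sum_distrib_left mult_ac)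

lemma mat_mul_scale_right: "(A::'k::comm_ring_1^'n^'m) ** mat_scale c B = mat_scale c (A ** B)"
  by (simp add: vec_eq_iff matrix_matrix_mult_def mat_scale_def sum_distrib_left mult_ac)

lemma mat_scale_add: "mat_scale c ((A::'k::comm_ring_1^'n^'m) + B) = mat_scale c A + mat_scale c B"
  by (simp add: vec_eq_iff mat_scale_def distrib_left)

lemma mat_scale_diff: "mat_scale c ((A::'k::comm_ring_1^'n^'m) - B) = mat_scale c A - mat_scale c B"
  by (simp add: vec_eq_iff mat_scale_def right_diff_distrib)

lemma transpose_linear:
  "transpose ((A::'k::comm_ring_1^'n^'m) + B) = transpose A + transpose B"
  "transpose ((A::'k::comm_ring_1^'n^'m) - B) = transpose A - transpose B"
  "transpose (mat_scale c (A::'k::comm_ring_1^'n^'m)) = mat_scale c (transpose A)"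
  by (simp_all add: vec_eq_iff transpose_def mat_scale_def)

lemma sp_algebra_iff:
  "X \<in> sp_algebra \<longleftrightarrow> transpose X ** symplectic_form = - (symplectic_form ** X)"
  by (simp add: sp_algebra_def eq_neg_iff_add_eq_0)

lemma mat_mul_minus:
  "(- (A::'k::ring_1^'n^'m)) ** B = - (A ** B)" "(A::'k::ring_1^'n^'m) ** (- C) = - (A ** C)"
  by (simp_all add: vec_eq_iff matrix_matrix_mult_def sum_negf)

lemma commutator_sp:
  assumes "X \<in> sp_algebra" "Y \<in> sp_algebra" shows "commutator X Y \<in> sp_algebra"
proof -
  let ?J = symplectic_form
  have *: "transpose (A ** B) ** ?J = ?J ** (B ** A)"
    if "A \<in> sp_algebra" "B \<in> sp_algebra" for A B :: "'a ^ ('b + 'b) ^ ('b + 'b)"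
  proof -
    have "transpose (A ** B) ** ?J = transpose B ** (transpose A ** ?J)"
      by (simp add: matrix_transpose_mul matrix_mul_assoc)
    also have "\<dots> = - ((transpose B ** ?J) ** A)"
      using that by (simp add: sp_algebra_iff mat_mul_minus matrix_mul_assoc)
    also have "\<dots> = ?J ** (B ** A)"
      using that by (simp add: sp_algebra_iff mat_mul_minus matrix_mul_assoc)
    finally show ?thesis .
  qed
  show ?thesis
    using *[OF assms] *[OF assms(2,1)]
    by (simp add: sp_algebra_iff commutator_def transpose_linear mat_mul_diff_left
        mat_mul_diff_right)
qed

lemma vector_space_mat_scale: "vector_space (mat_scale :: 'k::field \<Rightarrow> 'k^'n^'m \<Rightarrow> _)"
  by unfold_locales (simp_all add: vec_eq_iff mat_scale_def algebra_simps)

global_interpretation sp: lie_algebra mat_scale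
  "sp_algebra :: ('k::field ^ ('n::finite + 'n) ^ ('n + 'n)) set" commutator
proof -
  interpret vector_space "mat_scale :: 'k \<Rightarrow> 'k ^ ('n + 'n) ^ ('n + 'n) \<Rightarrow> _"
    by (rule vector_space_mat_scale)
  show "lie_algebra mat_scale (sp_algebra :: ('k ^ ('n + 'n) ^ ('n + 'n)) set) commutator"
  proof
    show "subspace (sp_algebra :: ('k ^ ('n + 'n) ^ ('n + 'n)) set)"
      unfolding subspace_def
    proof (intro conjI ballI allI)
      show "(0 :: 'k ^ ('n + 'n) ^ ('n + 'n)) \<in> sp_algebra"
        by (simp add: sp_algebra_def vec_eq_iff matrix_matrix_mult_def transpose_def)
    next
      fix x y :: "'k ^ ('n + 'n) ^ ('n + 'n)" assume "x \<in> sp_algebra" "y \<in> sp_algebra"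
      then show "x + y \<in> sp_algebra"
        by (simp add: sp_algebra_iff transpose_linear mat_mul_add_left matrix_add_ldistrib)
    next
      fix c and x :: "'k ^ ('n + 'n) ^ ('n + 'n)" assume "x \<in> sp_algebra"
      then show "mat_scale c x \<in> sp_algebra"
        by (simp add: sp_algebra_iff transpose_linear mat_mul_scale_left mat_mul_scale_right)
    qed
  qed (simp_all add: commutator_sp, simp_all add: commutator_def mat_mul_add_left matrix_add_ldistrib
      mat_mul_scale_left mat_mul_scale_right mat_scale_diff mat_mul_diff_left mat_mul_diff_right
      matrix_mul_assoc)
qed

end

theory Submission
  imports Defs
begin

text \<open>Dualising by the trace form, the odd powers \<open>A, A\<^sup>3, \<dots>, A\<^bsup>2l-1\<^esup>\<close> lie in the stabiliser of
  \<open>A \<in> \<gg>\<close> and are independent for generic \<open>A\<close>, so \<open>l \<le> ind \<gg>\<close>. Rescaling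
  \<open>\<gg>\<^sub>i\<close> by \<open>s\<^sup>i\<close> makes \<open>\<gg>\<^bsub>(0)\<^esub>\<close> a degeneration of \<open>\<gg>\<close>, so
  \<open>ind \<gg> \<le> ind \<gg>\<^bsub>(0)\<^esub>\<close> by semicontinuity.

  For \<open>ind \<gg>\<^bsub>(0)\<^esub> \<le> l\<close>, the automorphism preserves the set of extremal elements \<open>v\<^sup>2\<close> of
  \<open>\<gg> = S\<^sup>2V\<close>, hence is conjugation by some symplectic \<open>S\<close>, and since \<open>m\<close> is odd the sign of \<open>S\<close> can be
  chosen such that \<open>S\<^sup>m = 1\<close>. A symplectic basis of eigenvectors of \<open>S\<close> has eigenvalues \<open>\<zeta>\<^sup>a\<close> with
  \<open>\<bar>a\<bar> < m/2\<close>, which shows that \<open>\<gg>\<^bsub>(0)\<^esub>\<close> only depends on the order of the levels \<open>a\<close>: the basis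
  elements with level sum \<open>\<ge> 0\<close> span a parabolic subalgebra, the other ones an abelian ideal. A linear form whose
  stabiliser has dimension at most \<open>l\<close> is then built from blocks of the basis. A row, that is one vector
  on each nonzero level, carries a cyclic form; the rows are put together by a generic linear
  combination. A pair of level \<open>0\<close> is added to at most two rows at a time, by a first order perturbation.\<close>

section \<open>Semicontinuity\<close>

text \<open>The stabiliser is measured by a set \<open>Z\<close> of at most \<open>l\<close> entries
  whose vanishing kills it: this condition survives generic perturbation and adds up over orthogonal
  blocks, as soon as one block carries a form without stabiliser elements towards the other.

  The obstacle is level 0. A row is closed under \<open>star\<close> and has distinct levels, so it
  misses level 0, which \<open>u\<close> and \<open>star u\<close> share. Its cyclic form is
  degenerate there: among the products with \<open>u\<close>, the one with the vector
  \<open>f\<close> just below level 0 survives. Over \<open>r\<close> rows, the \<open>2 r\<close>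
  products of the vectors \<open>f\<close> with \<open>u\<close> and \<open>star u\<close> lie in
  the abelian ideal, so a form pairs them only with the 3 products of \<open>u\<close> and
  \<open>star u\<close>, and to first order at least \<open>2 r - 3\<close> dimensions remain. The
  pair may contribute only 1, whence \<open>r \<le> 2\<close>. Two rows are also enough to go on:
  the negative half of one row, \<open>u\<close> and the positive half of the other form a chain
  disjoint from its dual. Its levels include all those that remain, so its cyclic form separates the
  block from the rest.\<close>

lemma independent_rows_generic:
  fixes A :: "'i \<Rightarrow> 'j \<Rightarrow> 'k::field poly"
  assumes "finite I"
    and "\<And>c. \<forall>j\<in>J. (\<Sum>i\<in>I. c i * poly (A i j) 0) = 0 \<Longrightarrow> \<forall>i\<in>I. c i = 0"
  shows "\<exists>p. p \<noteq> 0 \<and> (\<forall>t. poly p t \<noteq> 0 \<longrightarrow>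
    (\<forall>c. (\<forall>j\<in>J. (\<Sum>i\<in>I. c i * poly (A i j) t) = 0) \<longrightarrow> (\<forall>i\<in>I. c i = 0)))"
  using assms
proof (induction I arbitrary: A rule: finite_induct)
  case empty
  then show ?case by (intro exI[of _ 1]) auto
next
  case (insert k I)
  have "\<exists>j\<in>J. poly (A k j) 0 \<noteq> 0"
  proof (rule ccontr)
    assume "\<not> ?thesis"
    then have "\<forall>j\<in>J. (\<Sum>i\<in>insert k I. (if i = k then 1 else 0) * poly (A i j) 0) = 0"
      using insert.hyps by (auto intro!: sum.neutral)
    from insert.prems[OF this] show False by simp
  qed
  then obtain l where l: "l \<in> J" "poly (A k l) 0 \<noteq> 0" by blast
  \<comment> \<open>Division-free elimination with pivot row \<open>k\<close> and column
    \<open>l\<close>. The polynomial obtained in the end is the product of the pivots, none of which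
    vanishes at 0.\<close>
  define A' where "A' i j = A k l * A i j - A i l * A k j" for i j
  have A': "(\<Sum>i\<in>I. c i * poly (A' i j) t)
      = poly (A k l) t * (\<Sum>i\<in>I. c i * poly (A i j) t) - (\<Sum>i\<in>I. c i * poly (A i l) t) * poly (A k j) t"
    for c j t
    by (simp add: A'_def sum_distrib_left sum_distrib_right sum_subtractf algebra_simps)
  have elim: "(\<forall>j\<in>J. (\<Sum>i\<in>insert k I. c i * poly (A i j) t) = 0)
      \<Longrightarrow> \<forall>j\<in>J. (\<Sum>i\<in>I. c i * poly (A' i j) t) = 0" for c t
  proof
    fix j assume *: "\<forall>j\<in>J. (\<Sum>i\<in>insert k I. c i * poly (A i j) t) = 0" and j: "j \<in> J"
    have e: "(\<Sum>i\<in>I. c i * poly (A i j) t) = - c k * poly (A k j) t" if "j \<in> J" for j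
      using bspec[OF * that] insert.hyps by (simp add: add_eq_0_iff)
    show "(\<Sum>i\<in>I. c i * poly (A' i j) t) = 0" unfolding A' e[OF j] e[OF l(1)] by simp
  qed
  have "\<forall>i\<in>I. c i = 0" if c: "\<forall>j\<in>J. (\<Sum>i\<in>I. c i * poly (A' i j) 0) = 0" for c
  proof -
    \<comment> \<open>A relation \<open>c\<close> of the eliminated rows at 0 lifts to a relation
      \<open>d\<close> of the original ones; its coefficient at \<open>k\<close> is forced by column
      \<open>l\<close>.\<close>
    define d where "d i = (if i = k then - (\<Sum>i\<in>I. c i * poly (A i l) 0) else poly (A k l) 0 * c i)" for i
    have "(\<Sum>i\<in>insert k I. d i * poly (A i j) 0) = (\<Sum>i\<in>I. c i * poly (A' i j) 0)" for j
    proof -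
      have "(\<Sum>i\<in>I. d i * poly (A i j) 0) = poly (A k l) 0 * (\<Sum>i\<in>I. c i * poly (A i j) 0)"
        using insert.hyps by (auto simp: d_def sum_distrib_left intro!: sum.cong)
      then show ?thesis using insert.hyps by (simp add: A' d_def)
    qed
    then have "\<forall>j\<in>J. (\<Sum>i\<in>insert k I. d i * poly (A i j) 0) = 0" using c by simp
    from insert.prems[OF this] have "d i = 0" if "i \<in> I" for i using that by blast
    then show ?thesis using l(2) insert.hyps by (metis d_def mult_eq_0_iff)
  qed
  then have "\<exists>p. p \<noteq> 0 \<and> (\<forall>t. poly p t \<noteq> 0 \<longrightarrow>
      (\<forall>c. (\<forall>j\<in>J. (\<Sum>i\<in>I. c i * poly (A' i j) t) = 0) \<longrightarrow> (\<forall>i\<in>I. c i = 0)))"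
    by (rule insert.IH)
  then obtain p where p: "p \<noteq> 0" "\<forall>t. poly p t \<noteq> 0 \<longrightarrow>
      (\<forall>c. (\<forall>j\<in>J. (\<Sum>i\<in>I. c i * poly (A' i j) t) = 0) \<longrightarrow> (\<forall>i\<in>I. c i = 0))"
    by (elim exE conjE)
  show ?case
  proof (intro exI[of _ "p * A k l"] conjI allI impI)
    show "p * A k l \<noteq> 0" using p(1) l(2) by auto
  next
    fix t c assume t: "poly (p * A k l) t \<noteq> 0"
      and c: "\<forall>j\<in>J. (\<Sum>i\<in>insert k I. c i * poly (A i j) t) = 0"
    have 0: "\<forall>i\<in>I. c i = 0" using p(2)[rule_format, of t c] elim[OF c] t by auto
    have "c k * poly (A k l) t = 0" using bspec[OF c l(1)] 0 insert.hyps by simp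
    then show "\<forall>i\<in>insert k I. c i = 0" using 0 t by simp
  qed
qed

lemma finite_nonindependent_rows:
  fixes A :: "'i \<Rightarrow> 'j \<Rightarrow> 'k::field poly"
  assumes "finite I"
    and "\<And>c. \<forall>j\<in>J. (\<Sum>i\<in>I. c i * poly (A i j) 0) = 0 \<Longrightarrow> \<forall>i\<in>I. c i = 0"
  shows "finite {t. \<exists>c. (\<forall>j\<in>J. (\<Sum>i\<in>I. c i * poly (A i j) t) = 0) \<and> (\<exists>i\<in>I. c i \<noteq> 0)}"
proof -
  have "\<exists>p. p \<noteq> 0 \<and> (\<forall>t. poly p t \<noteq> 0 \<longrightarrow>
      (\<forall>c. (\<forall>j\<in>J. (\<Sum>i\<in>I. c i * poly (A i j) t) = 0) \<longrightarrow> (\<forall>i\<in>I. c i = 0)))"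
    by (rule independent_rows_generic) (fact assms)+
  then obtain p where p: "p \<noteq> 0" "\<forall>t. poly p t \<noteq> 0 \<longrightarrow>
      (\<forall>c. (\<forall>j\<in>J. (\<Sum>i\<in>I. c i * poly (A i j) t) = 0) \<longrightarrow> (\<forall>i\<in>I. c i = 0))"
    by (elim exE conjE)
  have "{t. \<exists>c. (\<forall>j\<in>J. (\<Sum>i\<in>I. c i * poly (A i j) t) = 0) \<and> (\<exists>i\<in>I. c i \<noteq> 0)} \<subseteq> {t. poly p t = 0}"
  proof (intro subsetI CollectI, elim CollectE exE conjE)
    fix t c assume "\<forall>j\<in>J. (\<Sum>i\<in>I. c i * poly (A i j) t) = 0" "\<exists>i\<in>I. c i \<noteq> 0"
    then show "poly p t = 0" using p(2) by auto
  qed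
  then show ?thesis using poly_roots_finite[OF p(1)] by (rule finite_subset)
qed

text \<open>A parameter and its inverse are controlled together because
  \<open>\<xi> + t \<eta>\<close> and \<open>\<eta> + inverse t \<xi>\<close> are proportional: one
  condition can be generic around \<open>\<xi>\<close> and another one around
  \<open>\<eta>\<close>.\<close>

lemma avoid_finite_sets:
  assumes "finite (X :: 'k::field_char_0 set)" "finite Y" obtains t where "t \<notin> X" "t \<noteq> 0" "inverse t \<notin> Y"
proof -
  have "finite (insert 0 X \<union> inverse ` Y)" using assms by simp
  then obtain t where t: "t \<notin> insert 0 X \<union> inverse ` Y"
    using ex_new_if_finite[OF infinite_UNIV_char_0] by blast
  then have "inverse t \<notin> Y" by (metis UnI2 imageI inverse_inverse_eq)
  then show ?thesis using t that by blast
qed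

context finite_dimensional_vector_space
begin

lemma dim_trivial_Int:
  assumes "subspace U" "subspace W" "subspace L" "U \<subseteq> L" "W \<subseteq> L" "U \<inter> W \<subseteq> {0}"
  shows "dim U + dim W \<le> dim L"
proof -
  have 0: "dim (U \<inter> W) = 0" using assms(6) by simp
  have "dim {x + y |x y. x \<in> U \<and> y \<in> W} \<le> dim L"
    using assms(3-5) by (intro dim_subset) (auto simp: subspace_add subset_eq)
  then show ?thesis using dim_sums_Int[OF assms(1,2)] 0 by simp
qed

text \<open>A complement of the radical at \<open>t = 0\<close> meets the radical of the perturbed
  form trivially for all but finitely many \<open>t\<close>, since its rows stay independent. So the
  dimension of the radical cannot grow at a generic parameter.\<close>

lemma radical_dim_generic:
  fixes f g :: "'b \<Rightarrow> 'b \<Rightarrow> 'a"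
  assumes L: "subspace L"
    and f: "\<And>x y z. x \<in> L \<Longrightarrow> y \<in> L \<Longrightarrow> z \<in> L \<Longrightarrow> f (x + y) z = f x z + f y z"
      "\<And>c x z. x \<in> L \<Longrightarrow> z \<in> L \<Longrightarrow> f (scale c x) z = c * f x z"
    and g: "\<And>x y z. x \<in> L \<Longrightarrow> y \<in> L \<Longrightarrow> z \<in> L \<Longrightarrow> g (x + y) z = g x z + g y z"
      "\<And>c x z. x \<in> L \<Longrightarrow> z \<in> L \<Longrightarrow> g (scale c x) z = c * g x z"
  shows "finite {t. dim {x \<in> L. \<forall>y\<in>L. f x y + t * g x y = 0} > dim {x \<in> L. \<forall>y\<in>L. f x y = 0}}"
proof -
  define Rad where "Rad t = {x \<in> L. \<forall>y\<in>L. f x y + t * g x y = 0}" for t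
  define dep where "dep I = {t. \<exists>c. (\<forall>y\<in>L. (\<Sum>i\<in>I. c i * poly [:f i y, g i y:] t) = 0) \<and> (\<exists>i\<in>I. c i \<noteq> 0)}" for I
  have sub: "subspace (Rad t)" for t
    unfolding subspace_def
  proof (intro conjI ballI allI)
    have "f 0 y = 0" "g 0 y = 0" if "y \<in> L" for y
      using f(2)[of 0 y 0] g(2)[of 0 y 0] that subspace_0[OF L] by auto
    then show "0 \<in> Rad t" using subspace_0[OF L] by (simp add: Rad_def)
  next
    fix x y assume "x \<in> Rad t" "y \<in> Rad t"
    then have xy: "x \<in> L" "y \<in> L" and *: "\<And>z. z \<in> L \<Longrightarrow> f x z + t * g x z = 0" "\<And>z. z \<in> L \<Longrightarrow> f y z + t * g y z = 0"
      by (auto simp: Rad_def)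
    have "f (x + y) z + t * g (x + y) z = (f x z + t * g x z) + (f y z + t * g y z)" if "z \<in> L" for z
      using f(1)[OF xy that] g(1)[OF xy that] by (simp add: algebra_simps)
    then show "x + y \<in> Rad t"
      using * xy by (simp add: Rad_def subspace_add[OF L])
  next
    fix c x assume "x \<in> Rad t"
    then have x: "x \<in> L" and *: "\<And>z. z \<in> L \<Longrightarrow> f x z + t * g x z = 0" by (auto simp: Rad_def)
    have "f (scale c x) z + t * g (scale c x) z = c * (f x z + t * g x z)" if "z \<in> L" for z
      using f(2)[OF x that] g(2)[OF x that] by (simp add: algebra_simps)
    then show "scale c x \<in> Rad t"
      using * x by (simp add: Rad_def subspace_scale[OF L])
  qed
  define R where "R = {x \<in> L. \<forall>y\<in>L. f x y = 0}"
  have R: "subspace R" "R \<subseteq> L" using sub[of 0] by (auto simp: R_def Rad_def)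
  obtain B where B: "B \<subseteq> R" "independent B" "R \<subseteq> span B" "card B = dim R"
    using basis_exists[of R] by blast
  obtain C where C: "B \<subseteq> C" "C \<subseteq> L" "independent C" "L \<subseteq> span C"
    using maximal_independent_subset_extend[of B L] B R by blast
  have finC: "finite C" using finiteI_independent[OF C(3)] .
  define I where "I = C - B"
  have I: "I \<subseteq> L" "finite I" "independent I" using C finC independent_mono[OF C(3), of "C - B"] by (auto simp: I_def)
  have cardI: "card I + dim R = dim L"
  proof -
    have "card C = dim L" using basis_card_eq_dim[OF C(2,4,3)] .
    moreover have "card I = card C - card B" unfolding I_def using C(1) finC by (meson card_Diff_subset finite_subset)
    moreover have "card B \<le> card C" by (rule card_mono[OF finC C(1)])
    ultimately show ?thesis using B(4) by simp
  qed
  have fsum: "f (\<Sum>i\<in>I. scale (c i) i) y = (\<Sum>i\<in>I. c i * f i y)"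
    and gsum: "g (\<Sum>i\<in>I. scale (c i) i) y = (\<Sum>i\<in>I. c i * g i y)" if y: "y \<in> L" for c y
  proof -
    have z: "f 0 y = 0" "g 0 y = 0" using f(2)[of 0 y 0] g(2)[of 0 y 0] y subspace_0[OF L] by auto
    have "K \<subseteq> L \<Longrightarrow> f (\<Sum>i\<in>K. scale (c i) i) y = (\<Sum>i\<in>K. c i * f i y) \<and>
        g (\<Sum>i\<in>K. scale (c i) i) y = (\<Sum>i\<in>K. c i * g i y)" if "finite K" for K
      using that
    proof (induction K rule: finite_induct)
      case (insert a K)
      have m: "scale (c a) a \<in> L" "(\<Sum>i\<in>K. scale (c i) i) \<in> L"
        using insert.prems by (auto intro!: subspace_scale[OF L] subspace_sum[OF L])
      show ?case using insert f(1)[OF m y] g(1)[OF m y] f(2)[of a y] g(2)[of a y] y by simp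
    qed (simp add: z)
    then show "f (\<Sum>i\<in>I. scale (c i) i) y = (\<Sum>i\<in>I. c i * f i y)"
      "g (\<Sum>i\<in>I. scale (c i) i) y = (\<Sum>i\<in>I. c i * g i y)" using I by auto
  qed
  have sumL: "(\<Sum>i\<in>I. scale (c i) i) \<in> L" for c
    using I(1) by (auto intro!: subspace_scale[OF L] subspace_sum[OF L])
  have "finite (dep I)" unfolding dep_def
  proof (rule finite_nonindependent_rows[OF I(2)])
    fix c assume "\<forall>y\<in>L. (\<Sum>i\<in>I. c i * poly [:f i y, g i y:] 0) = 0"
    then have "\<forall>y\<in>L. f (\<Sum>i\<in>I. scale (c i) i) y = 0" by (simp add: fsum)
    then have "(\<Sum>i\<in>I. scale (c i) i) \<in> R" using sumL by (simp add: R_def)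
    then have "(\<Sum>i\<in>I. scale (c i) i) \<in> span B" using B(3) by blast
    then obtain d where d: "(\<Sum>i\<in>I. scale (c i) i) = (\<Sum>i\<in>B. scale (d i) i)"
      using span_finite[of B] C(1) finC finite_subset by auto
    \<comment> \<open>Gluing \<open>c\<close> on \<open>I\<close> and \<open>- d\<close> on
      \<open>B\<close> gives a relation of the whole basis \<open>C\<close>.\<close>
    define e where "e i = (if i \<in> B then - d i else c i)" for i
    have "(\<Sum>i\<in>C. scale (e i) i) = (\<Sum>i\<in>I. scale (e i) i) + (\<Sum>i\<in>B. scale (e i) i)"
      unfolding I_def by (rule sum.subset_diff[OF C(1) finC])
    also have "(\<Sum>i\<in>I. scale (e i) i) = (\<Sum>i\<in>I. scale (c i) i)"
      by (rule sum.cong) (auto simp: e_def I_def)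
    also have "(\<Sum>i\<in>B. scale (e i) i) = - (\<Sum>i\<in>B. scale (d i) i)"
      by (simp add: e_def sum_negf)
    finally have "(\<Sum>i\<in>C. scale (e i) i) = 0" using d by simp
    then have "\<forall>i\<in>C. e i = 0" using C(3) finC independentD by blast
    then show "\<forall>i\<in>I. c i = 0" by (auto simp: e_def I_def)
  qed
  moreover have "{t. dim (Rad t) > dim R}
      \<subseteq> dep I"
  proof (rule subsetI, rule ccontr)
    fix t assume t: "t \<in> {t. dim (Rad t) > dim R}"
      and n: "t \<notin> dep I"
    have "Rad t \<inter> span I \<subseteq> {0}"
    proof
      fix x assume x: "x \<in> Rad t \<inter> span I"
      then obtain c where c: "x = (\<Sum>i\<in>I. scale (c i) i)" using span_finite[OF I(2)] by auto
      have "(\<Sum>i\<in>I. c i * poly [:f i y, g i y:] t) = 0" if "y \<in> L" for y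
      proof -
        have "f x y + t * g x y = 0" using x that by (simp add: Rad_def)
        then show ?thesis using that
          by (simp add: c fsum gsum sum.distrib sum_distrib_left algebra_simps)
      qed
      then have "\<forall>i\<in>I. c i = 0" using n unfolding dep_def by blast
      then show "x \<in> {0}" using c by simp
    qed
    moreover have "span I \<subseteq> L" using I(1) L by (rule span_minimal)
    moreover have "Rad t \<subseteq> L" "subspace (Rad t)" using sub by (auto simp: Rad_def)
    ultimately have "dim (Rad t) + dim (span I) \<le> dim L" using dim_trivial_Int[OF _ _ L, of "Rad t" "span I"] subspace_span by blast
    moreover have "dim (span I) = card I" by (rule dim_span_eq_card_independent[OF I(3)])
    ultimately show False using t cardI by (simp add: Rad_def)
  qed
  ultimately show ?thesis unfolding R_def[symmetric] Rad_def[symmetric] by (rule finite_subset[rotated])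
qed

end

section \<open>The stabiliser equations of the parabolic contraction\<close>

text \<open>\<open>'b\<close> indexes a symplectic basis \<open>(g\<^sub>p)\<close> in which \<open>g\<^sub>p\<close> is paired with \<open>g\<^bsub>star p\<^esub>\<close>, and
  \<open>lv p\<close> is the level of \<open>g\<^sub>p\<close>. Elements of the Lie algebra, seen as \<open>S\<^sup>2V\<close>, and linear forms on it
  are both encoded as symmetric functions \<open>'b \<Rightarrow> 'b \<Rightarrow> 'k\<close>.\<close>

locale symplectic_levels =
  fixes star :: "'b::finite \<Rightarrow> 'b" and sg :: "'b \<Rightarrow> 'k::field_char_0" and lv :: "'b \<Rightarrow> int"
  assumes star_star [simp]: "star (star p) = p" and star_neq: "star p \<noteq> p"
    and sg_star: "sg (star p) = - sg p" and sg_nz [simp]: "sg p \<noteq> 0"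
    and lv_star [simp]: "lv (star p) = - lv p"
begin

text \<open>\<open>lev p q\<close> is \<open>0\<close> on the parabolic subalgebra and \<open>1\<close> on the abelian ideal. \<open>kap p q r\<close> decides
  whether contracting \<open>(p, q)\<close> with \<open>(star q, r)\<close> contributes to the contracted bracket, and
  \<open>Phi \<xi> x y\<close> is, up to a factor, \<open>\<xi>\<close> at the bracket of \<open>x\<close> and \<open>y\<close>. The Lie algebra may be replaced by
  the one of a subset \<open>B\<close> of the basis; then \<open>kern B \<xi>\<close> is the stabiliser of \<open>\<xi>\<close>.\<close>

definition lev :: "'b \<Rightarrow> 'b \<Rightarrow> nat" where
  "lev p q = (if lv p + lv q < 0 then 1 else 0)"

definition kap :: "'b \<Rightarrow> 'b \<Rightarrow> 'b \<Rightarrow> 'k" where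
  "kap p q r = (if lev p q + lev (star q) r = lev p r then 1 else 0)"

text \<open>The product of the symmetric matrix \<open>\<xi>\<close> with a single column, masked by
  \<open>kap\<close>. Since \<open>D\<close> uses one column of \<open>x\<close> at a time, the part
  of a stabiliser element between two blocks can be studied column by column.\<close>

definition col :: "('b \<Rightarrow> 'b \<Rightarrow> 'k) \<Rightarrow> 'b \<Rightarrow> ('b \<Rightarrow> 'k) \<Rightarrow> 'b \<Rightarrow> 'k" where
  "col \<xi> q v s = (\<Sum>p\<in>UNIV. kap p q s * \<xi> p s * v p)"

definition D :: "('b \<Rightarrow> 'b \<Rightarrow> 'k) \<Rightarrow> ('b \<Rightarrow> 'b \<Rightarrow> 'k) \<Rightarrow> 'b \<Rightarrow> 'b \<Rightarrow> 'k" where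
  "D \<xi> x r s = sg (star r) * col \<xi> (star r) (\<lambda>p. x p (star r)) s"

definition eqn :: "('b \<Rightarrow> 'b \<Rightarrow> 'k) \<Rightarrow> ('b \<Rightarrow> 'b \<Rightarrow> 'k) \<Rightarrow> 'b \<Rightarrow> 'b \<Rightarrow> 'k" where
  "eqn \<xi> x r s = D \<xi> x r s + D \<xi> x s r"

definition Phi :: "('b \<Rightarrow> 'b \<Rightarrow> 'k) \<Rightarrow> ('b \<Rightarrow> 'b \<Rightarrow> 'k) \<Rightarrow> ('b \<Rightarrow> 'b \<Rightarrow> 'k) \<Rightarrow> 'k" where
  "Phi \<xi> x y = (\<Sum>r\<in>UNIV. \<Sum>s\<in>UNIV. D \<xi> x r s * y r s)"

definition symm :: "'b set \<Rightarrow> ('b \<Rightarrow> 'b \<Rightarrow> 'k) set" where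
  "symm B = {x. (\<forall>p q. x p q = x q p) \<and> (\<forall>p q. x p q \<noteq> 0 \<longrightarrow> p \<in> B \<and> q \<in> B)}"

definition kern :: "'b set \<Rightarrow> ('b \<Rightarrow> 'b \<Rightarrow> 'k) \<Rightarrow> ('b \<Rightarrow> 'b \<Rightarrow> 'k) set" where
  "kern B \<xi> = {x \<in> symm B. \<forall>r\<in>B. \<forall>s\<in>B. eqn \<xi> x r s = 0}"

text \<open>The entries in \<open>Z\<close> are coordinates that separate the points of the
  stabiliser, so \<open>card Z\<close> bounds its dimension.\<close>

definition rigid :: "'b set \<Rightarrow> ('b \<Rightarrow> 'b \<Rightarrow> 'k) \<Rightarrow> ('b \<times> 'b) set \<Rightarrow> bool" where
  "rigid B \<xi> Z \<longleftrightarrow> (\<forall>x\<in>kern B \<xi>. (\<forall>(p, q)\<in>Z. x p q = 0) \<longrightarrow> x = (\<lambda>_ _. 0))"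

text \<open>Half of \<open>card B\<close> is the rank of the symplectic algebra with basis vectors
  in \<open>B\<close>; this is the upper bound for the index, block by block.\<close>

definition half_rigid :: "'b set \<Rightarrow> bool" where
  "half_rigid B \<longleftrightarrow> (\<exists>\<xi>\<in>symm B. \<exists>Z. finite Z \<and> 2 * card Z \<le> card B \<and> rigid B \<xi> Z)"

definition comb :: "'k \<Rightarrow> ('b \<Rightarrow> 'b \<Rightarrow> 'k) \<Rightarrow> ('b \<Rightarrow> 'b \<Rightarrow> 'k) \<Rightarrow> 'b \<Rightarrow> 'b \<Rightarrow> 'k" where
  "comb t \<xi> \<eta> = (\<lambda>p q. \<xi> p q + t * \<eta> p q)"

text \<open>The product of two basis vectors. For \<open>r = s\<close> the entry is 2, which makes
  the pairing with \<open>Phi\<close> equal to \<open>eqn\<close> without a case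
  distinction.\<close>

definition symm_unit :: "'b \<Rightarrow> 'b \<Rightarrow> 'b \<Rightarrow> 'b \<Rightarrow> 'k" where
  "symm_unit r s = (\<lambda>p q. of_bool (p = r \<and> q = s) + of_bool (p = s \<and> q = r))"

section \<open>Symmetric functions and the skew form \<open>Phi\<close>\<close>

lemma symmD: "x \<in> symm B \<Longrightarrow> x p q = x q p" by (simp add: symm_def)

lemma symm_supp: "x \<in> symm B \<Longrightarrow> p \<notin> B \<or> q \<notin> B \<Longrightarrow> x p q = 0" by (auto simp: symm_def)

lemma symmI:
  assumes "\<And>p q. x p q = x q p" "\<And>p q. x p q \<noteq> 0 \<Longrightarrow> p \<in> B"
  shows "x \<in> symm B"
proof -
  have "p \<in> B \<and> q \<in> B" if "x p q \<noteq> 0" for p q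
    using assms(1)[of p q] assms(2)[of p q] assms(2)[of q p] that by simp
  then show ?thesis using assms(1) by (auto simp: symm_def)
qed

lemma symm_mono: "B \<subseteq> C \<Longrightarrow> x \<in> symm B \<Longrightarrow> x \<in> symm C"
  by (rule symmI) (auto simp: symm_def)

lemma symm_comb:
  assumes "\<xi> \<in> symm B" "\<eta> \<in> symm B" shows "comb t \<xi> \<eta> \<in> symm B"
proof (rule symmI)
  show "comb t \<xi> \<eta> p q = comb t \<xi> \<eta> q p" for p q
    by (simp add: comb_def symmD[OF assms(1), of p] symmD[OF assms(2), of p])
  show "p \<in> B" if "comb t \<xi> \<eta> p q \<noteq> 0" for p q
  proof (rule ccontr)
    assume "p \<notin> B"
    then show False
      using that symm_supp[OF assms(1), of p q] symm_supp[OF assms(2), of p q] by (simp add: comb_def)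
  qed
qed

lemma col_comb: "col (comb t \<xi> \<eta>) q v s = col \<xi> q v s + t * col \<eta> q v s"
  by (simp add: col_def comb_def algebra_simps sum.distrib sum_distrib_left)

lemma eqn_comb: "eqn (comb t \<xi> \<eta>) x r s = eqn \<xi> x r s + t * eqn \<eta> x r s"
  by (simp add: eqn_def D_def col_comb algebra_simps)

lemma kap_sym: "kap p (star q) r = kap r q p"
  by (simp add: kap_def lev_def add.commute)

lemma Phi_expand:
  "Phi \<xi> x y = (\<Sum>q\<in>UNIV. \<Sum>s\<in>UNIV. \<Sum>p\<in>UNIV. sg q * kap p q s * \<xi> p s * x p q * y (star q) s)"
proof -
  have b: "bij star" by (metis bijI' star_star)
  have "Phi \<xi> x y = (\<Sum>q\<in>UNIV. \<Sum>s\<in>UNIV. D \<xi> x (star q) s * y (star q) s)"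
    unfolding Phi_def by (rule sum.reindex_bij_betw[symmetric]) (use b in simp)
  then show ?thesis by (simp add: D_def col_def sum_distrib_left sum_distrib_right mult_ac)
qed

text \<open>Reindexing the contracted index by \<open>star\<close> exchanges the two factors;
  \<open>kap\<close> is invariant under this exchange and \<open>sg\<close> contributes the
  sign.\<close>

lemma Phi_skew:
  assumes "\<xi> \<in> symm B" "x \<in> symm B" "y \<in> symm B"
  shows "Phi \<xi> x y = - Phi \<xi> y x"
proof -
  have b: "bij_betw star UNIV UNIV" by (metis bijI' star_star)
  have "Phi \<xi> y x = (\<Sum>q\<in>UNIV. \<Sum>s\<in>UNIV. \<Sum>p\<in>UNIV. sg (star q) * kap p (star q) s * \<xi> p s * y p (star q) * x q s)"
    unfolding Phi_expand
    by (subst sum.reindex_bij_betw[OF b, symmetric, of "\<lambda>q. \<Sum>s\<in>UNIV. \<Sum>p\<in>UNIV. sg q * kap p q s * \<xi> p s * y p q * x (star q) s"]) simp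
  also have "\<dots> = (\<Sum>q\<in>UNIV. \<Sum>s\<in>UNIV. \<Sum>p\<in>UNIV. - (sg q * kap s q p * \<xi> s p * x s q * y (star q) p))"
    by (intro sum.cong refl) (simp add: sg_star kap_sym symmD[OF assms(1)] symmD[OF assms(2)] symmD[OF assms(3)])
  also have "\<dots> = (\<Sum>q\<in>UNIV. \<Sum>p\<in>UNIV. \<Sum>s\<in>UNIV. - (sg q * kap s q p * \<xi> s p * x s q * y (star q) p))"
    by (intro sum.cong refl sum.swap)
  also have "\<dots> = - Phi \<xi> x y" by (simp add: Phi_expand sum_negf)
  finally show ?thesis by simp
qed

lemma Phi_symm_unit: "Phi \<xi> x (symm_unit r s) = eqn \<xi> x r s"
proof -
  have "(\<Sum>a\<in>UNIV. \<Sum>b\<in>UNIV. D \<xi> x a b * of_bool (a = p \<and> b = q)) = D \<xi> x p q" for p q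
  proof -
    have "(\<Sum>b\<in>UNIV. D \<xi> x a b * of_bool (a = p \<and> b = q)) = (if a = p then D \<xi> x p q else 0)" for a
      by (cases "a = p") (simp_all add: of_bool_def if_distrib[of "\<lambda>z. _ * z"] cong: if_cong)
    then show ?thesis by simp
  qed
  then show ?thesis unfolding Phi_def symm_unit_def eqn_def by (simp only: distrib_left sum.distrib)
qed

lemma Phi_eqn:
  assumes "y \<in> symm B" shows "2 * Phi \<xi> x y = (\<Sum>r\<in>UNIV. \<Sum>s\<in>UNIV. eqn \<xi> x r s * y r s)"
proof -
  have "(\<Sum>r\<in>UNIV. \<Sum>s\<in>UNIV. D \<xi> x s r * y r s) = (\<Sum>s\<in>UNIV. \<Sum>r\<in>UNIV. D \<xi> x s r * y s r)"
    by (subst sum.swap) (simp add: symmD[OF assms])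
  then show ?thesis by (simp add: eqn_def Phi_def distrib_right sum.distrib)
qed

text \<open>The equation at \<open>(r, s)\<close> is the pairing of \<open>x\<close> with
  \<open>symm_unit r s\<close>, so by skewness it is void if this element lies in the radical. At
  such positions only the equation of a perturbation is left.\<close>

lemma eqn_symm_unit_kern:
  assumes \<xi>: "\<xi> \<in> symm B" and x: "x \<in> symm B" and k: "symm_unit r s \<in> kern B \<xi>"
  shows "eqn \<xi> x r s = 0"
proof -
  have k': "symm_unit r s \<in> symm B" using k by (simp add: kern_def)
  have "2 * Phi \<xi> (symm_unit r s) x = 0"
    unfolding Phi_eqn[OF x] using k x by (intro sum.neutral ballI) (auto simp: kern_def symm_def)
  then show ?thesis using Phi_skew[OF \<xi> x k'] by (simp add: Phi_symm_unit)
qed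

section \<open>Genericity along pencils of forms\<close>

definition lin :: "(('b \<Rightarrow> 'b \<Rightarrow> 'k) \<Rightarrow> 'k) \<Rightarrow> bool" where
  "lin F \<longleftrightarrow> (\<forall>x y. F (\<lambda>p q. x p q + y p q) = F x + F y) \<and> (\<forall>c x. F (\<lambda>p q. c * x p q) = c * F x)"

lemma lin_sum:
  assumes "lin F" "finite I"
  shows "F (\<lambda>p q. \<Sum>i\<in>I. c i * u i p q) = (\<Sum>i\<in>I. c i * F (u i))"
  using assms(2)
proof (induction I rule: finite_induct)
  case empty
  have "\<forall>c x. F (\<lambda>p q. c * x p q) = c * F x" using assms(1) by (simp add: lin_def)
  from spec[OF spec[OF this, of 0]] show ?case by simp
next
  case (insert i I)
  have "F (\<lambda>p q. c i * u i p q + (\<Sum>i\<in>I. c i * u i p q)) = c i * F (u i) + F (\<lambda>p q. \<Sum>i\<in>I. c i * u i p q)"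
    using assms(1) unfolding lin_def by simp
  then show ?case using insert by simp
qed

lemma lin_expand:
  assumes "lin F"
  shows "F x = (\<Sum>i\<in>UNIV. x (fst i) (snd i) * F (\<lambda>p q. of_bool (i = (p, q))))"
proof -
  have "x = (\<lambda>p q. \<Sum>i\<in>UNIV. x (fst i) (snd i) * of_bool (i = (p, q)))"
    by (simp add: fun_eq_iff of_bool_def if_distrib[of "\<lambda>z. _ * z"] cong: if_cong)
  then have "F x = F (\<lambda>p q. \<Sum>i\<in>UNIV. x (fst i) (snd i) * of_bool (i = (p, q)))" by simp
  also have "\<dots> = (\<Sum>i\<in>UNIV. x (fst i) (snd i) * F (\<lambda>p q. of_bool (i = (p, q))))"
    by (rule lin_sum[OF assms]) simp
  finally show ?thesis .
qed

text \<open>A linear system with trivial kernel at \<open>t = 0\<close> has full column rank there,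
  hence for all but finitely many \<open>t\<close>. Pairs of functionals allow stabiliser equations,
  symmetry conditions and prescribed zeros to be treated alike.\<close>

lemma lin_pencil:
  assumes J: "\<And>F G. (F, G) \<in> J \<Longrightarrow> lin F \<and> lin G"
    and triv: "\<And>x. \<forall>(F, G)\<in>J. F x = 0 \<Longrightarrow> x = (\<lambda>_ _. 0)"
  shows "finite {t. \<exists>x. x \<noteq> (\<lambda>_ _. 0) \<and> (\<forall>(F, G)\<in>J. F x + t * G x = 0)}"
proof -
  define u :: "'b \<times> 'b \<Rightarrow> 'b \<Rightarrow> 'b \<Rightarrow> 'k" where "u i = (\<lambda>p q. of_bool (i = (p, q)))" for i
  define A where "A i j = [: fst j (u i), snd j (u i) :]" for i :: "'b \<times> 'b"
    and j :: "(('b \<Rightarrow> 'b \<Rightarrow> 'k) \<Rightarrow> 'k) \<times> (('b \<Rightarrow> 'b \<Rightarrow> 'k) \<Rightarrow> 'k)"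
  have A: "(\<Sum>i\<in>UNIV. c i * poly (A i j) t) = fst j (\<lambda>p q. c (p, q)) + t * snd j (\<lambda>p q. c (p, q))"
    if "j \<in> J" for c j t
  proof -
    have l: "lin (fst j)" "lin (snd j)" using J[of "fst j" "snd j"] that by auto
    show ?thesis
      unfolding lin_expand[OF l(1), of "\<lambda>p q. c (p, q)"] lin_expand[OF l(2), of "\<lambda>p q. c (p, q)"]
      by (simp add: A_def u_def sum_distrib_left sum.distrib algebra_simps)
  qed
  have "finite {t. \<exists>c. (\<forall>j\<in>J. (\<Sum>i\<in>UNIV. c i * poly (A i j) t) = 0) \<and> (\<exists>i\<in>UNIV. c i \<noteq> 0)}"
  proof (rule finite_nonindependent_rows)
    fix c assume "\<forall>j\<in>J. (\<Sum>i\<in>UNIV. c i * poly (A i j) 0) = 0"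
    then have "\<forall>(F, G)\<in>J. F (\<lambda>p q. c (p, q)) = 0" using A[of _ c 0] by fastforce
    from triv[OF this] show "\<forall>i\<in>UNIV. c i = 0" by (metis surj_pair)
  qed simp
  moreover have "{t. \<exists>x. x \<noteq> (\<lambda>_ _. 0) \<and> (\<forall>(F, G)\<in>J. F x + t * G x = 0)}
      \<subseteq> {t. \<exists>c. (\<forall>j\<in>J. (\<Sum>i\<in>UNIV. c i * poly (A i j) t) = 0) \<and> (\<exists>i\<in>UNIV. c i \<noteq> 0)}"
  proof
    fix t assume "t \<in> {t. \<exists>x. x \<noteq> (\<lambda>_ _. 0) \<and> (\<forall>(F, G)\<in>J. F x + t * G x = 0)}"
    then obtain x where x: "x \<noteq> (\<lambda>_ _. 0)" "\<And>F G. (F, G) \<in> J \<Longrightarrow> F x + t * G x = 0" by auto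
    have "\<exists>i. case_prod x i \<noteq> 0" using x(1) by (auto simp: fun_eq_iff)
    moreover have "(\<Sum>i\<in>UNIV. case_prod x i * poly (A i j) t) = 0" if "j \<in> J" for j
      using A[OF that, of "case_prod x" t] x(2)[of "fst j" "snd j"] that by simp
    ultimately show "t \<in> {t. \<exists>c. (\<forall>j\<in>J. (\<Sum>i\<in>UNIV. c i * poly (A i j) t) = 0) \<and> (\<exists>i\<in>UNIV. c i \<noteq> 0)}"
      by blast
  qed
  ultimately show ?thesis by (rule finite_subset[rotated])
qed

lemma lin_eqn: "lin (\<lambda>x. eqn \<xi> x r s)"
  by (simp add: lin_def eqn_def D_def col_def algebra_simps sum.distrib sum_distrib_left)

lemma lin_entry: "lin (\<lambda>x. x p q)" by (simp add: lin_def)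

text \<open>If \<open>\<xi> + t \<eta>\<close> is considered as a perturbation of \<open>\<xi>\<close>, the equations of \<open>\<eta>\<close> only have to
  cut down the radical of \<open>\<xi>\<close>: on that radical the form of \<open>\<xi> + t \<eta>\<close> is divisible by \<open>t\<close>.\<close>

lemma rigid_generic:
  assumes \<xi>: "\<xi> \<in> symm B" and \<eta>: "\<eta> \<in> symm B"
    and main: "\<And>x. \<lbrakk>x \<in> kern B \<xi>; \<And>r s. symm_unit r s \<in> kern B \<xi> \<Longrightarrow> eqn \<eta> x r s = 0; \<forall>(p, q)\<in>Z. x p q = 0\<rbrakk>
      \<Longrightarrow> x = (\<lambda>_ _. 0)"
  shows "finite {t. \<not> rigid B (comb t \<xi> \<eta>) Z}"
proof -
  \<comment> \<open>The perturbed equations, their quotients by \<open>t\<close> at the radical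
    positions, the symmetry, and the zeros outside \<open>B\<close> and on \<open>Z\<close>.\<close>
  define J where "J = (\<lambda>(r, s). (\<lambda>x. eqn \<xi> x r s, \<lambda>x. eqn \<eta> x r s)) ` (B \<times> B)
    \<union> (\<lambda>(r, s). (\<lambda>x. eqn \<eta> x r s, \<lambda>x. 0)) ` {(r, s). symm_unit r s \<in> kern B \<xi>}
    \<union> (\<lambda>(p, q). (\<lambda>x. x p q - x q p, \<lambda>x. 0)) ` UNIV
    \<union> (\<lambda>(p, q). (\<lambda>x. x p q, \<lambda>x. 0)) ` ({(p, q). p \<notin> B \<or> q \<notin> B} \<union> Z)"
  \<comment> \<open>0 is made exceptional because the equations at radical positions get divided by
    \<open>t\<close>.\<close>
  define X where "X = insert 0 {t. \<exists>x. x \<noteq> (\<lambda>_ _. 0) \<and> (\<forall>(F, G)\<in>J. F x + t * G x = 0)}"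
  have lin0: "lin (\<lambda>x. 0)" "lin (\<lambda>x. x p q - x q p)" for p q
    by (simp_all add: lin_def algebra_simps)
  have "finite {t. \<exists>x. x \<noteq> (\<lambda>_ _. 0) \<and> (\<forall>(F, G)\<in>J. F x + t * G x = 0)}"
  proof (rule lin_pencil)
    show "lin F \<and> lin G" if "(F, G) \<in> J" for F G
      using that unfolding J_def by (auto simp: lin_eqn lin_entry lin0)
  next
    fix x assume *: "\<forall>(F, G)\<in>J. F x = 0"
    have 1: "eqn \<xi> x r s = 0" if "r \<in> B" "s \<in> B" for r s
      using * that unfolding J_def by (auto simp: ball_Un)
    have 2: "eqn \<eta> x r s = 0" if "symm_unit r s \<in> kern B \<xi>" for r s
      using * that unfolding J_def by (auto simp: ball_Un)
    have 3: "x p q = x q p" for p q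
      using * unfolding J_def by (auto simp: ball_Un)
    have 4: "x p q = 0" if "p \<notin> B \<or> q \<notin> B" for p q
      using * that unfolding J_def by (auto simp: ball_Un)
    have 5: "\<forall>(p, q)\<in>Z. x p q = 0"
      using * unfolding J_def by (auto simp: ball_Un)
    have "x \<in> symm B" using 3 4 by (intro symmI) blast+
    then have "x \<in> kern B \<xi>" using 1 by (simp add: kern_def)
    then show "x = (\<lambda>_ _. 0)" using main 2 5 by blast
  qed
  then have "finite X" by (simp add: X_def)
  moreover have "{t. \<not> rigid B (comb t \<xi> \<eta>) Z} \<subseteq> X"
  proof
    fix t assume "t \<in> {t. \<not> rigid B (comb t \<xi> \<eta>) Z}"
    then obtain x where x: "x \<in> kern B (comb t \<xi> \<eta>)" "x \<noteq> (\<lambda>_ _. 0)" "\<forall>(p, q)\<in>Z. x p q = 0"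
      unfolding rigid_def by blast
    have xs: "x \<in> symm B" using x(1) by (simp add: kern_def)
    have e: "eqn \<xi> x r s + t * eqn \<eta> x r s = 0" if "r \<in> B" "s \<in> B" for r s
      using x(1) that by (simp add: kern_def eqn_comb)
    show "t \<in> X"
    proof (cases "t = 0")
      case False
      have "eqn \<eta> x r s = 0" if k: "symm_unit r s \<in> kern B \<xi>" for r s
      proof -
        have "symm_unit r s r s \<noteq> (0::'k)" by (simp add: symm_unit_def)
        moreover have "symm_unit r s \<in> symm B" using k by (simp add: kern_def)
        ultimately have "r \<in> B" "s \<in> B" by (meson symm_supp)+
        then show ?thesis using e eqn_symm_unit_kern[OF \<xi> xs k] False by fastforce
      qed
      then have "\<forall>(F, G)\<in>J. F x + t * G x = 0"
        using e x(3) symmD[OF xs] symm_supp[OF xs] unfolding J_def by (auto simp: ball_Un)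
      then show ?thesis using x(2) unfolding X_def by blast
    qed (simp add: X_def)
  qed
  ultimately show ?thesis by (rule finite_subset[rotated])
qed

section \<open>Joining orthogonal blocks of the basis\<close>

definition supp_in :: "'b set \<Rightarrow> ('b \<Rightarrow> 'k) \<Rightarrow> bool" where
  "supp_in B v \<longleftrightarrow> (\<forall>p. p \<notin> B \<longrightarrow> v p = 0)"

text \<open>The forms \<open>\<xi> + t \<xi>'\<close> on a union of two orthogonal blocks split into the two blocks as soon
  as there is no stabiliser element between them; this is what \<open>nondeg\<close> provides.\<close>

definition nondeg :: "'b set \<Rightarrow> ('b \<Rightarrow> 'b \<Rightarrow> 'k) \<Rightarrow> 'b \<Rightarrow> bool" where
  "nondeg B \<xi> q \<longleftrightarrow> (\<forall>v. supp_in B v \<and> (\<forall>s\<in>B. col \<xi> q v s = 0) \<longrightarrow> v = (\<lambda>_. 0))"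

lemma nondeg_generic:
  assumes "nondeg B \<xi> q"
  shows "finite {t. \<not> nondeg B (comb t \<xi> \<eta>) q}"
proof -
  define A where "A p s = [: kap p q s * \<xi> p s, kap p q s * \<eta> p s :]" for p s
  have A: "(\<Sum>p\<in>B. c p * poly (A p s) t) = col (comb t \<xi> \<eta>) q (\<lambda>p. if p \<in> B then c p else 0) s" for c s t
  proof -
    have "col (comb t \<xi> \<eta>) q (\<lambda>p. if p \<in> B then c p else 0) s
       = (\<Sum>p\<in>UNIV. if p \<in> B then c p * poly (A p s) t else 0)"
      unfolding col_def by (rule sum.cong) (auto simp: A_def comb_def algebra_simps)
    then show ?thesis by (simp add: sum.If_cases)
  qed
  have "finite {t. \<exists>c. (\<forall>s\<in>B. (\<Sum>p\<in>B. c p * poly (A p s) t) = 0) \<and> (\<exists>p\<in>B. c p \<noteq> 0)}"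
  proof (rule finite_nonindependent_rows)
    fix c assume c: "\<forall>s\<in>B. (\<Sum>p\<in>B. c p * poly (A p s) 0) = 0"
    have 0: "comb 0 \<xi> \<eta> = \<xi>" by (simp add: comb_def)
    have "(\<lambda>p. if p \<in> B then c p else 0) = (\<lambda>_. 0)"
      using assms c unfolding nondeg_def A 0 by (metis (mono_tags, lifting) supp_in_def)
    then show "\<forall>p\<in>B. c p = 0" by (metis (mono_tags))
  qed simp
  moreover have "{t. \<not> nondeg B (comb t \<xi> \<eta>) q}
    \<subseteq> {t. \<exists>c. (\<forall>s\<in>B. (\<Sum>p\<in>B. c p * poly (A p s) t) = 0) \<and> (\<exists>p\<in>B. c p \<noteq> 0)}"
  proof
    fix t assume "t \<in> {t. \<not> nondeg B (comb t \<xi> \<eta>) q}"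
    then obtain v where v: "supp_in B v" "\<forall>s\<in>B. col (comb t \<xi> \<eta>) q v s = 0" "v \<noteq> (\<lambda>_. 0)"
      by (auto simp: nondeg_def)
    have "(\<lambda>p. if p \<in> B then v p else 0) = v" using v(1) by (auto simp: supp_in_def)
    then have "\<forall>s\<in>B. (\<Sum>p\<in>B. v p * poly (A p s) t) = 0" using v(2) by (simp add: A)
    moreover have "\<exists>p\<in>B. v p \<noteq> 0" using v(1,3) unfolding supp_in_def fun_eq_iff by blast
    ultimately show "t \<in> {t. \<exists>c. (\<forall>s\<in>B. (\<Sum>p\<in>B. c p * poly (A p s) t) = 0) \<and> (\<exists>p\<in>B. c p \<noteq> 0)}"
      by blast
  qed
  ultimately show ?thesis by (rule finite_subset[rotated])
qed

lemma col_scale: "col (\<lambda>p q. c * \<xi> p q) q v s = c * col \<xi> q v s"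
  by (simp add: col_def sum_distrib_left mult_ac)

lemma nondeg_scale: "c \<noteq> 0 \<Longrightarrow> nondeg B (\<lambda>p q. c * \<xi> p q) r \<longleftrightarrow> nondeg B \<xi> r"
  by (simp add: nondeg_def col_scale)

lemma eqn_scale: "eqn (\<lambda>p q. c * \<xi> p q) x r s = c * eqn \<xi> x r s"
  by (simp add: eqn_def D_def col_scale algebra_simps)

lemma kern_scale: "c \<noteq> 0 \<Longrightarrow> kern B (\<lambda>p q. c * \<xi> p q) = kern B \<xi>"
  by (simp add: kern_def eqn_scale)

definition restr :: "'b set \<Rightarrow> ('b \<Rightarrow> 'b \<Rightarrow> 'k) \<Rightarrow> 'b \<Rightarrow> 'b \<Rightarrow> 'k" where
  "restr B x = (\<lambda>p q. if p \<in> B \<and> q \<in> B then x p q else 0)"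

lemma D_supp:
  assumes \<xi>: "\<xi> \<in> symm B1" "\<eta> \<in> symm B2" and "B1 \<inter> B2 = {}" "s \<in> B1"
  shows "D (comb t \<xi> \<eta>) x r s = D \<xi> x r s"
proof -
  have "\<eta> p s = 0" for p using assms symm_supp[OF \<xi>(2), of p s] by blast
  then show ?thesis by (simp add: D_def col_def comb_def)
qed

lemma D_restr:
  assumes \<xi>: "\<xi> \<in> symm B1" and "star ` B1 \<subseteq> B1" "r \<in> B1"
  shows "D \<xi> (restr B1 x) r s = D \<xi> x r s"
proof -
  have "star r \<in> B1" using assms by blast
  moreover have "\<xi> p s = 0" if "p \<notin> B1" for p using symm_supp[OF \<xi>, of p s] that by blast
  ultimately have "kap p (star r) s * \<xi> p s * restr B1 x p (star r) = kap p (star r) s * \<xi> p s * x p (star r)" for p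
    by (cases "p \<in> B1") (simp_all add: restr_def)
  then show ?thesis unfolding D_def col_def by (simp only:)
qed

text \<open>For \<open>r\<close> and \<open>s\<close> in \<open>B1\<close> the equation only sees
  entries of \<open>x\<close> inside \<open>B1\<close>: \<open>\<eta>\<close> has no entry at
  \<open>s\<close>, and \<open>star r\<close> stays in \<open>B1\<close>.\<close>

lemma kern_restr:
  assumes \<xi>: "\<xi> \<in> symm B1" "\<eta> \<in> symm B2" and B: "B1 \<inter> B2 = {}" "star ` B1 \<subseteq> B1"
    and x: "x \<in> kern (B1 \<union> B2) (comb t \<xi> \<eta>)"
  shows "restr B1 x \<in> kern B1 \<xi>"
proof -
  have "restr B1 x \<in> symm B1"
    using x by (intro symmI) (auto simp: restr_def kern_def symm_def split: if_splits)
  moreover have "eqn \<xi> (restr B1 x) r s = 0" if "r \<in> B1" "s \<in> B1" for r s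
  proof -
    have "eqn (comb t \<xi> \<eta>) x r s = 0" using x that by (simp add: kern_def)
    then show ?thesis
      using D_supp[OF \<xi> B(1) that(2), of t x r] D_supp[OF \<xi> B(1) that(1), of t x s] that
      by (simp add: eqn_def D_restr[OF \<xi>(1) B(2)])
  qed
  ultimately show ?thesis by (simp add: kern_def)
qed

text \<open>Proportional forms have the same stabiliser, so the blocks may exchange their
  roles.\<close>

lemma kern_restr':
  assumes \<xi>: "\<xi> \<in> symm B1" "\<eta> \<in> symm B2" and B: "B1 \<inter> B2 = {}" "star ` B2 \<subseteq> B2"
    and x: "x \<in> kern (B1 \<union> B2) (comb t \<xi> \<eta>)" and t: "t \<noteq> 0"
  shows "restr B2 x \<in> kern B2 \<eta>"
proof -
  have s: "(\<lambda>p q. inverse t * comb t \<xi> \<eta> p q) = comb (inverse t) \<eta> \<xi>"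
    using t by (simp add: comb_def fun_eq_iff algebra_simps)
  have "x \<in> kern (B2 \<union> B1) (comb (inverse t) \<eta> \<xi>)"
    using x t kern_scale[of "inverse t" "B1 \<union> B2" "comb t \<xi> \<eta>"] by (simp add: s Un_commute)
  then show ?thesis using kern_restr[OF \<xi>(2,1) _ B(2)] B(1) by blast
qed

text \<open>For \<open>q\<close> in \<open>B2\<close> and \<open>s\<close> in \<open>B1\<close>, one
  of the two terms of the equation at \<open>(star q, s)\<close> vanishes, as \<open>\<xi>\<close>
  has no entry at \<open>star q\<close>. The other term is the column condition for the column of
  \<open>x\<close> at \<open>q\<close>, to which nondegeneracy applies.\<close>

lemma nondeg_cross:
  assumes \<xi>: "\<xi> \<in> symm B1" and B: "B1 \<inter> B2 = {}" "star ` B2 \<subseteq> B2"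
    and N: "\<forall>q\<in>B2. nondeg B1 \<xi> q"
    and x: "x \<in> kern (B1 \<union> B2) \<xi>" "restr B1 x = (\<lambda>_ _. 0)" "restr B2 x = (\<lambda>_ _. 0)"
  shows "x = (\<lambda>_ _. 0)"
proof -
  have xs: "x \<in> symm (B1 \<union> B2)" using x(1) by (simp add: kern_def)
  have 1: "x p q = 0" if "p \<in> B1" "q \<in> B1" for p q using fun_cong[OF fun_cong[OF x(2), of p], of q] that by (simp add: restr_def)
  have 2: "x p q = 0" if "p \<in> B2" "q \<in> B2" for p q using fun_cong[OF fun_cong[OF x(3), of p], of q] that by (simp add: restr_def)
  have 12: "x p q = 0" if q: "q \<in> B2" for p q
  proof -
    have r: "star q \<in> B2" using q B by blast
    have "supp_in B1 (\<lambda>p. x p q)"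
      unfolding supp_in_def using 2 q symm_supp[OF xs] by blast
    moreover have "col \<xi> q (\<lambda>p. x p q) s = 0" if s: "s \<in> B1" for s
    proof -
      have "eqn \<xi> x (star q) s = 0" using x(1) r s by (simp add: kern_def)
      moreover have "D \<xi> x s (star q) = 0"
      proof -
        have "\<xi> p (star q) = 0" for p using symm_supp[OF \<xi>, of p "star q"] r B(1) by blast
        then show ?thesis by (simp add: D_def col_def)
      qed
      ultimately show ?thesis by (simp add: eqn_def D_def)
    qed
    ultimately have "(\<lambda>p. x p q) = (\<lambda>_. 0)" using N q unfolding nondeg_def by blast
    then show ?thesis by (rule fun_cong)
  qed
  have "x p q = 0" for p q
    using 1[of p q] 12[of q p] 12[of p q] symmD[OF xs, of p q] symm_supp[OF xs, of p q] by auto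
  then show ?thesis by (simp add: fun_eq_iff)
qed

text \<open>On the line through a rigid form \<open>\<eta>\<close> and a nondegenerate form
  \<open>\<xi>\<close>, both properties fail at finitely many points only, so one form has
  both.\<close>

lemma half_rigid_nondeg:
  assumes g: "half_rigid B1" and \<xi>: "\<xi> \<in> symm B1" and N: "\<forall>q\<in>B2. nondeg B1 \<xi> q"
  obtains \<zeta> Z where "\<zeta> \<in> symm B1" "finite Z" "2 * card Z \<le> card B1" "rigid B1 \<zeta> Z"
    "\<forall>q\<in>B2. nondeg B1 \<zeta> q"
proof -
  obtain \<eta> Z where \<eta>: "\<eta> \<in> symm B1" and Z: "finite Z" "2 * card Z \<le> card B1" "rigid B1 \<eta> Z"
    using g unfolding half_rigid_def by blast
  have f1: "finite {t. \<not> rigid B1 (comb t \<eta> \<xi>) Z}"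
    by (rule rigid_generic[OF \<eta> \<xi>]) (use Z(3) in \<open>auto simp: rigid_def\<close>)
  have f2: "finite (\<Union>q\<in>B2. {t. \<not> nondeg B1 (comb t \<xi> \<eta>) q})"
    using N by (intro finite_UN_I nondeg_generic) auto
  obtain t where t: "t \<notin> {t. \<not> rigid B1 (comb t \<eta> \<xi>) Z}" "t \<noteq> 0"
    "inverse t \<notin> (\<Union>q\<in>B2. {t. \<not> nondeg B1 (comb t \<xi> \<eta>) q})"
    by (rule avoid_finite_sets[OF f1 f2])
  have s: "comb t \<eta> \<xi> = (\<lambda>p q. t * comb (inverse t) \<xi> \<eta> p q)"
    using t(2) by (simp add: comb_def fun_eq_iff algebra_simps)
  show ?thesis
  proof (rule that[OF symm_comb[OF \<eta> \<xi>, of t] Z(1,2)])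
    show "rigid B1 (comb t \<eta> \<xi>) Z" using t(1) by blast
    show "\<forall>q\<in>B2. nondeg B1 (comb t \<eta> \<xi>) q"
      unfolding s nondeg_scale[OF t(2)] using t(3) by blast
  qed
qed

text \<open>\<open>H\<close> consists of the positions inside a block. If \<open>x\<close> vanishes
  on \<open>H\<close>, then it is zero already for the form \<open>\<zeta>\<close> alone, hence for
  generic \<open>t\<close>. The parts inside the blocks are stabiliser elements of
  \<open>\<zeta>\<close> and \<open>\<eta>\<close> for every \<open>t \<noteq> 0\<close> and are
  killed by \<open>Z1\<close> and \<open>Z2\<close>.\<close>

lemma rigid_union:
  assumes B: "B1 \<inter> B2 = {}" "star ` B1 \<subseteq> B1" "star ` B2 \<subseteq> B2"
    and \<zeta>: "\<zeta> \<in> symm B1" "rigid B1 \<zeta> Z1" and N: "\<forall>q\<in>B2. nondeg B1 \<zeta> q"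
    and \<eta>: "\<eta> \<in> symm B2" "rigid B2 \<eta> Z2"
  obtains t where "t \<noteq> 0" "rigid (B1 \<union> B2) (comb t \<zeta> \<eta>) (Z1 \<union> Z2)"
proof -
  have sub: "\<zeta> \<in> symm (B1 \<union> B2)" "\<eta> \<in> symm (B1 \<union> B2)" using \<zeta> \<eta> by (auto intro: symm_mono[rotated])
  define H where "H = B1 \<times> B1 \<union> B2 \<times> B2"
  have H: "(\<forall>(p, q)\<in>H. x p q = 0) \<longleftrightarrow> restr B1 x = (\<lambda>_ _. 0) \<and> restr B2 x = (\<lambda>_ _. 0)" for x
    unfolding H_def restr_def fun_eq_iff ball_Un split_paired_Ball_Sigma prod.case by auto
  have f1: "finite {t. \<not> rigid (B1 \<union> B2) (comb t \<zeta> \<eta>) H}"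
  proof (rule rigid_generic[OF sub])
    fix x assume x: "x \<in> kern (B1 \<union> B2) \<zeta>" "\<forall>(p, q)\<in>H. x p q = 0"
    then have "restr B1 x = (\<lambda>_ _. 0)" "restr B2 x = (\<lambda>_ _. 0)" using H[of x] by blast+
    then show "x = (\<lambda>_ _. 0)" by (rule nondeg_cross[OF \<zeta>(1) B(1,3) N x(1)])
  qed
  obtain t where t: "t \<notin> {t. \<not> rigid (B1 \<union> B2) (comb t \<zeta> \<eta>) H}" "t \<noteq> 0"
    by (rule avoid_finite_sets[OF f1 finite.emptyI])
  have "rigid (B1 \<union> B2) (comb t \<zeta> \<eta>) (Z1 \<union> Z2)"
    unfolding rigid_def
  proof (intro ballI impI)
    fix x assume x: "x \<in> kern (B1 \<union> B2) (comb t \<zeta> \<eta>)" and z: "\<forall>(p, q)\<in>Z1 \<union> Z2. x p q = 0"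
    have z': "\<forall>(p, q)\<in>Z1. restr B1 x p q = 0" "\<forall>(p, q)\<in>Z2. restr B2 x p q = 0"
      using z by (auto simp: restr_def)
    have "restr B1 x = (\<lambda>_ _. 0)"
      using kern_restr[OF \<zeta>(1) \<eta>(1) B(1,2) x] \<zeta>(2) z'(1) unfolding rigid_def by blast
    moreover have "restr B2 x = (\<lambda>_ _. 0)"
      using kern_restr'[OF \<zeta>(1) \<eta>(1) B(1,3) x t(2)] \<eta>(2) z'(2) unfolding rigid_def by blast
    ultimately show "x = (\<lambda>_ _. 0)" using t(1) x H unfolding rigid_def by blast
  qed
  then show ?thesis by (rule that[OF t(2)])
qed

lemma half_rigid_union:
  assumes B: "B1 \<inter> B2 = {}" "star ` B1 \<subseteq> B1" "star ` B2 \<subseteq> B2"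
    and g1: "half_rigid B1" and \<xi>: "\<xi> \<in> symm B1" and N: "\<forall>q\<in>B2. nondeg B1 \<xi> q" and g2: "half_rigid B2"
  shows "half_rigid (B1 \<union> B2)"
proof -
  obtain \<zeta> Z1 where \<zeta>: "\<zeta> \<in> symm B1" and Z1: "finite Z1" "2 * card Z1 \<le> card B1" "rigid B1 \<zeta> Z1"
    and N': "\<forall>q\<in>B2. nondeg B1 \<zeta> q"
    by (rule half_rigid_nondeg[OF g1 \<xi> N])
  obtain \<eta> Z2 where \<eta>: "\<eta> \<in> symm B2" and Z2: "finite Z2" "2 * card Z2 \<le> card B2" "rigid B2 \<eta> Z2"
    using g2 unfolding half_rigid_def by blast
  obtain t where t: "rigid (B1 \<union> B2) (comb t \<zeta> \<eta>) (Z1 \<union> Z2)"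
    by (rule rigid_union[OF B \<zeta> Z1(3) N' \<eta> Z2(3)])
  have "\<zeta> \<in> symm (B1 \<union> B2)" "\<eta> \<in> symm (B1 \<union> B2)" using \<zeta> \<eta> by (auto intro: symm_mono[rotated])
  then have "comb t \<zeta> \<eta> \<in> symm (B1 \<union> B2)" by (rule symm_comb)
  moreover have "2 * card (Z1 \<union> Z2) \<le> card (B1 \<union> B2)"
    using card_Un_le[of Z1 Z2] Z1 Z2 B(1) by (simp add: card_Un_disjoint)
  moreover have "finite (Z1 \<union> Z2)" using Z1 Z2 by simp
  ultimately show ?thesis unfolding half_rigid_def using t by blast
qed

section \<open>Cyclic forms on rows\<close>

text \<open>The vectors of a chain have increasing levels; it is indexed by all integers, \<open>n\<close>-periodically,
  such that the indices of the cyclic form need no case distinction at the end.\<close>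

definition chain :: "(int \<Rightarrow> 'b) \<Rightarrow> int \<Rightarrow> bool" where
  "chain e n \<longleftrightarrow> 0 < n \<and> (\<forall>i. e (i mod n) = e i) \<and> (\<forall>i j. 0 \<le> i \<and> i < j \<and> j < n \<longrightarrow> lv (e i) < lv (e j))"

lemma chain_mod: "chain e n \<Longrightarrow> e (i mod n) = e i" by (simp add: chain_def)

lemma chain_pos: "chain e n \<Longrightarrow> 0 < n" by (simp add: chain_def)

lemma chain_less_iff:
  assumes "chain e n" "0 \<le> i" "i < n" "0 \<le> j" "j < n" shows "lv (e i) < lv (e j) \<longleftrightarrow> i < j"
proof -
  have *: "\<And>i j. 0 \<le> i \<Longrightarrow> i < j \<Longrightarrow> j < n \<Longrightarrow> lv (e i) < lv (e j)" using assms(1) unfolding chain_def by blast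
  show ?thesis using *[of i j] *[of j i] assms by (cases i j rule: linorder_cases) auto
qed

lemma chain_cong: "chain e n \<Longrightarrow> i mod n = j mod n \<Longrightarrow> e i = e j"
  using chain_mod by metis

lemma chain_lv_eq:
  assumes "chain e n" "lv (e i) = lv (e j)" shows "i mod n = j mod n"
proof -
  have b: "0 \<le> k mod n" "k mod n < n" for k using chain_pos[OF assms(1)] by auto
  have "lv (e (i mod n)) = lv (e (j mod n))" using assms chain_mod by metis
  then show ?thesis
    using chain_less_iff[OF assms(1) b[of i] b[of j]] chain_less_iff[OF assms(1) b[of j] b[of i]] by simp
qed

lemma chain_eq: "chain e n \<Longrightarrow> e i = e j \<longleftrightarrow> i mod n = j mod n"
  using chain_lv_eq chain_cong by metis

lemma chain_range: "chain e n \<Longrightarrow> range e = e ` {0..<n}"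
proof
  assume c: "chain e n"
  show "range e \<subseteq> e ` {0..<n}"
  proof
    fix p assume "p \<in> range e"
    then obtain i where "p = e (i mod n)" using chain_mod[OF c] by auto
    then show "p \<in> e ` {0..<n}" using chain_pos[OF c] by auto
  qed
qed auto

lemma chain_card: "chain e n \<Longrightarrow> card (range e) = nat n"
proof -
  assume c: "chain e n"
  have "inj_on e {0..<n}" using c by (auto simp: inj_on_def chain_eq)
  then show ?thesis by (simp add: chain_range[OF c] card_image)
qed

lemma chain_exists:
  assumes "W \<noteq> {}" "inj_on lv W" obtains e where "chain e (int (card W))" "range e = W"
proof -
  have fin: "finite W" by simp
  define h where "h = nth (sorted_list_of_set (lv ` W))"
  have h: "bij_betw h {..<card (lv ` W)} (lv ` W)" "strict_mono_on {..<card (lv ` W)} h"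
    unfolding h_def
    by (rule bij_betw_nth) (auto simp: strict_mono_on_def intro!: sorted_wrt_nth_less[of "(<)"])
  have cW: "card (lv ` W) = card W" using card_image[OF assms(2)] .
  define g where "g = inv_into W lv"
  have g: "g y \<in> W" "lv (g y) = y" if "y \<in> lv ` W" for y
    using that unfolding g_def by (simp_all add: inv_into_into f_inv_into_f)
  define n where "n = int (card W)"
  have n: "0 < n" using assms(1) by (simp add: n_def card_gt_0_iff)
  define e where "e i = g (h (nat (i mod n)))" for i
  have hW: "h (nat (i mod n)) \<in> lv ` W" for i
  proof -
    have "0 \<le> i mod n" "i mod n < n" using n by auto
    then have "nat (i mod n) < card (lv ` W)" using cW by (simp add: n_def nat_less_iff)
    then show ?thesis using h(1) by (auto simp: bij_betw_def)
  qed
  have "lv (e i) < lv (e j)" if "0 \<le> i" "i < j" "j < n" for i j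
  proof -
    have "lv (e i) = h (nat i)" "lv (e j) = h (nat j)"
      using g(2)[OF hW[of i]] g(2)[OF hW[of j]] that by (simp_all add: e_def)
    moreover have "h (nat i) < h (nat j)"
      using h(2) that cW by (auto simp: strict_mono_on_def n_def nat_less_iff)
    ultimately show ?thesis by simp
  qed
  then have c: "chain e n" using n by (auto simp: chain_def e_def)
  have "range e \<subseteq> W" using g(1)[OF hW] by (auto simp: e_def)
  moreover have "card (range e) = card W" using chain_card[OF c] by (simp add: n_def)
  ultimately have "range e = W" using fin card_subset_eq by blast
  then show ?thesis using that c by (simp add: n_def)
qed

text \<open>In either chain the position of a vector within a period is the number of vectors of
  smaller level.\<close>

lemma chain_unique:
  assumes c: "chain e n" "chain e' n" and r: "range e = range e'" shows "e = e'"
proof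
  fix i
  have key: "int (card {p \<in> range e. lv p < lv (e i)}) = i" if "0 \<le> i" "i < n" "chain e n" for e i
  proof -
    have "{p \<in> range e. lv p < lv (e i)} = e ` {0..<i}"
      unfolding chain_range[OF that(3)] using that chain_less_iff[OF that(3)] by force
    moreover have "inj_on e {0..<i}" using that by (auto simp: inj_on_def chain_eq)
    ultimately show ?thesis using that by (simp add: card_image)
  qed
  define k where "k = i mod n"
  have k: "0 \<le> k" "k < n" using chain_pos[OF c(1)] by (auto simp: k_def)
  have "e k \<in> e' ` {0..<n}" using r chain_range[OF c(2)] by blast
  then obtain j where j: "0 \<le> j" "j < n" "e k = e' j" by auto
  have "int (card {p \<in> range e. lv p < lv (e k)}) = k" by (rule key[OF k c(1)])
  moreover have "int (card {p \<in> range e'. lv p < lv (e' j)}) = j" by (rule key[OF j(1,2) c(2)])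
  ultimately have "j = k" using r j(3) by simp
  then have "e k = e' k" using j by simp
  then show "e i = e' i" using chain_mod[OF c(1)] chain_mod[OF c(2)] by (simp add: k_def)
qed

text \<open>\<open>kap\<close> compares \<open>lv (e i)\<close> and \<open>lv (e (i + 1))\<close>
  with \<open>- lv q\<close> and with each other. On an ascending step these comparisons balance
  unless \<open>- lv q\<close> lies strictly inside the step; on the closing step from the top to
  the bottom they balance because the chain encloses \<open>- lv q\<close>.\<close>

lemma chain_kap:
  assumes c: "chain e n" and ij: "lv (e j) \<le> - lv q" "- lv q \<le> lv (e k)"
  shows "kap (e i) q (star (e (i + 1))) = (if lv (e i) < - lv q \<and> - lv q < lv (e (i + 1)) then 0 else 1)"
proof -
  have n: "0 < n" using chain_pos[OF c] .
  define l where "l = i mod n"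
  have l: "0 \<le> l" "l < n" "e i = e l" using n chain_mod[OF c] by (auto simp: l_def)
  have j': "lv (e (j mod n)) \<le> - lv q" "- lv q \<le> lv (e (k mod n))"
    using ij chain_mod[OF c] by auto
  have b: "0 \<le> j mod n" "j mod n < n" "0 \<le> k mod n" "k mod n < n" using n by auto
  show ?thesis
  proof (cases "l + 1 < n")
    case True
    have "e (i + 1) = e (l + 1)" by (rule chain_cong[OF c]) (simp add: l_def mod_simps)
    moreover have "lv (e l) < lv (e (l + 1))" using chain_less_iff[OF c, of l "l + 1"] True l by simp
    ultimately show ?thesis unfolding l(3) by (auto simp: kap_def lev_def)
  next
    case False
    then have ln: "l = n - 1" using l by simp
    have "e (i + 1) = e (l + 1)" by (rule chain_cong[OF c]) (simp add: l_def mod_simps)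
    also have "\<dots> = e 0" by (rule chain_cong[OF c]) (simp add: ln)
    finally have 0: "e (i + 1) = e 0" .
    have "lv (e 0) \<le> - lv q"
      using j'(1) chain_less_iff[OF c b(1,2), of 0] b(1) n by force
    moreover have "- lv q \<le> lv (e l)"
      using j'(2) chain_less_iff[OF c, of l "k mod n"] b l ln by force
    ultimately show ?thesis unfolding l(3) 0 by (auto simp: kap_def lev_def)
  qed
qed

lemma chain_consecutive:
  assumes c: "chain e n" and b: "lv (e i) < lv (e j)" shows "\<not> lv (e j) < lv (e (i + 1))"
proof
  assume a: "lv (e j) < lv (e (i + 1))"
  have n: "0 < n" using chain_pos[OF c] .
  have m: "0 \<le> k mod n" "k mod n < n" for k using n by auto
  have "i mod n < j mod n" using b chain_less_iff[OF c m[of i] m[of j]] chain_mod[OF c] by simp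
  moreover have "j mod n < (i + 1) mod n"
    using a chain_less_iff[OF c m[of j] m[of "i + 1"]] chain_mod[OF c] by simp
  moreover have "(i + 1) mod n \<le> i mod n + 1"
    using n m[of i] by (metis add_increasing2 mod_add_left_eq zero_le_one zmod_le_nonneg_dividend)
  ultimately show False by simp
qed

lemma chain_kap_level:
  assumes c: "chain e n" and q: "- lv q \<in> lv ` range e"
  shows "kap (e i) q (star (e (i + 1))) = 1"
proof -
  obtain j where j: "- lv q = lv (e j)" using q by blast
  show ?thesis
    using chain_kap[OF c, of j q j i] chain_consecutive[OF c, of i j] j by auto
qed

text \<open>The sum of the products of \<open>e i\<close> and \<open>star (e (i + 1))\<close>. By
  the trace form and up to signs, such a product is the operator between two neighbours of the
  chain, so the sum is a cyclic shift. The value 0 or 1 avoids double counting when both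
  alternatives hold.\<close>

definition chform :: "(int \<Rightarrow> 'b) \<Rightarrow> 'b \<Rightarrow> 'b \<Rightarrow> 'k" where
  "chform e p r = of_bool ((\<exists>i. p = e i \<and> r = star (e (i + 1))) \<or> (\<exists>i. r = e i \<and> p = star (e (i + 1))))"

lemma star_eq_iff: "star p = star q \<longleftrightarrow> p = q" by (metis star_star)

lemma chform_symm: "chform e \<in> symm (range e \<union> star ` range e)"
  by (rule symmI) (auto simp: chform_def split: if_splits)

text \<open>On a chain closed under \<open>star\<close>, which negates levels, \<open>star\<close>
  has to reverse the order; periodicity turns \<open>n - 1 - i\<close> into
  \<open>- 1 - i\<close>.\<close>

definition row :: "(int \<Rightarrow> 'b) \<Rightarrow> int \<Rightarrow> bool" where
  "row e n \<longleftrightarrow> chain e n \<and> (\<forall>i. star (e i) = e (- 1 - i))"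

text \<open>The pair of \<open>e i\<close> and \<open>star (e (i + 1))\<close> arises once more from
  the index \<open>- 2 - i\<close>, in the opposite order. Hence both alternatives of
  \<open>chform\<close> describe the same entries and each column has exactly one.\<close>

lemma row_chform:
  assumes r: "row e n" shows "chform e p (star (e (i + 1))) = of_bool (p = e i)"
proof -
  have c: "chain e n" and s: "\<And>i. star (e i) = e (- 1 - i)" using r by (auto simp: row_def)
  have 1: "e j = e i" if "star (e (i + 1)) = star (e (j + 1))" for j
  proof -
    have "(i + 1) mod n = (j + 1) mod n" using that by (simp add: star_eq_iff chain_eq[OF c])
    then have "(i + 1 - 1) mod n = (j + 1 - 1) mod n" by (rule mod_diff_cong) simp
    then show ?thesis by (intro chain_cong[OF c]) simp
  qed
  have 2: "star (e (j + 1)) = e i" if "star (e (i + 1)) = e j" for j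
  proof -
    have "(- 1 - (i + 1)) mod n = j mod n" using that by (simp add: s chain_eq[OF c])
    then have "(- 2 - (- 1 - (i + 1))) mod n = (- 2 - j) mod n" by (rule mod_diff_cong[OF refl])
    moreover have "- 2 - (- 1 - (i + 1)) = i" "- 1 - (j + 1) = - 2 - j" by simp_all
    ultimately show ?thesis unfolding s by (intro chain_cong[OF c]) (simp only:)
  qed
  show ?thesis unfolding chform_def
  proof (rule arg_cong[where f = of_bool], rule iffI)
    assume "(\<exists>j. p = e j \<and> star (e (i + 1)) = star (e (j + 1))) \<or>
      (\<exists>j. star (e (i + 1)) = e j \<and> p = star (e (j + 1)))"
    then show "p = e i"
    proof (elim disjE exE conjE)
      fix j assume "p = e j" "star (e (i + 1)) = star (e (j + 1))"
      then show ?thesis using 1[of j] by blast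
    next
      fix j assume "star (e (i + 1)) = e j" "p = star (e (j + 1))"
      then show ?thesis using 2[of j] by simp
    qed
  qed blast
qed

text \<open>The two alternatives of \<open>chform\<close> now concern different columns, those at
  the dual chain and those at the chain itself.\<close>

lemma disjoint_chform:
  assumes c: "chain e n" and d: "range e \<inter> star ` range e = {}"
  shows "chform e p (star (e (i + 1))) = of_bool (p = e i)"
    and "chform e p (e i) = of_bool (p = star (e (i + 1)))"
proof -
  have 1: "e j = e i" if "star (e (i + 1)) = star (e (j + 1))" for i j
  proof -
    have "(i + 1) mod n = (j + 1) mod n" using that by (simp add: star_eq_iff chain_eq[OF c])
    then have "(i + 1 - 1) mod n = (j + 1 - 1) mod n" by (rule mod_diff_cong) simp
    then show ?thesis by (intro chain_cong[OF c]) simp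
  qed
  have 2: "e i \<noteq> star (e j)" for i j using d by blast
  have h2: "star (e j) \<noteq> e i" for i j using 2[of i j] by metis
  have 3: "e (i + 1) = e (j + 1)" if "e i = e j" for i j
    using that mod_add_cong[of i n j 1 1] by (simp only: chain_eq[OF c])
  show "chform e p (star (e (i + 1))) = of_bool (p = e i)"
    unfolding chform_def
  proof (rule arg_cong[where f = of_bool], rule iffI)
    assume "(\<exists>j. p = e j \<and> star (e (i + 1)) = star (e (j + 1))) \<or>
      (\<exists>j. star (e (i + 1)) = e j \<and> p = star (e (j + 1)))"
    then show "p = e i"
    proof (elim disjE exE conjE)
      fix j assume "p = e j" "star (e (i + 1)) = star (e (j + 1))"
      then show ?thesis using 1[of i j] by simp
    next
      fix j assume "star (e (i + 1)) = e j"
      then show ?thesis using h2[of "i + 1" j] by simp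
    qed
  qed blast
  show "chform e p (e i) = of_bool (p = star (e (i + 1)))"
    unfolding chform_def
  proof (rule arg_cong[where f = of_bool], rule iffI)
    assume "(\<exists>j. p = e j \<and> e i = star (e (j + 1))) \<or> (\<exists>j. e i = e j \<and> p = star (e (j + 1)))"
    then show "p = star (e (i + 1))"
    proof (elim disjE exE conjE)
      fix j assume "e i = e j" "p = star (e (j + 1))"
      then show ?thesis using 3[of i j] by simp
    qed (use 2 in blast)
  qed blast
qed

lemma col_single:
  assumes "\<And>p. \<xi> p s = of_bool (p = p0)" shows "col \<xi> q v s = kap p0 q s * v p0"
proof -
  have "col \<xi> q v s = (\<Sum>p\<in>UNIV. if p = p0 then kap p0 q s * v p0 else 0)"
    unfolding col_def assms by (rule sum.cong) auto
  then show ?thesis by simp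
qed

lemma row_star_range: "row e n \<Longrightarrow> star ` range e = range e"
proof -
  assume "row e n"
  then have s: "\<And>i. star (e i) = e (- 1 - i)" by (simp add: row_def)
  show ?thesis
  proof
    show "star ` range e \<subseteq> range e" using s by auto
    show "range e \<subseteq> star ` range e" using s by (metis image_subset_iff rangeI star_star subsetI imageI)
  qed
qed

lemma row_symm: "row e n \<Longrightarrow> chform e \<in> symm (range e)"
  using chform_symm[of e] row_star_range[of e n] by simp

lemma row_col:
  assumes "row e n" shows "col (chform e) q v (star (e (i + 1))) = kap (e i) q (star (e (i + 1))) * v (e i)"
  by (rule col_single) (rule row_chform[OF assms])

lemma row_nondeg:
  assumes r: "row e n" and q: "lv q \<in> lv ` range e" shows "nondeg (range e) (chform e) q"
  unfolding nondeg_def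
proof (intro allI impI, elim conjE)
  fix v assume v: "supp_in (range e) v" "\<forall>s\<in>range e. col (chform e) q v s = 0"
  have c: "chain e n" using r by (simp add: row_def)
  obtain j where "lv q = lv (e j)" using q by blast
  then have "- lv q = lv (star (e j))" by simp
  then have q': "- lv q \<in> lv ` range e" using row_star_range[OF r] by blast
  have "v (e i) = 0" for i
  proof -
    have "star (e (i + 1)) \<in> range e" using row_star_range[OF r] by blast
    then have "col (chform e) q v (star (e (i + 1))) = 0" using v(2) by blast
    then show ?thesis using row_col[OF r, of q v i] chain_kap_level[OF c q', of i] by simp
  qed
  then have "v p = 0" if "p \<in> range e" for p using that by blast
  then show "v = (\<lambda>_. 0)" using v(1) unfolding supp_in_def by blast
qed

text \<open>At the columns of the dual chain no entry is lost to \<open>kap\<close> because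
  \<open>- lv q\<close> is a level of the chain, at those of the chain itself because
  \<open>lv q\<close> is one.\<close>

lemma disjoint_nondeg:
  assumes c: "chain e n" and d: "range e \<inter> star ` range e = {}"
    and q: "lv q \<in> lv ` range e" "- lv q \<in> lv ` range e"
  shows "nondeg (range e \<union> star ` range e) (chform e) q"
  unfolding nondeg_def
proof (intro allI impI, elim conjE)
  fix v assume v: "supp_in (range e \<union> star ` range e) v"
    "\<forall>s\<in>range e \<union> star ` range e. col (chform e) q v s = 0"
  have 1: "v (e i) = 0" for i
  proof -
    have "col (chform e) q v (star (e (i + 1))) = kap (e i) q (star (e (i + 1))) * v (e i)"
      by (rule col_single) (rule disjoint_chform[OF c d])
    then show ?thesis using v(2) chain_kap_level[OF c q(2), of i] by simp
  qed
  have 2: "v (star (e (i + 1))) = 0" for i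
  proof -
    have "col (chform e) q v (e i) = kap (star (e (i + 1))) q (e i) * v (star (e (i + 1)))"
      by (rule col_single) (rule disjoint_chform[OF c d])
    moreover have "kap (star (e (i + 1))) q (e i) = 1"
      using chain_kap_level[OF c, of "star q" i] q(1) kap_sym[of "e i" q "star (e (i + 1))"] by simp
    ultimately show ?thesis using v(2) by simp
  qed
  have "v (star (e i)) = 0" for i using 2[of "i - 1"] by simp
  then have "v p = 0" if "p \<in> range e \<union> star ` range e" for p using 1 that by blast
  then show "v = (\<lambda>_. 0)" using v(1) unfolding supp_in_def by blast
qed

lemma star_closed_image: "star ` B \<subseteq> B \<Longrightarrow> star ` B = B"
  by (metis image_subset_iff star_star subsetI subset_antisym imageI)

text \<open>Reversing the ascending chain of \<open>F\<close> and applying \<open>star\<close> gives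
  an ascending chain with the same range, so the two coincide.\<close>

lemma row_exists:
  assumes F: "F \<noteq> {}" "star ` F \<subseteq> F" "inj_on lv F"
  obtains e n where "row e n" "range e = F"
proof -
  obtain e where e: "chain e (int (card F))" "range e = F" using chain_exists[OF F(1,3)] .
  define n where "n = int (card F)"
  have c: "chain e n" using e(1) by (simp add: n_def)
  have n: "0 < n" by (rule chain_pos[OF c])
  define e' where "e' i = star (e (- 1 - i))" for i
  have "e' (i mod n) = e' i" for i
  proof -
    have "e (- 1 - i mod n) = e (- 1 - i)" by (rule chain_cong[OF c]) (simp add: mod_simps)
    then show ?thesis by (simp add: e'_def)
  qed
  moreover have "lv (e' i) < lv (e' j)" if "0 \<le> i" "i < j" "j < n" for i j
  proof -
    have "e (- 1 - k) = e (n - 1 - k)" for k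
      by (rule chain_cong[OF c]) (metis add_diff_eq diff_add_eq mod_add_self1 add_uminus_conv_diff add.commute)
    then have "lv (e' i) = - lv (e (n - 1 - i))" "lv (e' j) = - lv (e (n - 1 - j))"
      by (simp_all add: e'_def)
    then show ?thesis using chain_less_iff[OF c, of "n - 1 - j" "n - 1 - i"] that by simp
  qed
  ultimately have c': "chain e' n" using n by (simp add: chain_def)
  have "range e' = range e"
  proof -
    have "range (\<lambda>i. e (- 1 - i)) = range e"
    proof
      show "range e \<subseteq> range (\<lambda>i. e (- 1 - i))"
      proof
        fix p assume "p \<in> range e"
        then obtain i where "p = e (- 1 - (- 1 - i))" by auto
        then show "p \<in> range (\<lambda>i. e (- 1 - i))" by blast
      qed
    qed auto
    then show ?thesis using star_closed_image[OF F(2)] e(2) unfolding e'_def by (metis image_image)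
  qed
  then have "e' = e" using chain_unique[OF c' c] by simp
  then have "star (e i) = e (- 1 - i)" for i by (metis e'_def star_star)
  then show ?thesis by (intro that[of e n]) (simp_all add: row_def c e(2))
qed

lemma row_even: assumes r: "row e n" shows "even n"
proof (rule ccontr)
  have c: "chain e n" and s: "\<And>i. star (e i) = e (- 1 - i)" using r by (auto simp: row_def)
  assume "odd n"
  then obtain k where "n = 2 * k + 1" by (elim oddE)
  then have "- 1 - k + n = k" by simp
  then have "(- 1 - k) mod n = k mod n" by (metis mod_add_self2)
  then have "star (e k) = e k" using s chain_cong[OF c] by metis
  then show False using star_neq by blast
qed

text \<open>The equations tie \<open>x (e i) (e k)\<close> to
  \<open>x (e (i + 1)) (e (k - 1))\<close>, so \<open>x\<close> is determined by one entry for each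
  value of \<open>i + k\<close> modulo \<open>n\<close>. Odd sums contribute nothing; the even ones
  correspond to the odd powers of the cyclic shift.\<close>

lemma row_kern:
  assumes r: "row e n" and x: "x \<in> kern (range e) (chform e)"
    and Z: "\<And>k. 0 \<le> k \<Longrightarrow> k < n \<Longrightarrow> even k \<Longrightarrow> x (e 0) (e k) = 0"
  shows "x = (\<lambda>_ _. 0)"
proof -
  have c: "chain e n" using r by (simp add: row_def)
  have n: "0 < n" "even n" using chain_pos[OF c] row_even[OF r] by auto
  have xs: "x \<in> symm (range e)" using x by (simp add: kern_def)
  have lv: "- lv (e i) \<in> lv ` range e" for i
    using row_star_range[OF r] by (metis imageI lv_star rangeI)
  have D: "D (chform e) x (star (e k)) (star (e (i + 1))) = sg (e k) * x (e i) (e k)" for i k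
    using chain_kap_level[OF c lv, of i k] by (simp add: D_def row_col[OF r])
  have rel: "sg (e k) * x (e i) (e k) + sg (e (i + 1)) * x (e (k - 1)) (e (i + 1)) = 0" for i k
  proof -
    have "star (e k) \<in> range e" "star (e (i + 1)) \<in> range e" using row_star_range[OF r] by blast+
    then have "eqn (chform e) x (star (e k)) (star (e (i + 1))) = 0" using x unfolding kern_def by blast
    then show ?thesis using D[of k i] D[of "i + 1" "k - 1"] by (simp add: eqn_def)
  qed
  have step: "x (e i) (e k) = 0 \<longleftrightarrow> x (e (i + 1)) (e (k - 1)) = 0" for i k
    using rel[where i = i and k = k] symmD[OF xs, of "e (i + 1)" "e (k - 1)"]
    by (metis add_0 add_cancel_left_right mult_eq_0_iff sg_nz)
  have up: "x (e i) (e k) = 0 \<longleftrightarrow> x (e (i + int j)) (e (k - int j)) = 0" for i j k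
  proof (induction j)
    case (Suc j)
    then show ?case using step[of "i + int j" "k - int j"] by (simp add: algebra_simps)
  qed simp
  have shift: "x (e i) (e k) = 0 \<longleftrightarrow> x (e 0) (e (i + k)) = 0" for i k
  proof (cases "0 \<le> i")
    case True
    then show ?thesis using up[of 0 "i + k" "nat i"] by simp
  next
    case False
    then show ?thesis using up[of i k "nat (- i)"] by (simp add: add.commute)
  qed
  have "x (e i) (e k) = 0" for i k
  proof (cases "even (i + k)")
    case True
    have "x (e 0) (e ((i + k) mod n)) = 0"
      using n True by (intro Z) (auto simp: dvd_mod)
    then show ?thesis using shift chain_mod[OF c] by metis
  next
    case False
    then obtain j where j: "i + k = 2 * j + 1" by (elim oddE)
    \<comment> \<open>For an odd sum the relation at neighbouring indices ties an entry to itself,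
      with equal signs.\<close>
    have "(sg (e (j + 1)) + sg (e (j + 1))) * x (e j) (e (j + 1)) = 0"
      using rel[of "j + 1" j] by (simp add: distrib_right)
    moreover have "sg (e (j + 1)) + sg (e (j + 1)) \<noteq> 0" by (metis mult_2 mult_eq_0_iff sg_nz zero_neq_numeral)
    ultimately have "x (e j) (e (j + 1)) = 0" by simp
    then show ?thesis using shift[of j "j + 1"] shift[of i k] j by (simp add: algebra_simps)
  qed
  then have "x p q = 0" for p q using symm_supp[OF xs, of p q] by blast
  then show ?thesis by (simp add: fun_eq_iff)
qed

text \<open>\<open>star\<close> exchanges the two middle vectors, so their levels are opposite and
  enclose 0. The step between them is the only one lost to \<open>kap\<close> against a vector of
  level 0.\<close>

lemma row_mid:
  assumes r: "row e n"
  shows "lv (e (n div 2 - 1)) < 0"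
    and "lv q = 0 \<Longrightarrow> kap (e i) q (star (e (i + 1))) = (if e i = e (n div 2 - 1) then 0 else 1)"
proof -
  have c: "chain e n" and s: "\<And>i. star (e i) = e (- 1 - i)" using r by (auto simp: row_def)
  obtain t where t: "n = 2 * t" using row_even[OF r] by (elim evenE)
  have t0: "0 < t" using chain_pos[OF c] t by simp
  have "(- 1 - (t - 1)) mod n = t mod n"
  proof -
    have "- 1 - (t - 1) + n = t" using t by simp
    then show ?thesis by (metis mod_add_self2)
  qed
  then have "star (e (t - 1)) = e t" unfolding s by (rule chain_cong[OF c])
  then have "lv (e t) = - lv (e (t - 1))" by (metis lv_star)
  moreover have "lv (e (t - 1)) < lv (e t)" using chain_less_iff[OF c, of "t - 1" t] t t0 by simp
  ultimately have m: "lv (e (t - 1)) < 0" "0 < lv (e t)" by auto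
  then show "lv (e (n div 2 - 1)) < 0" using t by simp
  assume q: "lv q = 0"
  have "lv (e i) < 0 \<and> 0 < lv (e (i + 1)) \<longleftrightarrow> e i = e (t - 1)"
  proof
    assume a: "lv (e i) < 0 \<and> 0 < lv (e (i + 1))"
    have "\<not> lv (e i) < lv (e (t - 1))" using chain_consecutive[OF c, of i "t - 1"] a m by linarith
    moreover have "\<not> lv (e (t - 1)) < lv (e i)"
      using chain_consecutive[OF c, of "t - 1" i] a m by auto
    ultimately have "lv (e i) = lv (e (t - 1))" by simp
    from chain_lv_eq[OF c this] show "e i = e (t - 1)" by (rule chain_cong[OF c])
  next
    assume a: "e i = e (t - 1)"
    then have "(i + 1) mod n = (t - 1 + 1) mod n" unfolding chain_eq[OF c] by (rule mod_add_cong) simp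
    then have "e (i + 1) = e t" using chain_cong[OF c, of "i + 1" t] by simp
    then show "lv (e i) < 0 \<and> 0 < lv (e (i + 1))" using a m by simp
  qed
  then show "kap (e i) q (star (e (i + 1))) = (if e i = e (n div 2 - 1) then 0 else 1)"
    using chain_kap[OF c, of "t - 1" q t i] q m t by auto
qed

text \<open>On the row \<open>F\<close>, the stabiliser elements between \<open>F\<close> and a vector of level \<open>0\<close> are spanned by a single
  one, with entry at \<open>f\<close>.\<close>

definition row_form :: "'b set \<Rightarrow> ('b \<Rightarrow> 'b \<Rightarrow> 'k) \<Rightarrow> ('b \<times> 'b) set \<Rightarrow> 'b \<Rightarrow> bool" where
  "row_form F \<xi> Z f \<longleftrightarrow> \<xi> \<in> symm F \<and> finite Z \<and> 2 * card Z \<le> card F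
    \<and> rigid F \<xi> Z
    \<and> (\<forall>q. lv q \<in> lv ` F \<longrightarrow> nondeg F \<xi> q)
    \<and> (\<forall>q v. lv q = 0 \<longrightarrow> (\<forall>s\<in>F. col \<xi> q v s = 0) = (\<forall>p\<in>F. p \<noteq> f \<longrightarrow> v p = 0))
    \<and> (F \<noteq> {} \<longrightarrow> f \<in> F \<and> lv f < 0)"

lemma row_form_exists:
  assumes F: "star ` F \<subseteq> F" "inj_on lv F" obtains \<xi> Z f where "row_form F \<xi> Z f"
proof (cases "F = {}")
  case True
  have "rigid {} (\<lambda>_ _. 0) {}" by (auto simp: rigid_def kern_def symm_def fun_eq_iff)
  then have "row_form {} (\<lambda>_ _. 0) {} undefined"
    unfolding row_form_def by (simp add: symm_def)
  then have "row_form F (\<lambda>_ _. 0) {} undefined" by (simp only: True)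
  then show ?thesis by (rule that)
next
  case False
  obtain e n where r: "row e n" and F': "range e = F" using row_exists[OF False F] .
  have c: "chain e n" using r by (simp add: row_def)
  define K where "K = {k. 0 \<le> k \<and> k < n \<and> even k}"
  define Z where "Z = (\<lambda>k. (e 0, e k)) ` K"
  have n: "0 < n" "even n" using chain_pos[OF c] row_even[OF r] by auto
  have K: "K \<subseteq> (\<lambda>k. 2 * int k) ` {..<nat (n div 2)}"
  proof
    fix k assume "k \<in> K"
    then have k: "0 \<le> k" "k < n" "even k" by (auto simp: K_def)
    then have "k = 2 * int (nat (k div 2))" by simp
    moreover have "nat (k div 2) < nat (n div 2)"
    proof -
      obtain a where "k = 2 * a" using k(3) by (rule evenE)
      moreover obtain b where "n = 2 * b" using n(2) by (rule evenE)
      ultimately show ?thesis using k by simp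
    qed
    ultimately show "k \<in> (\<lambda>k. 2 * int k) ` {..<nat (n div 2)}" by blast
  qed
  then have finK: "finite K" by (rule finite_subset) simp
  have "card K \<le> card ((\<lambda>k. 2 * int k) ` {..<nat (n div 2)})" by (rule card_mono[OF _ K]) simp
  then have "card K \<le> nat (n div 2)"
    using card_image_le[of "{..<nat (n div 2)}" "\<lambda>k. 2 * int k"] by simp
  moreover have "card Z \<le> card K" unfolding Z_def by (rule card_image_le[OF finK])
  moreover have "card F = nat n" using chain_card[OF c] F' by simp
  ultimately have cZ: "2 * card Z \<le> card F" using n by auto
  have "row_form F (chform e) Z (e (n div 2 - 1))"
    unfolding row_form_def
  proof (intro conjI allI impI ballI)
    show "chform e \<in> symm F" using row_symm[OF r] F' by simp
    show "finite Z" using finK by (simp add: Z_def)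
    show "2 * card Z \<le> card F" by (rule cZ)
  next
    show "rigid F (chform e) Z"
      unfolding rigid_def
    proof (intro ballI impI)
      fix x assume x: "x \<in> kern F (chform e)" "\<forall>(p, q)\<in>Z. x p q = 0"
      show "x = (\<lambda>_ _. 0)"
        by (rule row_kern[OF r]) (use x F' in \<open>auto simp: Z_def K_def\<close>)
    qed
  next
    show "nondeg F (chform e) q" if "lv q \<in> lv ` F" for q using row_nondeg[OF r] that F' by simp
  next
    fix q v assume q: "lv q = 0"
    have "(\<forall>s\<in>F. col (chform e) q v s = 0) \<longleftrightarrow> (\<forall>i. col (chform e) q v (star (e (i + 1))) = 0)"
    proof
      assume "\<forall>s\<in>F. col (chform e) q v s = 0"
      moreover have "star (e (i + 1)) \<in> F" for i using F' row_star_range[OF r] by blast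
      ultimately show "\<forall>i. col (chform e) q v (star (e (i + 1))) = 0" by blast
    next
      assume a: "\<forall>i. col (chform e) q v (star (e (i + 1))) = 0"
      show "\<forall>s\<in>F. col (chform e) q v s = 0"
      proof
        fix s assume "s \<in> F"
        then obtain j where "s = star (e j)" using F' row_star_range[OF r] by blast
        then show "col (chform e) q v s = 0" using spec[OF a, of "j - 1"] by simp
      qed
    qed
    also have "\<dots> \<longleftrightarrow> (\<forall>i. e i \<noteq> e (n div 2 - 1) \<longrightarrow> v (e i) = 0)"
      by (simp add: row_col[OF r] row_mid(2)[OF r q]) 
    also have "\<dots> \<longleftrightarrow> (\<forall>p\<in>F. p \<noteq> e (n div 2 - 1) \<longrightarrow> v p = 0)" using F' by blast
    finally show "(\<forall>s\<in>F. col (chform e) q v s = 0) = (\<forall>p\<in>F. p \<noteq> e (n div 2 - 1) \<longrightarrow> v p = 0)" .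
  next
    show "e (n div 2 - 1) \<in> F" "lv (e (n div 2 - 1)) < 0" using F' row_mid(1)[OF r] by auto
  qed
  then show ?thesis by (rule that)
qed

section \<open>Blocks with a pair of level 0\<close>

lemma symm_zero: "(\<lambda>_ _. 0) \<in> symm B" by (simp add: symm_def)

lemma comb_zero: "comb t \<xi> (\<lambda>_ _. 0) = \<xi>" by (simp add: comb_def)

lemma D_single:
  assumes "\<And>p. \<eta> p s = of_bool (p = p0)"
  shows "D \<eta> x r s = sg (star r) * (kap p0 (star r) s * x p0 (star r))"
proof -
  have "col \<eta> (star r) (\<lambda>p. x p (star r)) s = kap p0 (star r) s * x p0 (star r)"
    by (rule col_single) (rule assms)
  then show ?thesis by (simp add: D_def)
qed

lemma D_none: "(\<And>p. \<eta> p s = 0) \<Longrightarrow> D \<eta> x r s = 0"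
  by (simp add: D_def col_def)

text \<open>One vector is chosen on each positive level and the choice is closed under
  \<open>star\<close>. Level 0 must be left out, as \<open>star\<close> preserves it without fixed
  points.\<close>

lemma row_select:
  assumes "star ` B \<subseteq> B"
  obtains F where "F \<subseteq> B" "star ` F \<subseteq> F" "inj_on lv F" "lv ` F = lv ` B - {0}"
proof -
  define h where "h = inv_into B lv"
  define P where "P = h ` {a \<in> lv ` B. 0 < a}"
  have h: "h a \<in> B" "lv (h a) = a" if "a \<in> lv ` B" for a
    using that unfolding h_def by (simp_all add: inv_into_into f_inv_into_f)
  have P: "p \<in> B" "0 < lv p" "h (lv p) = p" if "p \<in> P" for p
    using that h by (auto simp: P_def)
  have "P \<union> star ` P \<subseteq> B" using P assms by auto
  moreover have "star ` (P \<union> star ` P) \<subseteq> P \<union> star ` P" by (auto simp: image_iff)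
  moreover have "inj_on lv (P \<union> star ` P)"
  proof (rule inj_onI)
    fix p q assume pq: "p \<in> P \<union> star ` P" "q \<in> P \<union> star ` P" "lv p = lv q"
    show "p = q"
    proof (cases "p \<in> P")
      case True
      then have "0 < lv q" using pq(3) P(2)[of p] by simp
      then have "q \<in> P" using pq(2) P(2) by force
      then show ?thesis using True P(3) pq(3) by metis
    next
      case False
      then obtain p' where p': "p = star p'" "p' \<in> P" using pq by blast
      then have "q \<notin> P" using pq(3) P(2)[of q] P(2)[of p'] by auto
      then obtain q' where q': "q = star q'" "q' \<in> P" using pq by blast
      then have "lv p' = lv q'" using p' pq(3) by simp
      then have "p' = q'" using P(3)[OF p'(2)] P(3)[OF q'(2)] by metis
      then show ?thesis using p' q' by simp
    qed
  qed
  moreover have "lv ` (P \<union> star ` P) = lv ` B - {0}"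
  proof
    show "lv ` (P \<union> star ` P) \<subseteq> lv ` B - {0}"
      using P(2) \<open>P \<union> star ` P \<subseteq> B\<close> by force
    show "lv ` B - {0} \<subseteq> lv ` (P \<union> star ` P)"
    proof
      fix a assume "a \<in> lv ` B - {0}"
      then obtain p where p: "p \<in> B" "lv p = a" "a \<noteq> 0" by auto
      show "a \<in> lv ` (P \<union> star ` P)"
      proof (cases "0 < a")
        case True
        then have "h a \<in> P" using p by (auto simp: P_def)
        moreover have "a = lv (h a)" using h(2)[of a] p by force
        ultimately show ?thesis by blast
      next
        case False
        have "- a \<in> lv ` B" using p assms by (metis image_eqI image_subset_iff lv_star)
        then have "h (- a) \<in> P" "lv (star (h (- a))) = a" using False p(3) h(2)[of "- a"] by (auto simp: P_def)
        then show ?thesis by (metis UnI2 image_eqI)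
      qed
    qed
  qed
  ultimately show ?thesis by (rule that)
qed

lemma half_rigid_row_form:
  assumes "row_form F \<xi> Z f" shows "half_rigid F"
proof -
  have "\<xi> \<in> symm F" "finite Z \<and> 2 * card Z \<le> card F \<and> rigid F \<xi> Z"
    using assms by (simp_all add: row_form_def)
  then show ?thesis unfolding half_rigid_def by (intro bexI exI)
qed

text \<open>What the forms of the rows leave of a stabiliser element once the entries in
  \<open>Z \<union> Z'\<close> vanish: anything inside \<open>U\<close>, but towards the rows only
  entries at \<open>f\<close> and \<open>e\<close>.\<close>

definition confined :: "'b set \<Rightarrow> 'b set \<Rightarrow> 'b \<Rightarrow> 'b set \<Rightarrow> 'b \<Rightarrow> ('b \<Rightarrow> 'b \<Rightarrow> 'k) \<Rightarrow> bool" where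
  "confined U F f E e x \<longleftrightarrow> (\<forall>p\<in>F \<union> E. \<forall>q\<in>F \<union> E. x p q = 0)
    \<and> (\<forall>z\<in>U. (\<forall>p\<in>F. p \<noteq> f \<longrightarrow> x p z = 0) \<and> (\<forall>p\<in>E. p \<noteq> e \<longrightarrow> x p z = 0))"

text \<open>The form joins those of the two rows and has no entry at \<open>U\<close>. An equation
  between \<open>U\<close> and the rows is therefore the column condition of a row at level 0, which
  spares exactly \<open>f\<close> and \<open>e\<close>, and inside \<open>U\<close> there is no
  condition.\<close>

lemma block_form:
  assumes F: "row_form F \<xi> Z f" "star ` F \<subseteq> F" and E: "row_form E \<xi>' Z' e" "star ` E \<subseteq> E"
    and d: "F \<inter> E = {}" and l: "lv ` E \<subseteq> lv ` F"
    and U: "U \<inter> (F \<union> E) = {}" "star ` U \<subseteq> U" "\<And>z. z \<in> U \<Longrightarrow> lv z = 0"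
  shows "\<exists>\<xi>0\<in>symm (F \<union> E). \<forall>x.
    (x \<in> kern (F \<union> E \<union> U) \<xi>0 \<and> (\<forall>(p, q)\<in>Z \<union> Z'. x p q = 0) \<longrightarrow> confined U F f E e x) \<and>
    (x \<in> symm (F \<union> E \<union> U) \<and> confined U F f E e x \<longrightarrow> x \<in> kern (F \<union> E \<union> U) \<xi>0)"
proof -
  define C where "C = F \<union> E"
  have \<xi>: "\<xi> \<in> symm F" and ZF: "rigid F \<xi> Z"
    and NF: "\<And>q. lv q \<in> lv ` F \<Longrightarrow> nondeg F \<xi> q"
    and mF: "\<And>q v. lv q = 0 \<Longrightarrow> (\<forall>s\<in>F. col \<xi> q v s = 0) = (\<forall>p\<in>F. p \<noteq> f \<longrightarrow> v p = 0)"
    using F(1) by (simp_all add: row_form_def)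
  have \<xi>': "\<xi>' \<in> symm E" and ZE: "rigid E \<xi>' Z'"
    and mE: "\<And>q v. lv q = 0 \<Longrightarrow> (\<forall>s\<in>E. col \<xi>' q v s = 0) = (\<forall>p\<in>E. p \<noteq> e \<longrightarrow> v p = 0)"
    using E(1) by (simp_all add: row_form_def)
  have N: "\<forall>q\<in>E. nondeg F \<xi> q" using NF l by auto
  obtain t where t: "t \<noteq> 0"
    and tk: "rigid C (comb t \<xi> \<xi>') (Z \<union> Z')"
    unfolding C_def
    by (rule rigid_union[OF d F(2) E(2) \<xi> ZF N \<xi>' ZE])
  define \<xi>0 where "\<xi>0 = comb t \<xi> \<xi>'"
  have \<xi>0: "\<xi>0 \<in> symm C" unfolding \<xi>0_def C_def
    by (intro symm_comb symm_mono[OF _ \<xi>] symm_mono[OF _ \<xi>']) auto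
  have colF: "col \<xi>0 q v s = col \<xi> q v s" if "s \<in> F" for q v s
  proof -
    have "\<xi>' p s = 0" for p using symm_supp[OF \<xi>', of p s] that d by blast
    then show ?thesis unfolding \<xi>0_def col_comb by (simp add: col_def)
  qed
  have colE: "col \<xi>0 q v s = t * col \<xi>' q v s" if "s \<in> E" for q v s
  proof -
    have "\<xi> p s = 0" for p using symm_supp[OF \<xi>, of p s] that d by blast
    then show ?thesis unfolding \<xi>0_def col_comb by (simp add: col_def)
  qed
  have mid: "(\<forall>s\<in>C. col \<xi>0 z v s = 0) \<longleftrightarrow> (\<forall>p\<in>F. p \<noteq> f \<longrightarrow> v p = 0) \<and> (\<forall>p\<in>E. p \<noteq> e \<longrightarrow> v p = 0)"
    if "lv z = 0" for z v
    using mF[OF that, of v] mE[OF that, of v] colF[of _ z v] colE[of _ z v] t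
    by (auto simp: C_def ball_Un)
  have noU: "D \<xi>0 x r s = 0" if "s \<in> U" for x r s
    by (rule D_none) (use symm_supp[OF \<xi>0] that U(1) in \<open>auto simp: C_def\<close>)
  have CU: "C \<inter> U = {}" "star ` C \<subseteq> C" using U(1) F(2) E(2) by (auto simp: C_def)
  show ?thesis
  proof (intro bexI[of _ \<xi>0] allI conjI[of "_ \<longrightarrow> _"] impI; (elim conjE)?)
    show "\<xi>0 \<in> symm (F \<union> E)" using \<xi>0 by (simp add: C_def)
  next
    fix x assume x: "x \<in> kern (F \<union> E \<union> U) \<xi>0" and z: "\<forall>(p, q)\<in>Z \<union> Z'. x p q = 0"
    have "restr C x \<in> kern C \<xi>0"
      by (rule kern_restr[OF \<xi>0 symm_zero CU, of x 0]) (use x in \<open>simp add: comb_zero C_def\<close>)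
    moreover have "\<forall>(p, q)\<in>Z \<union> Z'. restr C x p q = 0" using z by (auto simp: restr_def)
    ultimately have "restr C x = (\<lambda>_ _. 0)" using tk unfolding rigid_def \<xi>0_def by blast
    then have "restr C x p q = 0" for p q by (rule fun_cong[OF fun_cong])
    then have 1: "x p q = 0" if "p \<in> C" "q \<in> C" for p q
      using that by (metis restr_def)
    have 2: "(\<forall>p\<in>F. p \<noteq> f \<longrightarrow> x p z = 0) \<and> (\<forall>p\<in>E. p \<noteq> e \<longrightarrow> x p z = 0)" if z: "z \<in> U" for z
    proof -
      have sz: "star z \<in> U" using z U(2) by blast
      have "col \<xi>0 z (\<lambda>p. x p z) s = 0" if s: "s \<in> C" for s
      proof -
        have "eqn \<xi>0 x (star z) s = 0" using x s sz unfolding kern_def C_def by blast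
        then show ?thesis using noU[OF sz, of x s] by (simp add: eqn_def D_def)
      qed
      then show ?thesis using mid[OF U(3)[OF z], of "\<lambda>p. x p z"] by blast
    qed
    show "confined U F f E e x" using 1 2 by (simp add: C_def confined_def)
  next
    fix x assume x: "x \<in> symm (F \<union> E \<union> U)" and "confined U F f E e x"
    then have 1: "\<forall>p\<in>F \<union> E. \<forall>q\<in>F \<union> E. x p q = 0"
      and 2: "\<forall>z\<in>U. (\<forall>p\<in>F. p \<noteq> f \<longrightarrow> x p z = 0) \<and> (\<forall>p\<in>E. p \<noteq> e \<longrightarrow> x p z = 0)"
      by (simp_all add: confined_def)
    have "D \<xi>0 x r s = 0" if r: "r \<in> C \<union> U" and s: "s \<in> C \<union> U" for r s
    proof (cases "s \<in> U")
      case True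
      then show ?thesis by (rule noU)
    next
      case False
      then have sC: "s \<in> C" using s by blast
      show ?thesis
      proof (cases "r \<in> U")
        case True
        then have "star r \<in> U" using U(2) by blast
        then have "col \<xi>0 (star r) (\<lambda>p. x p (star r)) s = 0"
          using mid[OF U(3), of "star r" "\<lambda>p. x p (star r)"] 2 sC by blast
        then show ?thesis by (simp add: D_def)
      next
        case False
        then have "star r \<in> C" using r CU(2) by blast
        then have "\<xi>0 p s * x p (star r) = 0" for p
          using symm_supp[OF \<xi>0, of p s] 1 by (auto simp: C_def)
        then have "(\<Sum>p\<in>UNIV. kap p (star r) s * \<xi>0 p s * x p (star r)) = 0"
          by (intro sum.neutral) (simp add: mult.assoc)
        then show ?thesis by (simp add: D_def col_def)
      qed
    qed
    then show "x \<in> kern (F \<union> E \<union> U) \<xi>0" using x by (simp add: kern_def eqn_def C_def)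
  qed
qed

lemma symm_unit_symm: "a \<in> B \<Longrightarrow> b \<in> B \<Longrightarrow> symm_unit a b \<in> symm B"
proof (rule symmI)
  show "symm_unit a b p q = symm_unit a b q p" for p q by (simp add: symm_unit_def conj_commute add.commute)
  show "p \<in> B" if "symm_unit a b p q \<noteq> 0" "a \<in> B" "b \<in> B" for p q
    using that by (cases "p = a"; cases "p = b") (simp_all add: symm_unit_def)
qed

text \<open>The form \<open>\<xi>0\<close> of \<open>block_form\<close> has too large a stabiliser, spanned up to \<open>Z \<union> Z'\<close> by the products
  of \<open>f, e, u, star u\<close> with \<open>u, star u\<close>. A small multiple of a form \<open>\<eta>\<close> supported on such
  products reduces it to the admissible size.\<close>

lemma half_rigid_block:
  assumes F: "row_form F \<xi> Z f" "star ` F \<subseteq> F" and E: "row_form E \<xi>' Z' e" "star ` E \<subseteq> E"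
    and d: "F \<inter> E = {}" and l: "lv ` E \<subseteq> lv ` F"
    and u: "lv u = 0" "u \<notin> F \<union> E"
  shows "half_rigid (F \<union> E \<union> {u, star u})"
proof -
  define U where "U = {u, star u}"
  define B where "B = F \<union> E \<union> U"
  have su: "star u \<notin> F \<union> E" using u(2) F(2) E(2) by (metis Un_iff image_subset_iff star_star)
  have U: "U \<inter> (F \<union> E) = {}" "star ` U \<subseteq> U" "\<And>z. z \<in> U \<Longrightarrow> lv z = 0" "u \<in> U" "star u \<in> U"
    using u su by (auto simp: U_def)
  have uu: "u \<noteq> star u" "star u \<noteq> u" using star_neq[of u] by auto
  obtain \<xi>0 where \<xi>0: "\<xi>0 \<in> symm (F \<union> E)" and k: "\<forall>x.
    (x \<in> kern B \<xi>0 \<and> (\<forall>(p, q)\<in>Z \<union> Z'. x p q = 0) \<longrightarrow> confined U F f E e x) \<and>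
    (x \<in> symm B \<and> confined U F f E e x \<longrightarrow> x \<in> kern B \<xi>0)"
    unfolding B_def by (rule bexE[OF block_form[OF F E d l U(1-3)]])
  have k1: "(\<forall>p\<in>F \<union> E. \<forall>q\<in>F \<union> E. x p q = 0)
      \<and> (\<forall>z\<in>U. (\<forall>p\<in>F. p \<noteq> f \<longrightarrow> x p z = 0) \<and> (\<forall>p\<in>E. p \<noteq> e \<longrightarrow> x p z = 0))"
    if "x \<in> kern B \<xi>0" "\<forall>(p, q)\<in>Z \<union> Z'. x p q = 0" for x
    using conjunct1[OF spec[OF k, of x]] that unfolding confined_def by blast
  have \<xi>0B: "\<xi>0 \<in> symm B" by (rule symm_mono[OF _ \<xi>0]) (auto simp: B_def)
  have fF: "F \<noteq> {} \<Longrightarrow> f \<in> F \<and> lv f < 0" and eE: "E \<noteq> {} \<Longrightarrow> e \<in> E \<and> lv e < 0"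
    using F(1) E(1) by (auto simp: row_form_def)
  have cZ: "finite Z" "2 * card Z \<le> card F" "finite Z'" "2 * card Z' \<le> card E"
    using F(1) E(1) by (auto simp: row_form_def)
  have symm_unit_kern: "symm_unit a z \<in> kern B \<xi>0"
    if a: "a \<in> U \<or> a = f \<and> a \<in> F \<or> a = e \<and> a \<in> E" and z: "z \<in> U" for a z
  proof -
    have sy: "symm_unit a z \<in> symm B" using a z by (intro symm_unit_symm) (auto simp: B_def)
    have z': "p \<noteq> z" if "p \<in> F \<union> E" for p using that z U(1) by blast
    have 0: "symm_unit a z p q = 0" if "q \<noteq> z" "p \<noteq> z" for p q using that by (simp add: symm_unit_def)
    have 1: "symm_unit a z p q = 0" if "p \<noteq> a" "p \<noteq> z" for p q using that by (simp add: symm_unit_def)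
    have aF: "p \<noteq> a" if "p \<in> F" "p \<noteq> f" for p using that a U(1) d by blast
    have aE: "p \<noteq> a" if "p \<in> E" "p \<noteq> e" for p using that a U(1) d by blast
    have "confined U F f E e (symm_unit a z)"
      unfolding confined_def using 0 1 z' aF aE by simp
    then show ?thesis using k sy by blast
  qed
  have sU: "symm_unit z z' \<in> kern B \<xi>0" if "z \<in> U" "z' \<in> U" for z z'
    using symm_unit_kern that by blast
  have sf: "symm_unit f z \<in> kern B \<xi>0" if "F \<noteq> {}" "z \<in> U" for z
    using symm_unit_kern fF that by blast
  have se: "symm_unit e z \<in> kern B \<xi>0" if "E \<noteq> {}" "z \<in> U" for z
    using symm_unit_kern eE that by blast
  have kap1: "kap a z z' = 1" "kap z z' a = 1" if "lv a < 0" "lv z = 0" "lv z' = 0" for a z z'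
    using that by (simp_all add: kap_def lev_def)
  have kap0: "kap z z' z'' = 1" if "lv z = 0" "lv z' = 0" "lv z'' = 0" for z z' z''
    using that by (simp add: kap_def lev_def)
  have fin: "x = (\<lambda>_ _. 0)"
    if x: "x \<in> kern B \<xi>0" "\<forall>(p, q)\<in>Z \<union> Z'. x p q = 0"
      and z: "x u u = 0" "x u (star u) = 0" "x (star u) (star u) = 0"
      and fz: "F \<noteq> {} \<Longrightarrow> x f u = 0 \<and> x f (star u) = 0"
      and ez: "E \<noteq> {} \<Longrightarrow> x e u = 0 \<and> x e (star u) = 0" for x
  proof -
    have xs: "x \<in> symm B" using x(1) by (simp add: kern_def)
    note k = k1[OF x]
    have UU: "x p q = 0" if "p \<in> U" "q \<in> U" for p q
      using that z symmD[OF xs, of u "star u"] by (auto simp: U_def)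
    have CU: "x p q = 0" if "p \<in> F \<union> E" "q \<in> U" for p q
    proof (cases "p = f \<and> p \<in> F \<or> p = e \<and> p \<in> E")
      case True
      then show ?thesis using fz ez that(2) by (auto simp: U_def)
    next
      case False
      then show ?thesis using k that by blast
    qed
    have "x p q = 0" for p q
    proof (cases "p \<in> B \<and> q \<in> B")
      case True
      then consider "p \<in> F \<union> E" "q \<in> F \<union> E" | "p \<in> F \<union> E" "q \<in> U" | "p \<in> U" "q \<in> F \<union> E" | "p \<in> U" "q \<in> U"
        unfolding B_def by blast
      then show ?thesis using k CU UU symmD[OF xs, of p q] by cases auto
    next
      case False
      then show ?thesis using symm_supp[OF xs, of p q] by blast
    qed
    then show ?thesis by (simp add: fun_eq_iff)
  qed
  have conclude: "half_rigid B"
    if \<eta>: "\<eta> \<in> symm B"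
      and main: "\<And>x. \<lbrakk>x \<in> kern B \<xi>0; \<And>r s. symm_unit r s \<in> kern B \<xi>0 \<Longrightarrow> eqn \<eta> x r s = 0;
        \<forall>(p, q)\<in>Z \<union> Z'. x p q = 0; x a b = 0\<rbrakk> \<Longrightarrow> x = (\<lambda>_ _. 0)" for \<eta> a b
  proof -
    \<comment> \<open>The pair \<open>u, star u\<close> raises \<open>card B\<close> by 2 and thus
      allows for one more entry.\<close>
    define Z0 where "Z0 = insert (a, b) (Z \<union> Z')"
    have "finite {t. \<not> rigid B (comb t \<xi>0 \<eta>) Z0}"
      by (rule rigid_generic[OF \<xi>0B \<eta>], rule main) (auto simp: Z0_def)
    then obtain t where "t \<notin> {t. \<not> rigid B (comb t \<xi>0 \<eta>) Z0}"
      by (rule avoid_finite_sets[OF _ finite.emptyI])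
    then have "rigid B (comb t \<xi>0 \<eta>) Z0" by blast
    moreover have "comb t \<xi>0 \<eta> \<in> symm B" by (rule symm_comb[OF \<xi>0B \<eta>])
    moreover have "2 * card Z0 \<le> card B"
    proof -
      have "card Z0 \<le> card Z + card Z' + 1"
        unfolding Z0_def using card_Un_le[of Z Z'] cZ by (simp add: card_insert_if)
      moreover have "card B = card F + card E + 2"
        using U(1) d uu by (simp add: B_def card_Un_disjoint Int_commute U_def)
      ultimately show ?thesis using cZ by simp
    qed
    moreover have "finite Z0" using cZ by (simp add: Z0_def)
    ultimately show ?thesis unfolding half_rigid_def by blast
  qed
  have "half_rigid B"
  proof (cases "F = {}")
    case Fe: True
    then have Ee: "E = {}" using l by simp
    show ?thesis
    proof (rule conclude)
      \<comment> \<open>Without rows only the three products of \<open>u\<close> and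
        \<open>star u\<close> are left, an algebra of type \<open>sl_2\<close>; the form is
        semisimple there and is stabilised by the product of \<open>u\<close> and
        \<open>star u\<close>.\<close>
      show "symm_unit u (star u) \<in> symm B" using U by (intro symm_unit_symm) (auto simp: B_def)
      fix x assume x: "x \<in> kern B \<xi>0" "\<And>r s. symm_unit r s \<in> kern B \<xi>0 \<Longrightarrow> eqn (symm_unit u (star u)) x r s = 0"
        "\<forall>(p, q)\<in>Z \<union> Z'. x p q = 0" "x u (star u) = 0"
      have e1: "symm_unit u (star u) p u = of_bool (p = star u)" "symm_unit u (star u) p (star u) = of_bool (p = u)" for p
        using uu by (auto simp: symm_unit_def)
      have "x (star u) (star u) = 0"
        using x(2)[OF sU[OF U(4,4)]] by (simp add: eqn_def D_single[where \<eta> = "symm_unit u (star u)" and s = "u" and ?p0.0 = "star u", OF e1(1)] kap0 u)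
      moreover have "x u u = 0"
        using x(2)[OF sU[OF U(5,5)]] by (simp add: eqn_def D_single[where \<eta> = "symm_unit u (star u)" and s = "star u" and ?p0.0 = "u", OF e1(2)] kap0 u)
      ultimately show "x = (\<lambda>_ _. 0)" using fin[OF x(1,3)] x(4) Fe Ee by blast
    qed
  next
    case Fn: False
    then have f: "f \<in> F" "lv f < 0" "f \<noteq> u" "f \<noteq> star u" using fF u su by auto
    show ?thesis
    proof (cases "E = {}")
      case Ee: True
      show ?thesis
      proof (rule conclude)
        \<comment> \<open>With one row there are five products left. The form kills all of them but
          the square of \<open>star u\<close>.\<close>
        show "symm_unit f u \<in> symm B" using U f by (intro symm_unit_symm) (auto simp: B_def)
        fix x assume x: "x \<in> kern B \<xi>0" "\<And>r s. symm_unit r s \<in> kern B \<xi>0 \<Longrightarrow> eqn (symm_unit f u) x r s = 0"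
          "\<forall>(p, q)\<in>Z \<union> Z'. x p q = 0" "x (star u) (star u) = 0"
        have e1: "symm_unit f u p u = of_bool (p = f)" "symm_unit f u p f = of_bool (p = u)" "symm_unit f u p (star u) = 0" for p
          using uu f by (auto simp: symm_unit_def)
        have ff: "x f (star f) = 0" using k1[OF x(1,3)] f F(2) by blast
        have "x f (star u) = 0"
          using x(2)[OF sU[OF U(4,4)]] by (simp add: eqn_def D_single[where \<eta> = "symm_unit f u" and s = "u" and ?p0.0 = "f", OF e1(1)] kap1 u f)
        moreover have "x f u = 0"
          using x(2)[OF sU[OF U(4,5)]] by (simp add: eqn_def D_single[where \<eta> = "symm_unit f u" and s = "u" and ?p0.0 = "f", OF e1(1)] D_none[where \<eta> = "symm_unit f u" and s = "star u", OF e1(3)] kap1 u f)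
        moreover have "x u (star u) = 0"
          using x(2)[OF sf[OF Fn U(4)]] by (simp add: eqn_def D_single[where \<eta> = "symm_unit f u" and s = "u" and ?p0.0 = "f", OF e1(1)] D_single[where \<eta> = "symm_unit f u" and s = "f" and ?p0.0 = "u", OF e1(2)] kap1 u f ff)
        moreover have "x u u = 0"
          using x(2)[OF sf[OF Fn U(5)]] by (simp add: eqn_def D_none[where \<eta> = "symm_unit f u" and s = "star u", OF e1(3)] D_single[where \<eta> = "symm_unit f u" and s = "f" and ?p0.0 = "u", OF e1(2)] kap1 u f)
        ultimately show "x = (\<lambda>_ _. 0)" using fin[OF x(1,3)] x(4) Ee by blast
      qed
    next
      case En: False
      then have e: "e \<in> E" "lv e < 0" "e \<noteq> u" "e \<noteq> star u" "e \<noteq> f" using eE u su d f(1) by auto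
      \<comment> \<open>With two rows there are seven products left. Five are killed outright, and
        the equation at \<open>(u, star u)\<close> ties the entry at \<open>(e, star u)\<close> to
        the one at \<open>(f, u)\<close>.\<close>
      define \<eta> where "\<eta> = comb 1 (symm_unit f u) (symm_unit e (star u))"
      show ?thesis
      proof (rule conclude)
        show "\<eta> \<in> symm B" unfolding \<eta>_def using U f e by (intro symm_unit_symm symm_comb) (auto simp: B_def)
        fix x assume x: "x \<in> kern B \<xi>0" "\<And>r s. symm_unit r s \<in> kern B \<xi>0 \<Longrightarrow> eqn \<eta> x r s = 0"
          "\<forall>(p, q)\<in>Z \<union> Z'. x p q = 0" "x f u = 0"
        have e1: "\<eta> p u = of_bool (p = f)" "\<eta> p f = of_bool (p = u)" "\<eta> p (star u) = of_bool (p = e)"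
          "\<eta> p e = of_bool (p = star u)" for p
          using uu f e by (auto simp: \<eta>_def comb_def symm_unit_def)
        note Ds = D_single[where \<eta> = "\<eta>" and s = "u" and ?p0.0 = "f", OF e1(1)] D_single[where \<eta> = "\<eta>" and s = "f" and ?p0.0 = "u", OF e1(2)] D_single[where \<eta> = "\<eta>" and s = "star u" and ?p0.0 = "e", OF e1(3)] D_single[where \<eta> = "\<eta>" and s = "e" and ?p0.0 = "star u", OF e1(4)]
        have ff: "x f (star f) = 0" "x e (star f) = 0" "x f (star e) = 0" "x e (star e) = 0"
          using k1[OF x(1,3)] f e F(2) E(2) by blast+
        have "x f (star u) = 0"
          using x(2)[OF sU[OF U(4,4)]] by (simp add: eqn_def Ds kap1 u f)
        moreover have "x e u = 0"
          using x(2)[OF sU[OF U(5,5)]] by (simp add: eqn_def Ds kap1 u e)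
        moreover have "x e (star u) = 0"
          using x(2)[OF sU[OF U(4,5)]] x(4) by (simp add: eqn_def Ds kap1 u f e)
        moreover have "x u (star u) = 0"
          using x(2)[OF sf[OF Fn U(4)]] by (simp add: eqn_def Ds kap1 u f ff)
        moreover have "x u u = 0"
          using x(2)[OF sf[OF Fn U(5)]] by (simp add: eqn_def Ds kap1 u f ff)
        moreover have "x (star u) (star u) = 0"
          using x(2)[OF se[OF En U(4)]] by (simp add: eqn_def Ds kap1 u e ff)
        ultimately show "x = (\<lambda>_ _. 0)" using fin[OF x(1,3)] x(4) by blast
      qed
    qed
  qed
  then show ?thesis by (simp add: B_def U_def)
qed

text \<open>Induction by peeling off a block that is separated from the rest: a row through all
  levels if level 0 is absent, and otherwise a pair of level 0 with two possibly empty rows.\<close>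

lemma half_rigid_star_closed:
  assumes "star ` B \<subseteq> B" shows "half_rigid B"
  using assms
proof (induction "card B" arbitrary: B rule: less_induct)
  case less
  obtain F where F: "F \<subseteq> B" "star ` F \<subseteq> F" "inj_on lv F" "lv ` F = lv ` B - {0}"
    by (rule row_select[OF less.prems])
  have dc: "star ` (B - X) \<subseteq> B - X" if "star ` X \<subseteq> X" "star ` B \<subseteq> B" for X B
  proof (rule image_subsetI)
    fix p assume p: "p \<in> B - X"
    have "star p \<notin> X"
    proof
      assume "star p \<in> X"
      then have "star (star p) \<in> X" using that(1) by blast
      then show False using p by simp
    qed
    then show "star p \<in> B - X" using p that(2) by blast
  qed
  obtain \<xi> Z f where r: "row_form F \<xi> Z f" using row_form_exists[OF F(2,3)] .
  have N: "\<And>q. lv q \<in> lv ` F \<Longrightarrow> nondeg F \<xi> q" and \<xi>: "\<xi> \<in> symm F" using r by (auto simp: row_form_def)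
  show ?case
  proof (cases "0 \<in> lv ` B")
    case False
    show ?thesis
    proof (cases "B = {}")
      case True
      then show ?thesis using half_rigid_row_form[OF r] F(1) by simp
    next
      case Bn: False
      then have "F \<noteq> {}" using F(4) False by auto
      then have "card (B - F) < card B" using F(1) by (intro psubset_card_mono) auto
      then have g: "half_rigid (B - F)" using dc[OF F(2) less.prems] by (rule less.hyps)
      have "half_rigid (F \<union> (B - F))"
        by (rule half_rigid_union[OF _ F(2) dc[OF F(2) less.prems] half_rigid_row_form[OF r] \<xi> _ g])
          (use N F(4) False in auto)
      moreover have "F \<union> (B - F) = B" using F(1) by blast
      ultimately show ?thesis by simp
    qed
  next
    case True
    then obtain u where u: "u \<in> B" "lv u = 0" by auto
    have cF: "star ` (B - F) \<subseteq> B - F" by (rule dc[OF F(2) less.prems])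
    \<comment> \<open>The second row is taken from what the first one leaves, so its levels occur in
      the first row as well.\<close>
    obtain E where E: "E \<subseteq> B - F" "star ` E \<subseteq> E" "inj_on lv E" "lv ` E = lv ` (B - F) - {0}"
      by (rule row_select[OF cF])
    obtain \<xi>' Z' e where r': "row_form E \<xi>' Z' e" using row_form_exists[OF E(2,3)] .
    have EF: "F \<inter> E = {}" "lv ` E \<subseteq> lv ` F" using E(1,4) F(4) by auto
    have un: "u \<notin> F \<union> E" using u(2) F(4) E(4) by (metis DiffD2 Un_iff image_eqI insertI1)
    define B1 where "B1 = F \<union> E \<union> {u, star u}"
    have g1: "half_rigid B1" unfolding B1_def by (rule half_rigid_block[OF r F(2) r' E(2) EF u(2) un])
    have B1: "B1 \<subseteq> B" "star ` B1 \<subseteq> B1"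
      using F(1,2) E(1,2) u(1) less.prems by (auto simp: B1_def)
    have "card (B - B1) < card B" using u(1) by (intro psubset_card_mono) (auto simp: B1_def)
    then have g2: "half_rigid (B - B1)" using dc[OF B1(2) less.prems] by (rule less.hyps)
    \<comment> \<open>\<open>B1\<close> is the union of \<open>W\<close> and its dual, so the cyclic form on \<open>W\<close> separates \<open>B1\<close> from all remaining levels.\<close>
    define W where "W = {p \<in> F. lv p < 0} \<union> {u} \<union> {p \<in> E. 0 < lv p}"
    have "inj_on lv W"
    proof (rule inj_onI)
      fix p q assume "p \<in> W" "q \<in> W" "lv p = lv q"
      then show "p = q" using F(3) E(3) u(2) by (auto simp: W_def inj_on_def)
    qed
    then obtain w where w: "chain w (int (card W))" "range w = W"
      using chain_exists[of W] by (auto simp: W_def)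
    have W1: "W \<union> star ` W = B1"
    proof
      show "W \<union> star ` W \<subseteq> B1" using F(2) E(2) by (auto simp: W_def B1_def)
      show "B1 \<subseteq> W \<union> star ` W"
      proof
        fix p assume p: "p \<in> B1"
        have "p \<in> W \<or> star p \<in> W"
        proof -
          have "lv q \<noteq> 0" if "q \<in> F \<union> E" for q using that F(4) E(4) by blast
          then show ?thesis using p F(2) E(2) unfolding B1_def W_def
            by (cases "lv p < 0") fastforce+
        qed
        then show "p \<in> W \<union> star ` W" by (metis UnCI image_eqI star_star)
      qed
    qed
    have W2: "W \<inter> star ` W = {}"
    proof (rule ccontr)
      assume "\<not> ?thesis"
      then obtain p where p: "p \<in> W" "star p \<in> W" by blast
      have nz: "lv q \<noteq> 0" if "q \<in> F \<union> E" for q using that F(4) E(4) by blast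
      show False using p nz[of p] nz[of "star p"] u(2) EF(1) F(2) E(2) star_neq[of u] un unfolding W_def by fastforce
    qed
    \<comment> \<open>A nonzero level outside \<open>B1\<close> occurs in \<open>E\<close> and then,
      with both signs, in \<open>E\<close> and in \<open>F\<close>. The positive sign is found in
      the half of \<open>E\<close>, the negative one in the half of \<open>F\<close>.\<close>
    have W3: "b \<in> lv ` W \<and> - b \<in> lv ` W" if "b \<in> lv ` (B - B1)" for b
    proof (cases "b = 0")
      case True
      then show ?thesis using u(2) by (force simp: W_def)
    next
      case False
      have bE: "b \<in> lv ` E" using that False E(4) by (auto simp: B1_def)
      have sy: "- c \<in> lv ` X" if "c \<in> lv ` X" "star ` X \<subseteq> X" for c X
        using that by (metis imageE image_eqI image_subset_iff lv_star)
      have "b \<in> lv ` E" "- b \<in> lv ` E" "b \<in> lv ` F" "- b \<in> lv ` F"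
        using bE sy[OF bE E(2)] EF(2) by auto
      moreover have "c \<in> lv ` W" if "c \<in> lv ` E" "0 < c" for c using that by (auto simp: W_def)
      moreover have "c \<in> lv ` W" if "c \<in> lv ` F" "c < 0" for c using that by (auto simp: W_def)
      ultimately show ?thesis using False by (cases "0 < b") simp_all
    qed
    have "half_rigid (B1 \<union> (B - B1))"
    proof (rule half_rigid_union[OF _ B1(2) dc[OF B1(2) less.prems] g1 _ _ g2])
      show "chform w \<in> symm B1" using chform_symm[of w] w(2) W1 by simp
      show "\<forall>q\<in>B - B1. nondeg B1 (chform w) q"
        using disjoint_nondeg[OF w(1)] w(2) W1 W2 W3 by auto
    qed auto
    moreover have "B1 \<union> (B - B1) = B" using B1(1) by blast
    ultimately show ?thesis by simp
  qed
qed

end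

section \<open>Automorphisms of the symplectic Lie algebra\<close>

lemma mv_scale: "(A :: 'k::comm_ring_1 ^ 'n ^ 'm) *v (c *s x) = c *s (A *v x)"
  by (simp add: vec_eq_iff matrix_vector_mult_def sum_distrib_left mult_ac)

lemma mat_scale_mv: "mat_scale c (A :: 'k::comm_ring_1 ^ 'n ^ 'm) *v x = c *s (A *v x)"
  by (simp add: vec_eq_iff matrix_vector_mult_def mat_scale_def sum_distrib_left mult_ac)

lemma mv_sum: "(A :: 'k::comm_ring_1 ^ 'n ^ 'm) *v (\<Sum>i\<in>I. f i) = (\<Sum>i\<in>I. A *v f i)"
  by (induction I rule: infinite_finite_induct) (simp_all add: matrix_vector_right_distrib)

lemma commutator_mv:
  "commutator X Y *v (y :: 'k::comm_ring_1 ^ 'n) = X *v (Y *v y) - Y *v (X *v y)"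
  by (simp add: commutator_def matrix_vector_mult_diff_rdistrib matrix_vector_mul_assoc)

fun swap_index :: "'n + 'n \<Rightarrow> 'n + 'n" where
  "swap_index (Inl a) = Inr a" | "swap_index (Inr a) = Inl a"

fun index_sign :: "'n + 'n \<Rightarrow> 'k::comm_ring_1" where
  "index_sign (Inl a) = 1" | "index_sign (Inr a) = - 1"

lemma swap_swap [simp]: "swap_index (swap_index p) = p" by (cases p) auto

lemma swap_neq: "swap_index p \<noteq> p" by (cases p) auto

lemma swap_eq_iff: "swap_index p = q \<longleftrightarrow> p = swap_index q" by (metis swap_swap)

lemma bij_swap: "bij_betw swap_index UNIV UNIV" by (metis bijI' swap_swap)

lemma sign_swap [simp]: "index_sign (swap_index p) = - index_sign p" by (cases p) auto

lemma sign_sq [simp]: "index_sign p * index_sign p = 1" by (cases p) auto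

lemma sign_nz [simp]: "index_sign p \<noteq> (0 :: 'k::field)" by (cases p) auto

lemma symplectic_form_entry:
  "(symplectic_form :: 'k::comm_ring_1 ^ ('n::finite + 'n) ^ ('n + 'n)) $ p $ q
    = (if q = swap_index p then index_sign p else 0)"
  by (cases p; cases q) (auto simp: symplectic_form_def)

section \<open>The symplectic form and the products of two vectors\<close>

definition om :: "'k::comm_ring_1 ^ ('n::finite + 'n) \<Rightarrow> 'k ^ ('n + 'n) \<Rightarrow> 'k" where
  "om v w = (\<Sum>p\<in>UNIV. index_sign p * v $ p * w $ swap_index p)"

lemma om_add_left: "om (v + v') w = om v w + om v' w"
  and om_add_right: "om v (w + w') = om v w + om v w'"
  and om_scale_left [simp]: "om (c *s v) w = c * om v w"
  and om_scale_right [simp]: "om v (c *s w) = c * om v w"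
  and om_diff_left: "om (v - v') w = om v w - om v' w"
  and om_diff_right: "om v (w - w') = om v w - om v w'"
  and om_minus_left [simp]: "om (- v) w = - om v w"
  and om_minus_right [simp]: "om v (- w) = - om v w"
  and om_zero_left [simp]: "om 0 w = 0"
  and om_zero_right [simp]: "om v 0 = 0"
  by (simp_all add: om_def algebra_simps sum.distrib sum_distrib_left sum_subtractf sum_negf)

lemma om_sum_left: "om (\<Sum>i\<in>I. f i) w = (\<Sum>i\<in>I. om (f i) w)"
  by (induction I rule: infinite_finite_induct) (simp_all add: om_add_left)

lemma om_sum_right: "om w (\<Sum>i\<in>I. f i) = (\<Sum>i\<in>I. om w (f i))"
  by (induction I rule: infinite_finite_induct) (simp_all add: om_add_right)

lemma om_skew: "om v w = - om w v"
proof -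
  have "om w v = (\<Sum>p\<in>UNIV. index_sign (swap_index p) * w $ swap_index p * v $ p)"
    unfolding om_def by (subst sum.reindex_bij_betw[OF bij_swap, symmetric]) simp
  then show ?thesis by (simp add: om_def sum_negf mult_ac)
qed

lemma om_self [simp]: "om v v = (0 :: 'k::field_char_0)"
proof -
  have "om v v + om v v = 0" using om_skew[of v v] by simp
  then have "2 * om v v = 0" by (simp only: mult_2)
  then show ?thesis by simp
qed

lemma om_axis: "om v (axis p 1) = - index_sign p * v $ swap_index p"
proof -
  have "om v (axis p 1) = (\<Sum>r\<in>UNIV. if r = swap_index p then - index_sign p * v $ swap_index p else 0)"
    unfolding om_def by (rule sum.cong) (auto simp: axis_def swap_eq_iff)
  then show ?thesis by simp
qed

lemma om_nondeg:
  fixes v :: "'k::field_char_0 ^ ('n::finite + 'n)"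
  assumes "\<And>w. om v w = 0" shows "v = 0"
proof -
  have "v $ swap_index p = 0" for p using assms[of "axis p 1"] by (simp add: om_axis)
  then have "v $ p = 0" for p by (metis swap_swap)
  then show ?thesis by (simp add: vec_eq_iff)
qed

lemma om_dual:
  fixes v :: "'k::field_char_0 ^ ('n::finite + 'n)"
  assumes "v \<noteq> 0" obtains w where "om v w = 1"
proof -
  obtain w where "om v w \<noteq> 0" using om_nondeg assms by blast
  then have "om v (inverse (om v w) *s w) = 1" by simp
  then show ?thesis by (rule that)
qed

lemma om_eq_sum: "om v w = (\<Sum>p\<in>UNIV. v $ p * ((symplectic_form :: 'k::comm_ring_1 ^ ('n::finite + 'n) ^ ('n + 'n)) *v w) $ p)"
proof -
  have "((symplectic_form :: 'k ^ ('n + 'n) ^ ('n + 'n)) *v w) $ p = index_sign p * w $ swap_index p" for p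
    by (simp add: matrix_vector_mult_def symplectic_form_entry if_distrib[of "\<lambda>x. x * _"] cong: if_cong)
  then show ?thesis by (simp add: om_def mult_ac)
qed

lemma sum_mv_transpose:
  "(\<Sum>p\<in>UNIV. ((X :: 'k::comm_ring_1 ^ 'n ^ 'm) *v v) $ p * u $ p) = (\<Sum>p\<in>UNIV. v $ p * (transpose X *v u) $ p)"
proof -
  have "(\<Sum>p\<in>UNIV. (X *v v) $ p * u $ p) = (\<Sum>p\<in>UNIV. \<Sum>q\<in>UNIV. X $ p $ q * v $ q * u $ p)"
    by (simp add: matrix_vector_mult_def sum_distrib_right)
  also have "\<dots> = (\<Sum>q\<in>UNIV. \<Sum>p\<in>UNIV. X $ p $ q * v $ q * u $ p)" by (rule sum.swap)
  finally show ?thesis by (simp add: matrix_vector_mult_def transpose_def sum_distrib_left mult_ac)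
qed

lemma bilinear_matrix_eq:
  assumes "\<And>v w. (\<Sum>p\<in>UNIV. v $ p * ((A :: 'k::comm_ring_1 ^ 'n ^ 'm) *v w) $ p) = (\<Sum>p\<in>UNIV. v $ p * (B *v w) $ p)"
  shows "A = B"
proof -
  have "(A *v w) $ p = (B *v w) $ p" for w p
  proof -
    have "(\<Sum>r\<in>UNIV. axis p 1 $ r * (C *v w) $ r) = (C *v w) $ p" for C :: "'k ^ 'n ^ 'm"
      by (simp add: axis_def if_distrib[of "\<lambda>x. x * _"] cong: if_cong)
    then show ?thesis using assms[of "axis p 1" w] by simp
  qed
  then show ?thesis by (simp add: matrix_eq vec_eq_iff)
qed

lemma sp_iff_om:
  "X \<in> (sp_algebra :: ('k::comm_ring_1 ^ ('n::finite + 'n) ^ ('n + 'n)) set)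
    \<longleftrightarrow> (\<forall>v w. om (X *v v) w = - om v (X *v w))"
proof -
  let ?J = "symplectic_form :: 'k ^ ('n + 'n) ^ ('n + 'n)"
  have 1: "om (X *v v) w = (\<Sum>p\<in>UNIV. v $ p * ((transpose X ** ?J) *v w) $ p)" for v w
    by (simp only: om_eq_sum sum_mv_transpose matrix_vector_mul_assoc)
  have 2: "- om v (X *v w) = (\<Sum>p\<in>UNIV. v $ p * ((- (?J ** X)) *v w) $ p)" for v w
    by (simp add: om_eq_sum matrix_vector_mul_assoc sum_negf[symmetric])
      (simp add: matrix_vector_mult_def sum_negf)
  show ?thesis unfolding sp_algebra_iff 1 2
  proof
    assume "\<forall>v w. (\<Sum>p\<in>UNIV. v $ p * ((transpose X ** ?J) *v w) $ p) = (\<Sum>p\<in>UNIV. v $ p * ((- (?J ** X)) *v w) $ p)"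
    then show "transpose X ** ?J = - (?J ** X)" by (intro bilinear_matrix_eq) blast
  qed simp
qed

lemma spD: "X \<in> sp_algebra \<Longrightarrow> om (X *v v) w = - om v (X *v w)" by (simp add: sp_iff_om)

text \<open>\<open>qm v w\<close> is the element of the Lie algebra corresponding to the product \<open>v w \<in> S\<^sup>2V\<close>.\<close>

definition qm :: "'k::comm_ring_1 ^ ('n::finite + 'n) \<Rightarrow> 'k ^ ('n + 'n) \<Rightarrow> 'k ^ ('n + 'n) ^ ('n + 'n)" where
  "qm v w = (\<chi> i j. om v (axis j 1) * w $ i + om w (axis j 1) * v $ i)"

lemma om_expand: "om v y = (\<Sum>j\<in>UNIV. om v (axis j 1) * y $ j)"
proof -
  have "om v y = (\<Sum>p\<in>UNIV. index_sign (swap_index p) * v $ swap_index p * y $ p)"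
    unfolding om_def by (subst sum.reindex_bij_betw[OF bij_swap, symmetric]) simp
  then show ?thesis by (simp add: om_axis)
qed

lemma qm_mv: "qm v w *v y = om v y *s w + om w y *s v"
proof -
  have "(qm v w *v y) $ i = (om v y *s w + om w y *s v) $ i" for i
    unfolding om_expand[of v y] om_expand[of w y]
    by (simp add: qm_def matrix_vector_mult_def sum_distrib_right sum_distrib_left sum.distrib algebra_simps)
  then show ?thesis by (simp add: vec_eq_iff)
qed

lemma qm_sp: "qm v w \<in> (sp_algebra :: ('k::field_char_0 ^ ('n::finite + 'n) ^ ('n + 'n)) set)"
proof -
  have "om v a * om w b + om w a * om v b = - (om v b * om a w + om w b * om a v)" for a b
    using om_skew[of a w] om_skew[of a v] by simp
  then show ?thesis by (simp add: sp_iff_om qm_mv om_add_left om_add_right)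
qed

lemma qm_sym: "qm v w = qm w v" by (simp add: matrix_eq qm_mv add.commute)

lemma qm_add: "qm v (w + w') = qm v w + qm v w'"
  and qm_scale: "qm v (c *s w) = mat_scale c (qm v w)"
  and qm_diff: "qm v (w - w') = qm v w - qm v w'"
  by (simp_all add: matrix_eq qm_mv om_add_left om_diff_left matrix_vector_mult_add_rdistrib
      matrix_vector_mult_diff_rdistrib mat_scale_mv vec_eq_iff algebra_simps)

text \<open>Evaluation at some \<open>y\<close> with \<open>om v y = 1\<close> makes the difference
  \<open>u\<close> a multiple of \<open>v\<close>; pairing with \<open>y\<close> shows that the
  factor is its own negative.\<close>

lemma qm_inj:
  fixes v :: "'k::field_char_0 ^ ('n::finite + 'n)"
  assumes "v \<noteq> 0" "qm v w = qm v w'" shows "w = w'"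
proof -
  define u where "u = w - w'"
  have 0: "om v y *s u + om u y *s v = 0" for y
    using arg_cong[OF assms(2), of "\<lambda>X. X *v y"]
    by (simp add: u_def qm_mv om_diff_left vec_eq_iff algebra_simps)
  obtain y where y: "om v y = 1" using om_dual assms(1) by blast
  have u: "u = (- om u y) *s v" using 0[of y] y by (simp add: eq_neg_iff_add_eq_0)
  have "om u y = - om u y * om v y" by (subst u) simp
  then have "2 * om u y = 0" using y by simp
  then show ?thesis using u by (simp add: u_def)
qed

lemma commutator_qm:
  assumes "X \<in> sp_algebra"
  shows "commutator X (qm v w) = qm (X *v v) w + qm v (X *v w)"
  by (simp add: matrix_eq commutator_mv qm_mv matrix_vector_right_distrib mv_scale spD[OF assms]
      matrix_vector_mult_add_rdistrib) (simp add: vec_eq_iff)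

lemma sp_transitive:
  fixes v z :: "'k::field_char_0 ^ ('n::finite + 'n)"
  assumes "om v z = 1" obtains u where "qm z u *v v = w"
proof -
  \<comment> \<open>With \<open>om z v = - 1\<close>, the product of \<open>z\<close> and
    \<open>- w + l z\<close> sends \<open>v\<close> to \<open>w - l z + (- om w v - l) z\<close>;
    the two multiples of \<open>z\<close> cancel for this \<open>l\<close>.\<close>
  define l where "l = - om w v / 2"
  have "om z v = - 1" using om_skew[of z v] assms by simp
  moreover have "- (om w v) - l = l" by (simp add: l_def)
  ultimately have "om (- w + l *s z) v = l" "om z v = - 1" by (simp_all add: om_add_left om_diff_left)
  then have "qm z (- w + l *s z) *v v = w"
    by (simp only: qm_mv) (simp add: vec_eq_iff algebra_simps)
  then show ?thesis by (rule that)
qed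

text \<open>The condition is used for \<open>Y = w\<^sup>2\<close> with
  \<open>om (X w) w \<noteq> 0\<close>. It says that
  \<open>2 w (X\<^sup>2 w) + 2 (X w)\<^sup>2\<close> is a multiple of \<open>X\<close> in
  \<open>S\<^sup>2V\<close>. Once \<open>X\<^sup>2 w = 0\<close> is known, \<open>X\<close> is a
  multiple of the square of \<open>X w\<close>, and a square root absorbs the factor.\<close>

lemma extremal_rank_one:
  fixes X :: "'k::{alg_closed_field, field_char_0} ^ ('n::finite + 'n) ^ ('n + 'n)"
  assumes X: "X \<in> sp_algebra" "X \<noteq> 0"
    and ext: "\<And>Y. Y \<in> sp_algebra \<Longrightarrow> \<exists>c. commutator X (commutator X Y) = mat_scale c X"
  obtains b where "X = qm b b"
proof -
  obtain w where w: "om (X *v w) w \<noteq> 0"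
  proof (rule ccontr)
    assume "\<not> thesis"
    then have 0: "om (X *v w) w = 0" for w using that by blast
    have "om (X *v v) w = 0" for v w
    proof -
      have "om (X *v v) w + om (X *v w) v = 0"
        using 0[of "v + w"] 0[of v] 0[of w] by (simp add: om_add_left om_add_right matrix_vector_right_distrib add.commute)
      moreover have "om (X *v w) v = om (X *v v) w" using spD[OF X(1), of w v] om_skew[of w "X *v v"] by simp
      ultimately have "2 * om (X *v v) w = 0" by simp
      then show ?thesis by simp
    qed
    then have "X *v v = 0" for v by (rule om_nondeg)
    then have "X = 0" by (simp add: matrix_eq)
    then show False using X(2) by simp
  qed
  define b where "b = X *v w"
  define l where "l = om b w"
  define c' where "c' = X *v b"
  have l: "l \<noteq> 0" using w by (simp add: l_def b_def)
  have wb: "om w b = - l" using om_skew by (simp add: l_def)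
  obtain c where c: "commutator X (commutator X (qm w w)) = mat_scale c X" using ext[OF qm_sp] by blast
  have e: "2 * om c' y * w $ i + 2 * om w y * c' $ i + 4 * om b y * b $ i = c * (X *v y) $ i" for y i
  proof -
    have "commutator X (commutator X (qm w w)) *v y = mat_scale c X *v y" using c by simp
    moreover have "commutator X (commutator X (qm w w))
        = commutator X (qm b w) + commutator X (qm w b)"
      unfolding commutator_qm[OF X(1), of w w] b_def[symmetric]
      by (simp add: commutator_def mat_mul_add_left matrix_add_ldistrib)
    ultimately have "(qm c' w + qm b b + (qm b b + qm w c')) *v y = c *s (X *v y)"
      by (simp add: commutator_qm[OF X(1)] b_def[symmetric] c'_def[symmetric] mat_scale_mv)
    then have "((qm c' w + qm b b + (qm b b + qm w c')) *v y) $ i = (c *s (X *v y)) $ i" by simp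
    then show ?thesis
      unfolding matrix_vector_mult_add_rdistrib qm_mv by (simp add: algebra_simps)
  qed
  have "om c' w = - om b b" using spD[OF X(1), of b w] by (simp add: b_def c'_def)
  then have "om c' w = 0" by simp
  \<comment> \<open>Evaluation at \<open>y = w\<close> determines the factor
    \<open>c\<close>.\<close>
  then have "4 * l * b $ i = c * b $ i" for i
    using e[of w i] by (simp add: l_def b_def[symmetric])
  moreover obtain i where "b $ i \<noteq> 0" using l by (auto simp: l_def vec_eq_iff) (metis om_zero_left vec_eq_iff zero_index)
  ultimately have c4: "c = 4 * l" by (metis mult_cancel_right)
  \<comment> \<open>Evaluation at \<open>y = b\<close> makes \<open>X\<^sup>2 w\<close> a multiple
    of \<open>w\<close>, with a factor \<open>m\<close> for which \<open>3 m = - m\<close>.\<close>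
  have 3: "om c' b * w $ i = 3 * l * c' $ i" for i
    using e[of b i] by (simp add: c4 wb c'_def[symmetric] algebra_simps)
  define m where "m = om c' b / (3 * l)"
  have cm: "c' = m *s w" using 3 l by (simp add: vec_eq_iff m_def field_simps)
  have "om c' b = - m * l" by (subst cm) (simp add: wb)
  then have "m * 3 = - m" using l by (simp add: m_def field_simps)
  then have "4 * m = 0" by simp
  then have c0: "c' = 0" using cm by simp
  have "\<exists>s :: 'k. s ^ 2 = inverse (2 * l)" by (rule nth_root_exists) simp
  then obtain s :: 'k where s: "s ^ 2 = inverse (2 * l)" ..
  have "X *v y = qm (s *s b) (s *s b) *v y" for y
  proof -
    have "(X *v y) $ i = (qm (s *s b) (s *s b) *v y) $ i" for i
    proof -
      have "l * (X *v y) $ i = om b y * b $ i" using e[of y i] by (simp add: c0 c4)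
      moreover have "(qm (s *s b) (s *s b) *v y) $ i = 2 * s ^ 2 * (om b y * b $ i)"
        by (simp add: qm_mv power2_eq_square algebra_simps)
      ultimately have "l * (X *v y) $ i = l * (qm (s *s b) (s *s b) *v y) $ i"
        using l by (simp add: s field_simps)
      then show ?thesis using l by simp
    qed
    then show ?thesis by (simp add: vec_eq_iff)
  qed
  then have "X = qm (s *s b) (s *s b)" by (simp add: matrix_eq)
  then show ?thesis by (rule that)
qed

section \<open>Automorphisms as conjugations by symplectic matrices\<close>

definition symp :: "'k::comm_ring_1 ^ ('n::finite + 'n) ^ ('n + 'n) \<Rightarrow> bool" where
  "symp S \<longleftrightarrow> (\<forall>v w. om (S *v v) (S *v w) = om v w)"

lemma symp_inverse:
  fixes S :: "'k::field_char_0 ^ ('n::finite + 'n) ^ ('n + 'n)"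
  assumes "symp S" obtains S' where "S' ** S = mat 1" "S ** S' = mat 1"
proof -
  have "inj ((*v) S)"
  proof (rule injI)
    fix x y assume "S *v x = S *v y"
    then have "S *v (x - y) = 0" by (simp add: matrix_vector_mult_diff_distrib)
    moreover have "om (S *v (x - y)) (S *v w) = om (x - y) w" for w using assms by (simp add: symp_def)
    ultimately have "om (x - y) w = 0" for w by simp
    then have "x - y = 0" by (rule om_nondeg)
    then show "x = y" by simp
  qed
  then obtain S' where "S' ** S = mat 1" using matrix_left_invertible_injective by blast
  then show ?thesis using that matrix_left_right_inverse1 by blast
qed

lemma vec_double: "x + x = (2 :: 'k::comm_ring_1) *s (x :: 'k ^ 'n)"
  by (simp add: vec_eq_iff)

lemma qm_self_mv: "qm v v *v x = (2 * om v x) *s v"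
  unfolding qm_mv vec_double by simp

lemma commutator_qm_self:
  assumes "X \<in> sp_algebra" shows "commutator X (qm a a) = qm a (2 *s (X *v a))"
  unfolding commutator_qm[OF assms] qm_sym[of "X *v a" a] qm_add[symmetric] vec_double[of "X *v a"] ..

text \<open>Brackets with the products \<open>v w\<close> show that \<open>\<psi> X\<close> and
  \<open>X\<close> agree at \<open>v\<close>, and that \<open>\<psi> X = X\<close> if
  \<open>X v = 0\<close>. Modulo such elements every \<open>X\<close> is a product of
  \<open>w\<close> with a vector \<open>z\<close> dual to \<open>v\<close>; there
  \<open>\<psi>\<close> deviates from the identity by the product of \<open>v\<close> and
  \<open>M w\<close> for a fixed matrix \<open>M\<close>, which turns out to be 0.\<close>

lemma automorphism_fixing_isotropic:
  fixes \<psi> :: "'k::field_char_0 ^ ('n::finite + 'n) ^ ('n + 'n) \<Rightarrow> 'k ^ ('n + 'n) ^ ('n + 'n)"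
  assumes \<psi>: "\<And>X. X \<in> sp_algebra \<Longrightarrow> \<psi> X \<in> sp_algebra"
    and add: "\<And>X Y. X \<in> sp_algebra \<Longrightarrow> Y \<in> sp_algebra \<Longrightarrow> \<psi> (X + Y) = \<psi> X + \<psi> Y"
    and br: "\<And>X Y. X \<in> sp_algebra \<Longrightarrow> Y \<in> sp_algebra \<Longrightarrow> \<psi> (commutator X Y) = commutator (\<psi> X) (\<psi> Y)"
    and v: "v \<noteq> 0" and fix_qm: "\<And>w. \<psi> (qm v w) = qm v w"
    and X: "X \<in> sp_algebra"
  shows "\<psi> X = X"
proof -
  have 1: "\<psi> X *v v = X *v v" if X: "X \<in> sp_algebra" for X
  proof -
    note c = commutator_qm_self
    have "qm v (2 *s (\<psi> X *v v)) = qm v (2 *s (X *v v))"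
      using br[OF X qm_sp, of v v] c[OF X] c[OF \<psi>[OF X]] fix_qm by simp
    then have "2 *s (\<psi> X *v v) = 2 *s (X *v v)" by (rule qm_inj[OF v])
    then show ?thesis by (simp add: vec_eq_iff)
  qed
  have 2: "\<psi> (qm (X *v v) w) = qm (X *v v) w + qm v (\<psi> X *v w - X *v w)" if X: "X \<in> sp_algebra" for X w
  proof -
    have "\<psi> (qm (X *v v) w) + \<psi> (qm v (X *v w)) = qm (\<psi> X *v v) w + qm v (\<psi> X *v w)"
      using br[OF X qm_sp, of v w] by (simp add: commutator_qm[OF X] commutator_qm[OF \<psi>[OF X]] fix_qm add[OF qm_sp qm_sp])
    then show ?thesis by (simp add: 1[OF X] fix_qm qm_diff algebra_simps)
  qed
  have 3: "\<psi> X = X" if X: "X \<in> sp_algebra" "X *v v = 0" for X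
  proof -
    have q0: "qm 0 w = 0" for w :: "'k ^ ('n + 'n)" by (simp add: matrix_eq qm_mv)
    have "\<psi> 0 = 0" using fix_qm[of 0] qm_scale[of v 0 0] by (simp add: mat_scale_def vec_eq_iff[symmetric] zero_vec_def)
    then have "qm v (\<psi> X *v w - X *v w) = qm v 0" for w
      using 2[OF X(1), of w] X(2) q0 qm_sym[of v 0] by simp
    then have "\<psi> X *v w - X *v w = 0" for w using qm_inj[OF v] by blast
    then show ?thesis by (simp add: matrix_eq)
  qed
  obtain z where z: "om v z = 1" using om_dual[OF v] .
  have zv: "om z v = - 1" using om_skew[of z v] z by simp
  \<comment> \<open>The product of \<open>z\<close> and \<open>u\<close> sends \<open>v\<close> to
    \<open>z\<close>, so fact \<open>2\<close> for it describes \<open>\<psi>\<close> on all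
    products with \<open>z\<close>.\<close>
  define u where "u = (- 1 / 2) *s z"
  have zu: "qm z u *v v = z"
    by (simp add: u_def qm_mv zv) (simp add: vec_eq_iff)
  define M where "M = \<psi> (qm z u) - qm z u"
  have zw: "\<psi> (qm z w) = qm z w + qm v (M *v w)" for w
    using 2[OF qm_sp, of z u w] by (simp add: zu M_def matrix_vector_mult_diff_rdistrib)
  \<comment> \<open>The deviation at \<open>w = u\<close> is \<open>M\<close> itself, so
    \<open>M\<close> is the product of \<open>v\<close> and \<open>c = M u\<close>. Computing
    \<open>M z\<close> in both ways gives \<open>- 2 c = c + om c z v\<close>, and pairing with
    \<open>z\<close> leaves \<open>c = 0\<close>.\<close>
  define c where "c = (- 1 / 2) *s (M *v z)"
  have Mu: "M *v u = c" by (simp only: u_def mv_scale c_def)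
  have e: "\<psi> (qm z u) = qm z u + qm v c" using zw[of u] by (simp only: Mu)
  have Mc: "M = qm v c" unfolding M_def e by simp
  have "M *v v = 0" using 1[OF qm_sp, of z u] by (simp add: M_def matrix_vector_mult_diff_rdistrib)
  then have cv: "om c v = 0" using v by (auto simp: Mc qm_mv vec_eq_iff)
  have "M *v z = c + om c z *s v" by (simp add: Mc qm_mv z)
  moreover have "M *v z = (- 2) *s c" by (simp add: c_def vec_eq_iff)
  ultimately have "(- 2) *s c = c + om c z *s v" by (simp only:)
  then have "((- 2) *s c) $ i = (c + om c z *s v) $ i" for i by (rule arg_cong[where f = "\<lambda>x. x $ i"])
  then have h: "- 2 * c $ i = c $ i + om c z * v $ i" for i by simp
  have c3: "3 * c $ i = - om c z * v $ i" for i
  proof -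
    have "3 * c $ i = c $ i - (- 2 * c $ i)" by simp
    also have "\<dots> = - om c z * v $ i" unfolding h by simp
    finally show ?thesis .
  qed
  have "3 *s c = (- om c z) *s v" using c3 by (simp add: vec_eq_iff)
  then have "om (3 *s c) z = om ((- om c z) *s v) z" by (rule arg_cong)
  then have "4 * om c z = 0" using z by simp
  then have "c = 0" using c3 by (simp add: vec_eq_iff)
  then have "M = 0" by (simp add: Mc matrix_eq qm_mv)
  then have "M *v w = 0" for w by simp
  moreover have "qm v 0 = 0" by (simp add: matrix_eq qm_mv)
  ultimately have fz: "\<psi> (qm z w) = qm z w" for w using zw[of w] by simp
  obtain w where w: "qm z w *v v = X *v v" using sp_transitive[OF z] .
  have X': "X - qm z w \<in> sp_algebra" by (rule sp.subspace_diff[OF sp.subspace_L X qm_sp])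
  have "\<psi> (X - qm z w) = X - qm z w"
    by (rule 3[OF X']) (simp add: matrix_vector_mult_diff_rdistrib w)
  moreover have "\<psi> (qm z w + (X - qm z w)) = \<psi> (qm z w) + \<psi> (X - qm z w)" by (rule add[OF qm_sp X'])
  ultimately show ?thesis by (simp add: fz)
qed

text \<open>Squares of nonzero vectors are extremal, hence \<open>\<theta>\<close> maps
  \<open>v\<^sup>2\<close> to some \<open>v1\<^sup>2\<close>. The map that \<open>\<theta>\<close>
  induces from the products with \<open>v\<close> to those with \<open>v1\<close> is linear in the
  other factor, and its matrix is \<open>S\<close>.\<close>

lemma automorphism_inner:
  fixes \<theta> :: "'k::{alg_closed_field, field_char_0} ^ ('n::finite + 'n) ^ ('n + 'n) \<Rightarrow> 'k ^ ('n + 'n) ^ ('n + 'n)"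
  assumes "sp.automorphism \<theta>"
  obtains S where "symp S" "\<And>X v. X \<in> sp_algebra \<Longrightarrow> \<theta> X *v (S *v v) = S *v (X *v v)"
proof -
  have bij: "bij_betw \<theta> sp_algebra sp_algebra"
    and add: "\<And>X Y. X \<in> sp_algebra \<Longrightarrow> Y \<in> sp_algebra \<Longrightarrow> \<theta> (X + Y) = \<theta> X + \<theta> Y"
    and scale: "\<And>c X. X \<in> sp_algebra \<Longrightarrow> \<theta> (mat_scale c X) = mat_scale c (\<theta> X)"
    and br: "\<And>X Y. X \<in> sp_algebra \<Longrightarrow> Y \<in> sp_algebra \<Longrightarrow> \<theta> (commutator X Y) = commutator (\<theta> X) (\<theta> Y)"
    using assms by (auto simp: sp.automorphism_def)
  have cl: "\<theta> X \<in> sp_algebra" if "X \<in> sp_algebra" for X using bij that by (auto simp: bij_betw_def)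
  have inj: "X = Y" if "\<theta> X = \<theta> Y" "X \<in> sp_algebra" "Y \<in> sp_algebra" for X Y
    using bij that by (auto simp: bij_betw_def inj_on_def)
  have surj: "\<exists>X\<in>sp_algebra. Y = \<theta> X" if "Y \<in> sp_algebra" for Y
    using bij that by (auto simp: bij_betw_def)
  have zero: "0 \<in> (sp_algebra :: ('k ^ ('n + 'n) ^ ('n + 'n)) set)" by (rule sp.subspace_0[OF sp.subspace_L])
  have \<theta>0: "\<theta> 0 = 0" using add[OF zero zero] by simp
  define v :: "'k ^ ('n + 'n)" where "v = axis (Inl undefined) 1"
  have v: "v \<noteq> 0" by (simp add: v_def axis_eq_0_iff)
  have qm0: "qm a 0 = (0 :: 'k ^ ('n + 'n) ^ ('n + 'n))" for a by (simp add: matrix_eq qm_mv)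
  have "qm v v \<noteq> 0"
  proof
    assume "qm v v = 0"
    then have "qm v v = qm v 0" by (simp add: qm0)
    then show False using qm_inj[OF v] v by blast
  qed
  then have "\<theta> (qm v v) \<noteq> 0" using inj[OF _ qm_sp zero, of v v] \<theta>0 by auto
  \<comment> \<open>Extremality of \<open>v\<^sup>2\<close> is the identity
    \<open>(ad v\<^sup>2)\<^sup>2 Y' = - 4 om v (Y' v) v\<^sup>2\<close>, transported by
    \<open>\<theta>\<close>.\<close>
  moreover have "\<exists>c. commutator (\<theta> (qm v v)) (commutator (\<theta> (qm v v)) Y) = mat_scale c (\<theta> (qm v v))"
    if Y: "Y \<in> sp_algebra" for Y
  proof -
    obtain Y' where Y': "Y' \<in> sp_algebra" "Y = \<theta> Y'" using surj[OF Y] by blast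
    have "commutator (qm v v) (commutator (qm v v) Y') = mat_scale (- 4 * om v (Y' *v v)) (qm v v)"
    proof -
      have "commutator (qm v v) Y' = - commutator Y' (qm v v)" by (simp add: commutator_def)
      also have "\<dots> = mat_scale (- 2) (qm v (Y' *v v))"
        by (simp add: commutator_qm_self[OF Y'(1)] qm_scale mat_scale_def vec_eq_iff)
      finally have "commutator (qm v v) (commutator (qm v v) Y')
          = mat_scale (- 2) (commutator (qm v v) (qm v (Y' *v v)))"
        by (simp add: commutator_def mat_mul_scale_left mat_mul_scale_right mat_scale_diff mat_mul_minus)
      also have "commutator (qm v v) (qm v (Y' *v v)) = mat_scale (2 * om v (Y' *v v)) (qm v v)"
        by (simp add: commutator_qm[OF qm_sp] qm_self_mv qm_scale qm0 qm_sym[of 0])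
      finally show ?thesis by (simp add: mat_scale_def vec_eq_iff)
    qed
    then have "\<theta> (commutator (qm v v) (commutator (qm v v) Y')) = \<theta> (mat_scale (- 4 * om v (Y' *v v)) (qm v v))" by simp
    then have "commutator (\<theta> (qm v v)) (commutator (\<theta> (qm v v)) (\<theta> Y'))
        = mat_scale (- 4 * om v (Y' *v v)) (\<theta> (qm v v))"
      by (simp only: br qm_sp commutator_sp scale Y'(1))
    then show ?thesis unfolding Y'(2) by blast
  qed
  ultimately obtain v1 where v1: "\<theta> (qm v v) = qm v1 v1" using extremal_rank_one[OF cl[OF qm_sp]] by blast
  have v1nz: "v1 \<noteq> 0"
  proof
    assume "v1 = 0"
    then show False using v1 \<open>\<theta> (qm v v) \<noteq> 0\<close> by (simp add: qm0)
  qed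
  obtain z where z: "om v z = 1" using om_dual[OF v] .
  \<comment> \<open>The \<open>v w\<close> are the image of the adjoint action on \<open>v\<^sup>2\<close>, so \<open>\<theta>\<close> maps them to the \<open>v1 w'\<close>.\<close>
  have ex: "\<exists>w'. \<theta> (qm v w) = qm v1 w'" for w
  proof -
    obtain u where u: "qm z u *v v = w" using sp_transitive[OF z] .
    have "\<theta> (qm v (2 *s w)) = qm v1 (2 *s (\<theta> (qm z u) *v v1))"
      using br[OF qm_sp qm_sp, of z u v v] by (simp add: commutator_qm_self qm_sp cl u v1)
    then have "mat_scale 2 (\<theta> (qm v w)) = mat_scale 2 (qm v1 (\<theta> (qm z u) *v v1))"
      by (simp add: qm_scale scale qm_sp)
    then have "\<theta> (qm v w) = qm v1 (\<theta> (qm z u) *v v1)" by (simp add: mat_scale_def vec_eq_iff)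
    then show ?thesis by blast
  qed
  define f where "f w = (SOME w'. \<theta> (qm v w) = qm v1 w')" for w
  have f: "\<theta> (qm v w) = qm v1 (f w)" for w unfolding f_def by (rule someI_ex[OF ex])
  have fadd: "f (a + b) = f a + f b" for a b
    by (rule qm_inj[OF v1nz]) (simp add: f[symmetric] qm_add add qm_sp)
  have fscale: "f (c *s a) = c *s f a" for c a
    by (rule qm_inj[OF v1nz]) (simp add: f[symmetric] qm_scale scale qm_sp)
  have fv: "f v = v1" by (rule qm_inj[OF v1nz]) (simp add: f[symmetric] v1)
  define S where "S = matrix f"
  have "Vector_Spaces.linear (*s) (*s) f"
    by unfold_locales (simp_all add: fadd fscale vec_eq_iff algebra_simps)
  then have S: "S *v w = f w" for w unfolding S_def by (rule matrix_works)
  have brv: "commutator (qm a b) (qm a c) = mat_scale (om b a) (qm a c) + mat_scale (om a c) (qm a b) + mat_scale (om b c) (qm a a)"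
    for a b c :: "'k ^ ('n + 'n)"
  proof -
    have "commutator (qm a b) (qm a c) = qm (om b a *s a) c + qm a (om a c *s b + om b c *s a)"
      by (simp add: commutator_qm[OF qm_sp] qm_mv)
    then show ?thesis by (simp add: qm_sym[of _ c] qm_add qm_scale add.assoc)
  qed
  \<comment> \<open>Comparing coefficients in \<open>key\<close> shows that \<open>f\<close> preserves the form.\<close>
  have key: "om b v *s f c + om v c *s f b + om b c *s v1 = om (f b) v1 *s f c + om v1 (f c) *s f b + om (f b) (f c) *s v1"
    for b c
  proof (rule qm_inj[OF v1nz])
    have sc: "mat_scale c (qm a b) \<in> sp_algebra" for c and a b :: "'k ^ ('n + 'n)"
      by (rule sp.subspace_scale[OF sp.subspace_L qm_sp])
    have "\<theta> (commutator (qm v b) (qm v c)) = commutator (qm v1 (f b)) (qm v1 (f c))"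
      by (simp add: br qm_sp f)
    then show "qm v1 (om b v *s f c + om v c *s f b + om b c *s v1)
        = qm v1 (om (f b) v1 *s f c + om v1 (f c) *s f b + om (f b) (f c) *s v1)"
      unfolding brv by (simp add: add scale qm_sp sc sp.subspace_add[OF sp.subspace_L] f fv qm_add qm_scale)
  qed
  \<comment> \<open>For \<open>c = v\<close> both sides of \<open>key\<close> are multiples of
    \<open>v1\<close>.\<close>
  have kv: "om (f b) v1 = om b v" for b
  proof -
    have "(om b v + om b v) * v1 $ i = (om (f b) v1 + om (f b) v1) * v1 $ i" for i
      using arg_cong[OF key[of b v], of "\<lambda>x. x $ i"] by (simp add: fv algebra_simps)
    moreover obtain i where "v1 $ i \<noteq> 0" using v1nz by (auto simp: vec_eq_iff)
    ultimately have "om b v + om b v = om (f b) v1 + om (f b) v1" by (metis mult_cancel_right)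
    then show ?thesis by (simp add: mult_2[symmetric])
  qed
  have kv': "om v1 (f b) = om v b" for b using kv[of b] om_skew[of v1 "f b"] om_skew[of v b] by simp
  have "om (f b) (f c) = om b c" for b c
  proof -
    have "om (f b) (f c) *s v1 = om b c *s v1" using key[of b c] by (auto simp: kv kv')
    then show ?thesis using v1nz by auto
  qed
  then have sS: "symp S" by (simp add: symp_def S)
  obtain S' where S': "S' ** S = mat 1" "S ** S' = mat 1" using symp_inverse[OF sS] .
  have S'v: "S' *v (S *v x) = x" "S *v (S' *v x) = x" for x
    using S' by (simp_all add: matrix_vector_mul_assoc)
  have oS': "om (S' *v x) y = om x (S *v y)" for x y
    using sS S'v(2)[of x] unfolding symp_def by metis
  \<comment> \<open>Undoing the conjugation leaves a map that fixes all products with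
    \<open>v\<close>.\<close>
  define \<psi> where "\<psi> X = S' ** \<theta> X ** S" for X
  have \<psi>v: "\<psi> X *v x = S' *v (\<theta> X *v (S *v x))" for X x by (simp add: \<psi>_def matrix_vector_mul_assoc matrix_mul_assoc)
  have "\<psi> X = X" if X: "X \<in> sp_algebra" for X
  proof (rule automorphism_fixing_isotropic[OF _ _ _ v _ X])
    show "\<psi> X \<in> sp_algebra" if "X \<in> sp_algebra" for X
      unfolding sp_iff_om \<psi>v
    proof (intro allI)
      fix a b
      have "om a (S' *v (\<theta> X *v (S *v b))) = om (S *v a) (\<theta> X *v (S *v b))"
        using oS'[of "\<theta> X *v (S *v b)" a] om_skew by metis
      then show "om (S' *v (\<theta> X *v (S *v a))) b = - om a (S' *v (\<theta> X *v (S *v b)))"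
        by (simp add: oS' spD[OF cl[OF that]])
    qed
    show "\<psi> (X + Y) = \<psi> X + \<psi> Y" if "X \<in> sp_algebra" "Y \<in> sp_algebra" for X Y
      using that by (simp add: \<psi>_def add matrix_add_ldistrib mat_mul_add_left)
    show "\<psi> (commutator X Y) = commutator (\<psi> X) (\<psi> Y)" if "X \<in> sp_algebra" "Y \<in> sp_algebra" for X Y
      using that by (simp add: matrix_eq \<psi>v br commutator_mv S'v matrix_vector_mult_diff_distrib)
    show "\<psi> (qm v w) = qm v w" for w
    proof -
      have "\<psi> (qm v w) *v x = qm v w *v x" for x
      proof -
        have "S' *v v1 = v" using S'v(1)[of v] by (simp add: S fv)
        moreover have "om (S *v a) (S *v x) = om a x" for a using sS by (simp add: symp_def)
        moreover have "om v1 (S *v x) = om v x" using sS unfolding symp_def by (metis S fv)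
        ultimately show ?thesis
          by (simp add: \<psi>v f S[symmetric] qm_mv matrix_vector_right_distrib mv_scale S'v)
      qed
      then show ?thesis by (simp add: matrix_eq)
    qed
  qed
  then have "\<theta> X *v (S *v w) = S *v (X *v w)" if "X \<in> sp_algebra" for X w
    using \<psi>v[of X w] S'v(2) that by metis
  then show ?thesis using that sS by blast
qed

text \<open>The \<open>m\<close>-th power of \<open>S\<close> commutes with the Lie algebra.
  Commuting with \<open>v\<^sup>2\<close> makes \<open>v\<close> an eigenvector, and transitivity
  spreads its eigenvalue \<open>\<mu>\<close> to all vectors. As \<open>S\<close> is symplectic,
  \<open>\<mu>\<^sup>2 = 1\<close>, and the \<open>m\<close>-th power of \<open>\<mu> S\<close> is
  \<open>\<mu>\<^sup>m \<mu> = 1\<close>.\<close>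

lemma periodic_automorphism_inner:
  fixes \<theta> :: "'k::{alg_closed_field, field_char_0} ^ ('n::finite + 'n) ^ ('n + 'n) \<Rightarrow> 'k ^ ('n + 'n) ^ ('n + 'n)"
  assumes \<theta>: "sp.automorphism \<theta>" "\<And>X. X \<in> sp_algebra \<Longrightarrow> (\<theta> ^^ m) X = X" and m: "odd m"
  obtains S where "symp S" "\<And>X v. X \<in> sp_algebra \<Longrightarrow> \<theta> X *v (S *v v) = S *v (X *v v)"
    "\<And>v. (((*v) S) ^^ m) v = v"
proof -
  obtain S where S: "symp S" "\<And>X v. X \<in> sp_algebra \<Longrightarrow> \<theta> X *v (S *v v) = S *v (X *v v)"
    using automorphism_inner[OF \<theta>(1)] by blast
  define T where "T k v = (((*v) S) ^^ k) v" for k v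
  have T: "T 0 v = v" "T (Suc k) v = S *v T k v" for k v by (simp_all add: T_def)
  have cl: "(\<theta> ^^ k) X \<in> sp_algebra" if "X \<in> sp_algebra" for k X
    using \<theta>(1) that by (induction k) (auto simp: sp.automorphism_def bij_betw_def)
  have "(\<theta> ^^ k) X *v T k v = T k (X *v v)" if "X \<in> sp_algebra" for k X v
    by (induction k) (simp_all add: T S(2)[OF cl[OF that]])
  then have com: "X *v T m v = T m (X *v v)" if "X \<in> sp_algebra" for X v using \<theta>(2) that by metis
  have Tadd: "T k (c *s v) = c *s T k v" for k c v by (induction k) (simp_all add: T mv_scale)
  have Tom: "om (T k v) (T k w) = om v w" for k v w
    using S(1) by (induction k) (simp_all add: T symp_def)
  define v :: "'k ^ ('n + 'n)" where "v = axis (Inl undefined) 1"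
  have v: "v \<noteq> 0" by (simp add: v_def axis_eq_0_iff)
  obtain z where z: "om v z = 1" using om_dual[OF v] .
  define \<mu> where "\<mu> = om v (T m z)"
  have "(2 * \<mu>) *s v = T m (2 *s v)"
    using com[OF qm_sp, of v v z] by (simp add: qm_self_mv z \<mu>_def)
  then have "2 *s (\<mu> *s v) = 2 *s T m v" by (simp add: Tadd vector_smult_assoc)
  then have Tv: "T m v = \<mu> *s v" by (simp add: vec_eq_iff)
  have Tw: "T m w = \<mu> *s w" for w
  proof -
    obtain u where u: "qm z u *v v = w" using sp_transitive[OF z] .
    show ?thesis using com[OF qm_sp, of z u v] by (simp add: u Tv mv_scale)
  qed
  have \<mu>: "\<mu> * \<mu> = 1" using Tom[of m v z] by (simp add: Tw z)
  define S' where "S' = mat_scale \<mu> S"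
  have S'v: "S' *v x = \<mu> *s (S *v x)" for x by (simp add: S'_def mat_scale_mv)
  show ?thesis
  proof (rule that)
    show "symp S'" using S(1) \<mu> by (simp add: symp_def S'v mult.assoc[symmetric])
    show "\<theta> X *v (S' *v w) = S' *v (X *v w)" if "X \<in> sp_algebra" for X w
      by (simp add: S'v mv_scale S(2)[OF that])
    fix w
    have "(((*v) S') ^^ k) w = \<mu> ^ k *s T k w" for k
      by (induction k) (simp_all add: T S'v mv_scale)
    moreover have "\<mu> ^ m * \<mu> = 1"
    proof -
      obtain k where "m = 2 * k + 1" using m by (elim oddE)
      then show ?thesis using \<mu> by (simp add: power_mult power2_eq_square)
    qed
    ultimately show "(((*v) S') ^^ m) w = w" by (simp add: Tw)
  qed
qed

text \<open>Averaging the powers of \<open>S\<close> against powers of \<open>\<zeta>\<close>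
  projects to the eigenspaces, without leaving a stable subspace \<open>U\<close>; orthogonal
  complements will take its place.\<close>

lemma eigen_components:
  fixes S :: "'k::field_char_0 ^ 'n ^ 'n"
  assumes per: "\<And>v. (((*v) S) ^^ m) v = v" and \<zeta>: "primitive_root \<zeta> m"
    and U: "\<And>c v. v \<in> U \<Longrightarrow> c *s v \<in> U" "\<And>v w. v \<in> U \<Longrightarrow> w \<in> U \<Longrightarrow> v + w \<in> U" "0 \<in> U"
      "\<And>v. v \<in> U \<Longrightarrow> S *v v \<in> U"
    and v: "v \<in> U"
  obtains e where "\<And>k. e k \<in> U" "\<And>k. S *v e k = \<zeta> ^ k *s e k" "(\<Sum>k<m. e k) = v"
proof -
  define T where "T k v = (((*v) S) ^^ k) v" for k v
  have T: "T 0 v = v" "T (Suc k) v = S *v T k v" "T m v = v" for v k using per by (simp_all add: T_def)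
  have TU: "T k v \<in> U" for k using v by (induction k) (simp_all add: T U)
  have nz: "\<zeta> \<noteq> 0" and m1: "\<zeta> ^ m = 1" and m0: "0 < m"
    using primitive_root_nz[OF \<zeta>] \<zeta> by (auto simp: primitive_root_def)
  define f where "f k j = inverse (\<zeta> ^ (k * j)) *s T j v" for k j
  define e where "e k = inverse (of_nat m) *s (\<Sum>j<m. f k j)" for k
  have sumU: "(\<Sum>j\<in>J. h j) \<in> U" if "\<And>j. h j \<in> U" for h and J :: "nat set"
    by (induction J rule: infinite_finite_induct) (simp_all add: that U)
  have "e k \<in> U" for k unfolding e_def f_def by (intro U(1) sumU TU)
  moreover have "S *v e k = \<zeta> ^ k *s e k" for k
  proof -
    have step: "S *v f k j = \<zeta> ^ k *s f k (Suc j)" for j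
      using nz by (simp add: f_def mv_scale T power_add vector_smult_assoc)
    have fm: "f k m = f k 0" using m1 by (simp add: f_def T power_mult mult.commute[of k])
    have "f k 0 + (\<Sum>j<m. f k (Suc j)) = (\<Sum>j<Suc m. f k j)" by (rule sum.lessThan_Suc_shift[symmetric])
    also have "\<dots> = (\<Sum>j<m. f k j) + f k m" by (rule sum.lessThan_Suc)
    finally have sh: "(\<Sum>j<m. f k (Suc j)) = (\<Sum>j<m. f k j)" using fm by (simp only: add.commute add_left_cancel)
    have "S *v (\<Sum>j<m. f k j) = (\<Sum>j<m. \<zeta> ^ k *s f k (Suc j))" by (simp only: mv_sum step)
    also have "\<dots> = \<zeta> ^ k *s (\<Sum>j<m. f k (Suc j))" by (simp add: vec.scale_sum_right)
    finally show ?thesis by (simp add: e_def mv_scale sh vector_smult_assoc mult.commute)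
  qed
  moreover have "(\<Sum>k<m. e k) = v"
  proof -
    have geo: "(\<Sum>k<m. inverse (\<zeta> ^ (k * j))) = (if j = 0 then of_nat m else 0)" if "j < m" for j
      using primitive_root_sum[OF \<zeta> m0 that] by (cases "j = 0") (simp_all add: mult.commute)
    have "(\<Sum>k<m. e k) = inverse (of_nat m) *s (\<Sum>k<m. \<Sum>j<m. f k j)"
      by (simp add: e_def vec.scale_sum_right)
    also have "(\<Sum>k<m. \<Sum>j<m. f k j) = (\<Sum>j<m. (\<Sum>k<m. inverse (\<zeta> ^ (k * j))) *s T j v)"
      by (subst sum.swap) (simp add: f_def vec.scale_sum_left)
    also have "\<dots> = (\<Sum>j<m. if j = 0 then of_nat m *s v else 0)"
      by (intro sum.cong) (auto simp: geo T)
    also have "\<dots> = of_nat m *s v" using m0 by simp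
    finally show ?thesis using m0 by (simp add: vector_smult_assoc)
  qed
  ultimately show ?thesis by (rule that)
qed

section \<open>Symplectic bases of eigenvectors\<close>

definition both :: "'n set \<Rightarrow> ('n + 'n) set" where "both I = Inl ` I \<union> Inr ` I"

lemma both_swap: "swap_index p \<in> both I \<longleftrightarrow> p \<in> both I"
  by (cases p) (auto simp: both_def)

text \<open>Dual pairs of eigenvectors are split off one at a time. The orthogonal complement
  \<open>U\<close> of the pairs already found is stable because \<open>S\<close> preserves the form,
  for which also dual eigenvectors have inverse eigenvalues.\<close>

lemma symplectic_eigenbasis_partial:
  fixes S :: "'k::field_char_0 ^ ('n::finite + 'n) ^ ('n + 'n)" and I :: "'n set"
  assumes S: "symp S" and per: "\<And>v. (((*v) S) ^^ m) v = v" and \<zeta>: "primitive_root \<zeta> m" and m: "odd m"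
  shows "\<exists>g a. (\<forall>p\<in>both I. \<forall>q\<in>both I. om (g p) (g q) = (if q = swap_index p then index_sign p else 0))
    \<and> (\<forall>p\<in>both I. S *v g p = \<zeta> powi a p *s g p \<and> a (swap_index p) = - a p \<and> 2 * \<bar>a p\<bar> < int m)"
proof -
  have "finite I" by simp
  then show ?thesis
  proof (induction I rule: finite_induct)
    case empty
    then show ?case by (simp add: both_def)
  next
    case (insert i I)
    then obtain g a where g: "\<And>p q. p \<in> both I \<Longrightarrow> q \<in> both I \<Longrightarrow> om (g p) (g q) = (if q = swap_index p then index_sign p else 0)"
      and a: "\<And>p. p \<in> both I \<Longrightarrow> S *v g p = \<zeta> powi a p *s g p" "\<And>p. p \<in> both I \<Longrightarrow> a (swap_index p) = - a p"
        "\<And>p. p \<in> both I \<Longrightarrow> 2 * \<bar>a p\<bar> < int m" by blast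
    have nz: "\<zeta> \<noteq> 0" using primitive_root_nz[OF \<zeta>] .
    define U where "U = {v. \<forall>q\<in>both I. om v (g q) = 0}"
    define d where "d v p = index_sign p * om v (g (swap_index p))" for v p
    define pr where "pr v = v - (\<Sum>p\<in>both I. d v p *s g p)" for v
    have prU: "pr v \<in> U" for v
    proof -
      have "om (\<Sum>p\<in>both I. d v p *s g p) (g q) = om v (g q)" if q: "q \<in> both I" for q
      proof -
        have "om (\<Sum>p\<in>both I. d v p *s g p) (g q) = (\<Sum>p\<in>both I. if p = swap_index q then om v (g q) else 0)"
          unfolding om_sum_left using g q by (intro sum.cong refl) (auto simp: d_def swap_eq_iff mult_ac)
        then show ?thesis using both_swap[of q I] q by simp
      qed
      then show ?thesis by (simp add: U_def pr_def om_diff_left)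
    qed
    have Usub: "\<And>c v. v \<in> U \<Longrightarrow> c *s v \<in> U" "\<And>v w. v \<in> U \<Longrightarrow> w \<in> U \<Longrightarrow> v + w \<in> U" "0 \<in> U"
      by (auto simp: U_def om_add_left)
    have US: "S *v v \<in> U" if v: "v \<in> U" for v
      unfolding U_def
    proof (intro CollectI ballI)
      fix q assume q: "q \<in> both I"
      have "\<zeta> powi a q * om (S *v v) (g q) = om (S *v v) (S *v g q)" by (simp add: a(1)[OF q])
      also have "\<dots> = om v (g q)" using S by (simp add: symp_def)
      also have "\<dots> = 0" using v q by (simp add: U_def)
      finally show "om (S *v v) (g q) = 0" using nz by simp
    qed
    \<comment> \<open>By dimension: fewer than \<open>l\<close> pairs do not span the whole
      space.\<close>
    have "\<exists>x\<in>U. x \<noteq> 0"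
    proof (rule ccontr)
      assume "\<not> ?thesis"
      then have "pr v = 0" for v using prU by blast
      then have "v = (\<Sum>p\<in>both I. d v p *s g p)" for v by (simp add: pr_def)
      moreover have "(\<Sum>p\<in>both I. d v p *s g p) \<in> vec.span (g ` both I)" for v
        by (intro vec.span_sum vec.span_scale vec.span_base) auto
      ultimately have "UNIV \<subseteq> vec.span (g ` both I)" by (metis subsetI)
      then have "vec.dim (UNIV :: ('k ^ ('n + 'n)) set) \<le> card (g ` both I)" by (rule vec.dim_le_card) simp
      also have "\<dots> \<le> card (both I)" by (rule card_image_le) simp
      also have "\<dots> \<le> card (Inl ` I :: ('n + 'n) set) + card (Inr ` I :: ('n + 'n) set)" unfolding both_def by (rule card_Un_le)
      also have "\<dots> = 2 * card I" by (simp add: card_image)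
      also have "card I < CARD('n)" using insert.hyps by (intro psubset_card_mono) auto
      finally show False unfolding vec_dim_card by simp
    qed
    then obtain x where x: "x \<in> U" "x \<noteq> 0" by blast
    obtain e where e: "\<And>k. e k \<in> U" "\<And>k. S *v e k = \<zeta> ^ k *s e k" "(\<Sum>k<m. e k) = x"
      using eigen_components[OF per \<zeta> Usub US x(1)] by blast
    obtain k where k: "k < m" "e k \<noteq> 0" using e(3) x(2) by (metis lessThan_iff sum.neutral)
    define v where "v = e k"
    obtain y where y: "om v y = 1" using om_dual k(2) by (metis v_def)
    have vU: "v \<in> U" using e(1) by (simp add: v_def)
    have "om v (pr y) = 1"
      using vU y by (simp add: pr_def om_diff_right om_sum_right U_def)
    moreover obtain f where f: "\<And>k. f k \<in> U" "\<And>k. S *v f k = \<zeta> ^ k *s f k" "(\<Sum>k<m. f k) = pr y"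
      using eigen_components[OF per \<zeta> Usub US prU] by blast
    ultimately have "(\<Sum>j<m. om v (f j)) = 1" by (simp add: om_sum_right[symmetric])
    \<comment> \<open>A vector of \<open>U\<close> dual to \<open>v\<close> need not be an
      eigenvector, but some eigencomponent of it pairs with \<open>v\<close>.\<close>
    then obtain j where j: "om v (f j) \<noteq> 0" by (metis sum.neutral zero_neq_one)
    define w where "w = inverse (om v (f j)) *s f j"
    have w: "om v w = 1" "w \<in> U" "S *v w = \<zeta> ^ j *s w"
      using j f by (simp_all add: w_def Usub mv_scale vector_smult_assoc mult.commute)
    have wv: "om w v = - 1" using om_skew[of w v] w(1) by simp
    have Sv: "S *v v = \<zeta> ^ k *s v" using e(2) by (simp add: v_def)
    have "\<zeta> ^ k * \<zeta> ^ j = 1"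
    proof -
      have "om (S *v v) (S *v w) = om v w" using S by (simp add: symp_def)
      then show ?thesis using w(1) by (simp add: Sv w(3) mult.commute)
    qed
    then have zj: "\<zeta> ^ j = inverse (\<zeta> ^ k)" using nz by (simp add: field_simps)
    \<comment> \<open>The representative of \<open>k\<close> modulo \<open>m\<close> of least
      absolute value; \<open>m / 2\<close> is excluded by oddness, so \<open>- b\<close> is of the
      same kind.\<close>
    define b where "b = (if 2 * k < m then int k else int k - int m)"
    have zb: "\<zeta> powi b = \<zeta> ^ k"
      using \<zeta> nz by (auto simp: b_def power_int_diff primitive_root_def)
    have b: "2 * \<bar>b\<bar> < int m"
    proof (cases "2 * k < m")
      case False
      then have "m < 2 * k" using m by presburger
      then show ?thesis using k(1) by (simp add: b_def)
    qed (simp add: b_def)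
    define g' where "g' = g(Inl i := v, Inr i := w)"
    define a' where "a' = a(Inl i := b, Inr i := - b)"
    have bi: "both (insert i I) = insert (Inl i) (insert (Inr i) (both I))" by (auto simp: both_def)
    have ni: "Inl i \<notin> both I" "Inr i \<notin> both I" using insert.hyps by (auto simp: both_def)
    have ni': "p \<noteq> Inl i" "p \<noteq> Inr i" "swap_index p \<noteq> Inl i" "swap_index p \<noteq> Inr i" if "p \<in> both I" for p
      using that ni both_swap[of p I] by auto
    have gU: "om v (g p) = 0" "om w (g p) = 0" "om (g p) v = 0" "om (g p) w = 0" if "p \<in> both I" for p
      using vU w(2) that om_skew[of "g p"] by (auto simp: U_def)
    show ?case
    proof (intro exI[of _ g'] exI[of _ a'] conjI ballI)
      fix p q assume "p \<in> both (insert i I)" "q \<in> both (insert i I)"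
      then show "om (g' p) (g' q) = (if q = swap_index p then index_sign p else 0)"
        unfolding bi using ni' ni g gU w(1) wv swap_neq[of p, symmetric] by (auto simp: g'_def)
    next
      fix p assume p: "p \<in> both (insert i I)"
      show "S *v g' p = \<zeta> powi a' p *s g' p"
        using p ni' a(1) unfolding bi by (auto simp: g'_def a'_def zb Sv w(3) zj power_int_minus)
      show "a' (swap_index p) = - a' p"
        using p ni' a(2) unfolding bi by (auto simp: a'_def)
      show "2 * \<bar>a' p\<bar> < int m"
        using p ni' a(3) b unfolding bi by (auto simp: a'_def)
    qed
  qed
qed

lemma symplectic_eigenbasis:
  fixes S :: "'k::field_char_0 ^ ('n::finite + 'n) ^ ('n + 'n)"
  assumes "symp S" and "\<And>v. (((*v) S) ^^ m) v = v" and "primitive_root \<zeta> m" and "odd m"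
  obtains g :: "'n + 'n \<Rightarrow> 'k ^ ('n + 'n)" and a where "\<And>p q. om (g p) (g q) = (if q = swap_index p then index_sign p else 0)"
    "\<And>p. S *v g p = \<zeta> powi a p *s g p" "\<And>p. a (swap_index p) = - a p" "\<And>p. 2 * \<bar>a p\<bar> < int m"
proof -
  have "both (UNIV :: 'n set) = UNIV" by (auto simp: both_def) (metis obj_sumE rangeI)
  then have "\<exists>(g :: 'n + 'n \<Rightarrow> 'k ^ ('n + 'n)) a. (\<forall>p q. om (g p) (g q) = (if q = swap_index p then index_sign p else 0))
    \<and> (\<forall>p. S *v g p = \<zeta> powi a p *s g p \<and> a (swap_index p) = - a p \<and> 2 * \<bar>a p\<bar> < int m)"
    using symplectic_eigenbasis_partial[OF assms, of UNIV] by (simp only: ball_UNIV)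
  then obtain g :: "'n + 'n \<Rightarrow> 'k ^ ('n + 'n)" and a
    where h: "\<forall>p q. om (g p) (g q) = (if q = swap_index p then index_sign p else 0)"
      "\<forall>p. S *v g p = \<zeta> powi a p *s g p \<and> a (swap_index p) = - a p \<and> 2 * \<bar>a p\<bar> < int m"
    by (elim exE conjE)
  show ?thesis by (rule that[of g a]) (simp_all add: h)
qed

section \<open>The bounds for the index\<close>

context finite_dimensional_vector_space
begin

lemma independent_family_card:
  assumes "finite I" and u: "\<And>i. i \<in> I \<Longrightarrow> u i \<in> V"
    and ind: "\<And>c i. (\<Sum>i\<in>I. scale (c i) (u i)) = 0 \<Longrightarrow> i \<in> I \<Longrightarrow> c i = 0"
  shows "card I \<le> dim V"
proof -
  have inj: "inj_on u I"
  proof (rule inj_onI, rule ccontr)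
    fix i j assume ij: "i \<in> I" "j \<in> I" "u i = u j" "i \<noteq> j"
    define c where "c = (\<lambda>k. if k = i then 1 else if k = j then - 1 else 0 :: 'a)"
    have "(\<Sum>k\<in>I. scale (c k) (u k)) = (\<Sum>k\<in>{i, j}. scale (c k) (u k))"
      using assms(1) ij by (intro sum.mono_neutral_right) (auto simp: c_def)
    also have "\<dots> = 0" using ij by (simp add: c_def)
    finally have "c i = 0" using ind ij(1) by blast
    then show False by (simp add: c_def)
  qed
  have "independent (u ` I)"
  proof (rule independent_if_scalars_zero)
    fix f x assume f: "(\<Sum>x\<in>u ` I. scale (f x) x) = 0" and "x \<in> u ` I"
    then obtain i where i: "x = u i" "i \<in> I" by blast
    have "(\<Sum>i\<in>I. scale (f (u i)) (u i)) = 0" using f by (simp add: sum.reindex[OF inj])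
    then show "f x = 0" using ind[of "\<lambda>i. f (u i)"] i by simp
  qed (use assms(1) in simp)
  then have "card (u ` I) \<le> dim V" using u by (intro independent_card_le_dim) auto
  then show ?thesis by (simp add: card_image[OF inj])
qed

lemma dim_le_injective:
  assumes U: "subspace U" and h: "\<And>x. x \<in> U \<Longrightarrow> h x \<in> V"
    and add: "\<And>x y. x \<in> U \<Longrightarrow> y \<in> U \<Longrightarrow> h (x + y) = h x + h y"
    and scale: "\<And>c x. x \<in> U \<Longrightarrow> h (scale c x) = scale c (h x)"
    and inj: "\<And>x. x \<in> U \<Longrightarrow> h x = 0 \<Longrightarrow> x = 0"
  shows "dim U \<le> dim V"
proof -
  obtain B where B: "B \<subseteq> U" "independent B" "U \<subseteq> span B" "card B = dim U"
    using basis_exists[of U] by blast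
  have fin: "finite B" using B(2) by (rule finiteI_independent)
  have sumU: "(\<Sum>b\<in>C. scale (c b) b) \<in> U" if "C \<subseteq> U" for C and c :: "'b \<Rightarrow> 'a"
    using that by (intro subspace_sum[OF U] subspace_scale[OF U]) auto
  have h0: "h 0 = 0" using scale[of 0 0] subspace_0[OF U] by simp
  have hs: "h (\<Sum>b\<in>C. scale (c b) b) = (\<Sum>b\<in>C. scale (c b) (h b))" if "C \<subseteq> U" "finite C" for C c
    using that(2,1)
  proof (induction C rule: finite_induct)
    case (insert b C)
    then show ?case using add[OF subspace_scale[OF U] sumU, of b C "c b" c] scale[of b] by simp
  qed (simp add: h0)
  have "card B \<le> dim V"
  proof (rule independent_family_card[OF fin, of h])
    show "h b \<in> V" if "b \<in> B" for b using h B(1) that by blast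
    fix c b assume "(\<Sum>b\<in>B. scale (c b) (h b)) = 0" "b \<in> B"
    then have "(\<Sum>b\<in>B. scale (c b) b) = 0" using inj[OF sumU[OF B(1)]] hs[OF B(1) fin] by simp
    then show "c b = 0" using independentD[OF B(2) fin subset_refl _ \<open>b \<in> B\<close>] by blast
  qed
  then show ?thesis using B(4) by simp
qed

end

definition mat_unit :: "'m \<Rightarrow> 'n \<Rightarrow> 'k::zero_neq_one ^ 'n ^ 'm" where
  "mat_unit p q = (\<chi> i j. if i = p \<and> j = q then 1 else 0)"

lemma mat_unit_sum:
  fixes f :: "'m::finite \<times> 'n::finite \<Rightarrow> 'k::field"
  shows "(\<Sum>z\<in>UNIV. mat_scale (f z) (mat_unit (fst z) (snd z))) = (\<chi> i j. f (i, j))"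
proof -
  have "(\<Sum>z\<in>UNIV. mat_scale (f z) (mat_unit (fst z) (snd z))) $ i $ j = f (i, j)" for i j
  proof -
    have "(\<Sum>z\<in>UNIV. mat_scale (f z) (mat_unit (fst z) (snd z))) $ i $ j
        = (\<Sum>z\<in>UNIV. if z = (i, j) then f (i, j) else 0)"
      unfolding sum_component by (rule sum.cong) (auto simp: mat_scale_def mat_unit_def)
    then show ?thesis by simp
  qed
  then show ?thesis by (simp add: vec_eq_iff)
qed

lemma mat_unit_inj: "inj (\<lambda>z. mat_unit (fst z) (snd z) :: 'k::zero_neq_one ^ 'n ^ 'm)"
proof (rule injI)
  fix z w assume "(mat_unit (fst z) (snd z) :: 'k ^ 'n ^ 'm) = mat_unit (fst w) (snd w)"
  then have "(mat_unit (fst z) (snd z) :: 'k ^ 'n ^ 'm) $ fst z $ snd z = mat_unit (fst w) (snd w) $ fst z $ snd z" by simp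
  then show "z = w" by (auto simp: mat_unit_def prod_eq_iff split: if_splits)
qed

lemma finite_dimensional_mat_scale:
  "finite_dimensional_vector_space (mat_scale :: 'k::field \<Rightarrow> 'k ^ 'n::finite ^ 'm::finite \<Rightarrow> _)
    (range (\<lambda>z. mat_unit (fst z) (snd z)))"
proof -
  interpret vector_space "mat_scale :: 'k \<Rightarrow> 'k ^ 'n ^ 'm \<Rightarrow> _" by (rule vector_space_mat_scale)
  show ?thesis
  proof
    show "finite (range (\<lambda>z. mat_unit (fst z) (snd z) :: 'k ^ 'n ^ 'm))" by simp
    show "independent (range (\<lambda>z. mat_unit (fst z) (snd z) :: 'k ^ 'n ^ 'm))"
    proof (rule independent_if_scalars_zero)
      fix f and x :: "'k ^ 'n ^ 'm"
      assume f: "(\<Sum>x\<in>range (\<lambda>z. mat_unit (fst z) (snd z)). mat_scale (f x) x) = (0 :: 'k ^ 'n ^ 'm)"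
        and "x \<in> range (\<lambda>z :: 'm \<times> 'n. mat_unit (fst z) (snd z))"
      then obtain z :: "'m \<times> 'n" where z: "x = mat_unit (fst z) (snd z)" by blast
      have "(\<chi> i j. f (mat_unit i j)) = (0 :: 'k ^ 'n ^ 'm)"
        using f mat_unit_sum[of "\<lambda>z. f (mat_unit (fst z) (snd z))"] by (simp add: sum.reindex[OF mat_unit_inj])
      then have "(\<chi> i j. f (mat_unit i j)) $ fst z $ snd z = (0 :: 'k ^ 'n ^ 'm) $ fst z $ snd z" by simp
      then show "f x = 0" by (simp add: z)
    qed simp
    show "span (range (\<lambda>z. mat_unit (fst z) (snd z) :: 'k ^ 'n ^ 'm)) = UNIV"
    proof -
      have "A \<in> span (range (\<lambda>z. mat_unit (fst z) (snd z)))" for A :: "'k ^ 'n ^ 'm"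
      proof -
        have "A = (\<Sum>z\<in>UNIV. mat_scale (A $ fst z $ snd z) (mat_unit (fst z) (snd z)))"
          unfolding mat_unit_sum by (simp add: vec_eq_iff)
        also have "\<dots> \<in> span (range (\<lambda>z. mat_unit (fst z) (snd z)))"
          by (intro span_sum span_scale span_base) blast
        finally show ?thesis .
      qed
      then show ?thesis by blast
    qed
  qed
qed

global_interpretation mat: finite_dimensional_vector_space
  "mat_scale :: 'k::field \<Rightarrow> 'k ^ 'n::finite ^ 'm::finite \<Rightarrow> _" "range (\<lambda>z. mat_unit (fst z) (snd z))"
  by (rule finite_dimensional_mat_scale)

section \<open>The index and its behaviour under degeneration\<close>

context lie_algebra
begin

lemma zero_dual: "(\<lambda>_. 0) \<in> dual" by (simp add: dual_def)

lemma index_le: "\<xi> \<in> dual \<Longrightarrow> index \<le> dim (stabiliser \<xi>)"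
  unfolding index_def by (rule Least_le) blast

lemma index_attained: obtains \<xi> where "\<xi> \<in> dual" "index = dim (stabiliser \<xi>)"
proof -
  have "\<exists>\<xi>\<in>dual. index = dim (stabiliser \<xi>)" unfolding index_def by (rule LeastI_ex) (use zero_dual in blast)
  then show ?thesis using that by blast
qed

lemma stabiliser_eq: "stabiliser \<xi> = {x \<in> L. \<forall>y\<in>L. \<xi> (br x y) = 0}"
  by (simp add: stabiliser_def coadjoint_def)

lemma dual_add: "\<xi> \<in> dual \<Longrightarrow> x \<in> L \<Longrightarrow> y \<in> L \<Longrightarrow> \<xi> (x + y) = \<xi> x + \<xi> y"
  and dual_scale: "\<xi> \<in> dual \<Longrightarrow> x \<in> L \<Longrightarrow> \<xi> (c \<cdot> x) = c * \<xi> x"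
  by (simp_all add: dual_def)

lemma dual_sum:
  assumes "\<xi> \<in> dual" "\<And>i. i \<in> A \<Longrightarrow> f i \<in> L" shows "\<xi> (\<Sum>i\<in>A. f i) = (\<Sum>i\<in>A. \<xi> (f i))"
proof -
  have z: "\<xi> 0 = 0" using dual_scale[OF assms(1), of 0 0] subspace_0[OF subspace_L] by simp
  show ?thesis using assms(2)
    by (induction A rule: infinite_finite_induct)
      (auto simp: z dual_add[OF assms(1)] subspace_sum[OF subspace_L])
qed

lemma stabiliser_subspace:
  assumes "\<xi> \<in> dual" shows "subspace (stabiliser \<xi>)"
  unfolding subspace_def stabiliser_eq
  using subspace_L dual_add[OF assms] dual_scale[OF assms] dual_scale[OF assms, of 0 0]
  by (auto simp: subspace_0 subspace_add subspace_scale br_zero_left br_add_left br_scale_left br_closed)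

end

context periodic_lie_algebra
begin

sublocale contr: lie_algebra scale L br0 by (rule lie_algebra_contraction)

lemma br_expand:
  assumes "x \<in> L" "y \<in> L" shows "br x y = (\<Sum>i<m. \<Sum>j<m. br (cpt i x) (cpt j y))"
proof -
  have "br x y = br (\<Sum>i<m. cpt i x) y" using component_decomposition(1)[OF assms(1)] by simp
  also have "\<dots> = (\<Sum>i<m. br (cpt i x) y)" by (rule br_sum_left) (auto simp: comp_L assms)
  also have "\<dots> = (\<Sum>i<m. \<Sum>j<m. br (cpt i x) (cpt j y))"
  proof (rule sum.cong)
    fix i assume i: "i \<in> {..<m}"
    have "br (cpt i x) y = br (cpt i x) (\<Sum>j<m. cpt j y)" using component_decomposition(1)[OF assms(2)] by simp
    also have "\<dots> = (\<Sum>j<m. br (cpt i x) (cpt j y))" by (rule br_sum_right) (use i assms in \<open>auto simp: comp_L\<close>)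
    finally show "br (cpt i x) y = (\<Sum>j<m. br (cpt i x) (cpt j y))" .
  qed simp
  finally show ?thesis .
qed

definition twist :: "'k \<Rightarrow> 'v \<Rightarrow> 'v" where "twist s x = (\<Sum>i<m. s ^ i \<cdot> cpt i x)"

lemma twist_L: "x \<in> L \<Longrightarrow> twist s x \<in> L"
  unfolding twist_def by (intro subspace_sum[OF subspace_L] subspace_scale[OF subspace_L] comp_L) auto

lemma twist_add: "x \<in> L \<Longrightarrow> y \<in> L \<Longrightarrow> twist s (x + y) = twist s x + twist s y"
  by (simp add: twist_def comp_add scale_right_distrib sum.distrib)

lemma twist_scale: "x \<in> L \<Longrightarrow> twist s (c \<cdot> x) = c \<cdot> twist s x"
  by (simp add: twist_def comp_scale scale_sum_right mult.commute)

lemma twist_sum: "(\<And>i. i \<in> A \<Longrightarrow> f i \<in> L) \<Longrightarrow> twist s (\<Sum>i\<in>A. f i) = (\<Sum>i\<in>A. twist s (f i))"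
  using twist_scale[of 0 s 0] subspace_0[OF subspace_L]
  by (induction A rule: infinite_finite_induct) (auto simp: twist_add subspace_sum[OF subspace_L])

lemma cpt_twist: "x \<in> L \<Longrightarrow> i < m \<Longrightarrow> cpt i (twist s x) = s ^ i \<cdot> cpt i x"
  unfolding twist_def
  by (rule component_unique) (auto intro: subspace_scale[OF eig_subspace] component_decomposition(2))

lemma twist_twist: "x \<in> L \<Longrightarrow> s \<noteq> 0 \<Longrightarrow> twist (inverse s) (twist s x) = x"
  using component_decomposition(1)[of x]
  by (simp add: twist_def[of "inverse s"] cpt_twist power_mult_distrib[symmetric])

lemma twist_eig:
  assumes "x \<in> eig i" "i < m" shows "twist s x = s ^ i \<cdot> x"
proof -
  have "twist s x = (\<Sum>j<m. if j = i then s ^ i \<cdot> x else 0)"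
    unfolding twist_def by (rule sum.cong) (auto simp: comp_homogeneous[OF assms])
  then show ?thesis using assms(2) by simp
qed

text \<open>Conjugating the bracket by \<open>x\<^sub>0 + \<dots> + x\<^bsub>m-1\<^esub> \<mapsto> x\<^sub>0 + s x\<^sub>1 + \<dots> + s\<^bsup>m-1\<^esup> x\<^bsub>m-1\<^esub>\<close> multiplies \<open>[x\<^sub>i, x\<^sub>j]\<close>
  by \<open>1\<close> if \<open>i + j < m\<close> and by \<open>s\<^sup>m\<close> otherwise.\<close>

lemma twisted_bracket:
  assumes x: "x \<in> L" and y: "y \<in> L" and s: "s \<noteq> 0"
  shows "twist (inverse s) (br (twist s x) (twist s y)) = br0 x y + s ^ m \<cdot> (br x y - br0 x y)"
proof -
  let ?b = "\<lambda>i j. br (cpt i x) (cpt j y)"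
  have bL: "?b i j \<in> L" if "i < m" "j < m" for i j using that by (intro br_closed comp_L x y)
  have "br (twist s x) (twist s y) = (\<Sum>i<m. \<Sum>j<m. s ^ (i + j) \<cdot> ?b i j)"
    unfolding br_expand[OF twist_L[OF x] twist_L[OF y]]
    by (intro sum.cong refl) (simp add: cpt_twist x y br_scale_left br_scale_right comp_L subspace_scale[OF subspace_L] power_add mult.commute)
  then have "twist (inverse s) (br (twist s x) (twist s y))
      = (\<Sum>i<m. twist (inverse s) (\<Sum>j<m. s ^ (i + j) \<cdot> ?b i j))"
    by (simp only:) (rule twist_sum, auto intro!: subspace_sum[OF subspace_L] subspace_scale[OF subspace_L] bL)
  also have "\<dots> = (\<Sum>i<m. \<Sum>j<m. twist (inverse s) (s ^ (i + j) \<cdot> ?b i j))"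
    by (intro sum.cong refl twist_sum) (auto intro!: subspace_scale[OF subspace_L] bL)
  also have "\<dots> = (\<Sum>i<m. \<Sum>j<m. (if i + j \<le> m - 1 then ?b i j else 0) + s ^ m \<cdot> (?b i j - (if i + j \<le> m - 1 then ?b i j else 0)))"
  proof (intro sum.cong refl)
    fix i j assume "i \<in> {..<m}" "j \<in> {..<m}"
    then have ij: "i < m" "j < m" by auto
    have "?b i j \<in> eig ((i + j) mod m)" using ij by (intro eig_br component_decomposition(2) x y)
    then have "twist (inverse s) (?b i j) = inverse s ^ ((i + j) mod m) \<cdot> ?b i j"
      using m_pos by (intro twist_eig) auto
    then have t: "twist (inverse s) (s ^ (i + j) \<cdot> ?b i j) = (s ^ (i + j) * inverse s ^ ((i + j) mod m)) \<cdot> ?b i j"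
      using bL[OF ij] by (simp add: twist_scale)
    show "twist (inverse s) (s ^ (i + j) \<cdot> ?b i j)
        = (if i + j \<le> m - 1 then ?b i j else 0) + s ^ m \<cdot> (?b i j - (if i + j \<le> m - 1 then ?b i j else 0))"
    proof (cases "i + j \<le> m - 1")
      case True
      then have "i + j < m" using m_pos by linarith
      then show ?thesis using s True unfolding t by (simp add: power_mult_distrib[symmetric])
    next
      case False
      then have "(i + j) mod m = i + j - m" using ij by (simp add: mod_if)
      moreover have "s ^ (i + j) = s ^ m * s ^ (i + j - m)" using False by (simp add: power_add[symmetric])
      moreover have "s ^ (i + j - m) * inverse s ^ (i + j - m) = 1" using s by (simp add: power_mult_distrib[symmetric])
      ultimately show ?thesis using False unfolding t by (simp add: mult.assoc)
    qed
  qed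
  also have "\<dots> = br0 x y + s ^ m \<cdot> (br x y - br0 x y)"
    unfolding br_expand[OF x y] contraction_def
    by (simp add: sum.distrib scale_sum_right[symmetric] sum_subtractf)
  finally show ?thesis .
qed

end

text \<open>A form attaining the index of the contraction is kept while the bracket is deformed. The
  radical of a generic deformation is not larger, and a twist identifies it with a stabiliser for
  the original bracket.\<close>

lemma index_contraction_ge:
  fixes L :: "('k::{alg_closed_field, field_char_0} ^ 'n::finite ^ 'n) set" and br
  assumes "periodic_lie_algebra mat_scale L br \<theta> m \<zeta>"
  shows "lie_algebra.index mat_scale L br
    \<le> lie_algebra.index mat_scale L (lie_algebra.contraction mat_scale L br \<theta> m \<zeta>)"
proof -
  interpret P: periodic_lie_algebra mat_scale L br \<theta> m \<zeta> by fact
  obtain \<xi> where \<xi>: "\<xi> \<in> P.contr.dual" "P.contr.index = mat.dim (P.contr.stabiliser \<xi>)"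
    using P.contr.index_attained by blast
  note sub = P.subspace_L
  define f where "f x y = \<xi> (P.br0 x y)" for x y
  define g where "g x y = \<xi> (br x y - P.br0 x y)" for x y
  have subd: "x - y \<in> L" if "x \<in> L" "y \<in> L" for x y using mat.subspace_diff[OF sub that] .
  have "finite {t. mat.dim {x \<in> L. \<forall>y\<in>L. f x y + t * g x y = 0} > mat.dim {x \<in> L. \<forall>y\<in>L. f x y = 0}}"
  proof (rule mat.radical_dim_generic[OF sub])
    show "f (x + y) z = f x z + f y z" if "x \<in> L" "y \<in> L" "z \<in> L" for x y z
      using that by (simp add: f_def P.br0_add_left P.br0_closed P.contr.dual_add[OF \<xi>(1)])
    show "f (mat_scale c x) z = c * f x z" if "x \<in> L" "z \<in> L" for c x z
      using that by (simp add: f_def P.br0_scale_left P.br0_closed P.contr.dual_scale[OF \<xi>(1)])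
    show "g (x + y) z = g x z + g y z" if "x \<in> L" "y \<in> L" "z \<in> L" for x y z
    proof -
      have "br (x + y) z - P.br0 (x + y) z = (br x z - P.br0 x z) + (br y z - P.br0 y z)"
        using that by (simp add: P.br_add_left P.br0_add_left)
      then show ?thesis using that by (simp add: g_def P.br_closed P.br0_closed subd P.contr.dual_add[OF \<xi>(1)])
    qed
    show "g (mat_scale c x) z = c * g x z" if "x \<in> L" "z \<in> L" for c x z
    proof -
      have "br (mat_scale c x) z - P.br0 (mat_scale c x) z = mat_scale c (br x z - P.br0 x z)"
        using that by (simp add: P.br_scale_left P.br0_scale_left mat.scale_right_diff_distrib)
      then show ?thesis using that by (simp add: g_def P.br_closed P.br0_closed subd P.contr.dual_scale[OF \<xi>(1)])
    qed
  qed
  then obtain t where t: "t \<noteq> 0" "\<not> mat.dim {x \<in> L. \<forall>y\<in>L. f x y + t * g x y = 0} > mat.dim {x \<in> L. \<forall>y\<in>L. f x y = 0}"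
    by (rule avoid_finite_sets[OF _ finite.emptyI]) (auto intro: that)
  \<comment> \<open>The twist by \<open>s\<close> realises the deformation parameter
    \<open>s ^ m\<close>, so an \<open>m\<close>-th root of \<open>t\<close> is required.\<close>
  have "\<exists>s. s ^ m = t" using P.m_pos by (rule nth_root_exists)
  then obtain s where s: "s ^ m = t" ..
  have s0: "s \<noteq> 0" using s t P.m_pos by (auto simp: power_0_left)
  define \<eta> where "\<eta> x = \<xi> (P.twist (inverse s) x)" for x
  have \<eta>: "\<eta> \<in> P.dual"
    unfolding P.dual_def \<eta>_def
    by (simp add: P.twist_add P.twist_scale P.twist_L P.contr.dual_add[OF \<xi>(1)] P.contr.dual_scale[OF \<xi>(1)])
  have id: "\<eta> (br (P.twist s x) (P.twist s y)) = f x y + t * g x y" if "x \<in> L" "y \<in> L" for x y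
  proof -
    have "\<xi> (P.br0 x y + mat_scale t (br x y - P.br0 x y)) = f x y + t * g x y"
      using that by (simp add: f_def g_def P.br_closed P.br0_closed subd mat.subspace_scale[OF sub]
        P.contr.dual_add[OF \<xi>(1)] P.contr.dual_scale[OF \<xi>(1)])
    then show ?thesis using P.twisted_bracket[OF that s0] by (simp add: \<eta>_def s)
  qed
  have is0: "inverse s \<noteq> 0" using s0 by simp
  have tt: "P.twist s (P.twist (inverse s) x) = x" if "x \<in> L" for x
    using P.twist_twist[OF that is0] by simp
  have "P.index \<le> mat.dim (P.stabiliser \<eta>)" by (rule P.index_le[OF \<eta>])
  also have "\<dots> \<le> mat.dim {x \<in> L. \<forall>y\<in>L. f x y + t * g x y = 0}"
  proof (rule mat.dim_le_injective[OF P.stabiliser_subspace[OF \<eta>], of "P.twist (inverse s)"])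
    fix x assume x: "x \<in> P.stabiliser \<eta>"
    then have xL: "x \<in> L" by (simp add: P.stabiliser_eq)
    have "f (P.twist (inverse s) x) y + t * g (P.twist (inverse s) x) y = 0" if y: "y \<in> L" for y
    proof -
      have "\<eta> (br x (P.twist s y)) = 0" using x P.twist_L[OF y, of s] by (simp add: P.stabiliser_eq)
      then show ?thesis using id[OF P.twist_L[OF xL, of "inverse s"] y] by (simp add: tt[OF xL])
    qed
    then show "P.twist (inverse s) x \<in> {x \<in> L. \<forall>y\<in>L. f x y + t * g x y = 0}"
      using xL by (simp add: P.twist_L)
    show "P.twist (inverse s) (mat_scale c x) = mat_scale c (P.twist (inverse s) x)" for c
      using xL by (rule P.twist_scale)
    show "x = 0" if "P.twist (inverse s) x = 0"
      using tt[OF xL] that P.twist_scale[of 0 s 0] mat.subspace_0[OF sub] by simp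
    show "P.twist (inverse s) (x + y) = P.twist (inverse s) x + P.twist (inverse s) y"
      if "y \<in> P.stabiliser \<eta>" for y using xL that by (intro P.twist_add) (simp_all add: P.stabiliser_eq)
  qed
  also have "\<dots> \<le> mat.dim {x \<in> L. \<forall>y\<in>L. f x y = 0}" using t by simp
  also have "\<dots> = P.contr.index" using \<xi>(2) by (simp add: P.contr.stabiliser_eq f_def)
  finally show ?thesis .
qed

section \<open>The lower bound by odd powers\<close>

primrec mpow :: "'k::comm_ring_1 ^ 'n::finite ^ 'n \<Rightarrow> nat \<Rightarrow> 'k ^ 'n ^ 'n" where
  "mpow A 0 = mat 1"
| "mpow A (Suc k) = A ** mpow A k"

lemma mpow_commute: "A ** mpow A k = mpow A k ** A"
  by (induction k) (simp_all add: matrix_mul_assoc)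

lemma mpow_om:
  assumes "A \<in> sp_algebra" shows "om (mpow A k *v v) w = (- 1) ^ k * om v (mpow A k *v w)"
proof (induction k arbitrary: v w)
  case (Suc k)
  have "om (mpow A (Suc k) *v v) w = - om (mpow A k *v v) (A *v w)"
    by (simp add: matrix_vector_mul_assoc[symmetric] spD[OF assms])
  also have "\<dots> = (- 1) ^ Suc k * om v (mpow A (Suc k) *v w)"
    by (simp add: Suc.IH matrix_vector_mul_assoc mpow_commute)
  finally show ?case .
qed simp

lemma mpow_sp: "A \<in> sp_algebra \<Longrightarrow> odd k \<Longrightarrow> mpow A k \<in> sp_algebra"
  by (simp add: sp_iff_om mpow_om)

definition diag :: "('n \<Rightarrow> 'k::comm_ring_1) \<Rightarrow> 'k ^ 'n ^ 'n::finite" where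
  "diag d = (\<chi> i j. if i = j then d i else 0)"

lemma diag_mv: "(diag d *v v) $ i = d i * v $ i"
  by (simp add: diag_def matrix_vector_mult_def if_distrib[of "\<lambda>x. x * _"] cong: if_cong)

lemma mpow_diag: "mpow (diag d) k = diag (\<lambda>i. d i ^ k)"
proof (induction k)
  case 0
  show ?case by (simp add: diag_def mat_def)
next
  case (Suc k)
  have "diag d ** diag (\<lambda>i. d i ^ k) = diag (\<lambda>i. d i ^ Suc k)"
    by (simp add: matrix_eq vec_eq_iff diag_mv matrix_vector_mul_assoc[symmetric] mult.assoc)
  then show ?case using Suc.IH by simp
qed

text \<open>The entries of the powers of \<open>D + s A\<close> are polynomials in \<open>s\<close>,
  which gives access to the genericity of independent rows.\<close>

lemma mpow_poly:
  "poly (mpow (\<chi> p q. [:D $ p $ q, A $ p $ q:]) k $ p $ q) s = mpow (D + mat_scale s A) k $ p $ q"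
proof (induction k arbitrary: p q)
  case (Suc k)
  then show ?case by (simp add: matrix_matrix_mult_def poly_sum mat_scale_def algebra_simps)
qed (simp add: mat_def)

lemma trace_commutator: "trace (A ** commutator X Y) = trace (commutator A X ** (Y :: 'k::comm_ring_1 ^ 'n::finite ^ 'n))"
proof -
  have "trace (A ** (Y ** X)) = trace (X ** (A ** Y))"
    by (simp only: matrix_mul_assoc trace_mul_sym[of "A ** Y" X])
  then show ?thesis
    by (simp add: commutator_def mat_mul_diff_left mat_mul_diff_right trace_sub matrix_mul_assoc)
qed

lemma minus_mv: "(- A) *v x = - ((A :: 'k::comm_ring_1 ^ 'n ^ 'm) *v x)"
  by (simp add: vec_eq_iff matrix_vector_mult_def sum_negf)

lemma form_square: "symplectic_form ** symplectic_form = - (mat 1 :: 'k::comm_ring_1 ^ ('n::finite + 'n) ^ ('n + 'n))"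
proof -
  have "((symplectic_form :: 'k ^ ('n + 'n) ^ ('n + 'n)) *v w) $ p = index_sign p * w $ swap_index p" for w p
    by (simp add: matrix_vector_mult_def symplectic_form_entry if_distrib[of "\<lambda>x. x * _"] cong: if_cong)
  then have "(symplectic_form ** symplectic_form) *v w = (- (mat 1 :: 'k ^ ('n + 'n) ^ ('n + 'n))) *v w" for w
    unfolding matrix_vector_mul_assoc[symmetric]
    by (simp add: vec_eq_iff mult.assoc[symmetric] minus_mv)
  then show ?thesis by (simp add: matrix_eq)
qed

lemma form_transpose: "transpose symplectic_form = - (symplectic_form :: 'k::comm_ring_1 ^ ('n::finite + 'n) ^ ('n + 'n))"
  by (simp add: vec_eq_iff transpose_def symplectic_form_entry swap_eq_iff)

lemma trace_transpose: "trace (transpose A) = trace A"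
  by (simp add: trace_def transpose_def)

text \<open>The Lie algebra is the fixed space of the involution \<open>\<tau>\<close>, which is
  self-adjoint for the trace form. So \<open>\<xi>\<close> extends along the projection
  \<open>\<pi>\<close>, the extension is given by a matrix \<open>A\<close>, and \<open>A\<close>
  may be replaced by \<open>\<pi> A\<close>.\<close>

lemma dual_trace:
  fixes \<xi> :: "'k::field_char_0 ^ ('n::finite + 'n) ^ ('n + 'n) \<Rightarrow> 'k"
  assumes \<xi>: "\<xi> \<in> sp.dual"
  obtains A where "A \<in> sp_algebra" "\<And>X. X \<in> sp_algebra \<Longrightarrow> \<xi> X = trace (A ** X)"
proof -
  let ?J = "symplectic_form :: 'k ^ ('n + 'n) ^ ('n + 'n)"
  define \<tau> where "\<tau> Y = ?J ** transpose Y ** ?J" for Y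
  define \<pi> where "\<pi> Y = mat_scale (1 / 2) (Y + \<tau> Y)" for Y
  have JJ: "?J ** (?J ** Y) = - Y" for Y :: "'k ^ ('n + 'n) ^ ('n + 'n)"
    by (simp add: matrix_mul_assoc form_square mat_mul_minus)
  have JJ': "Y ** ?J ** ?J = - Y" for Y :: "'k ^ ('n + 'n) ^ ('n + 'n)"
    by (simp add: matrix_mul_assoc[symmetric] form_square mat_mul_minus)
  have \<pi>sp: "\<pi> Y \<in> sp_algebra" for Y
  proof -
    have "transpose (\<tau> Y) ** ?J = - (?J ** Y)"
      by (simp add: \<tau>_def matrix_transpose_mul form_transpose mat_mul_minus transpose_transpose matrix_mul_assoc JJ')
    moreover have "?J ** \<tau> Y = - (transpose Y ** ?J)"
      unfolding \<tau>_def by (simp add: matrix_mul_assoc[symmetric] JJ)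
    ultimately show ?thesis
      by (simp add: \<pi>_def sp_algebra_iff transpose_linear mat_mul_scale_left mat_mul_scale_right mat_mul_add_left
        matrix_add_ldistrib) (simp add: mat_scale_def vec_eq_iff)
  qed
  have \<pi>id: "\<pi> X = X" if "X \<in> sp_algebra" for X
  proof -
    have "transpose X ** ?J = - (?J ** X)" using that by (simp add: sp_algebra_iff)
    then have "\<tau> X = X" by (simp add: \<tau>_def matrix_mul_assoc[symmetric] mat_mul_minus JJ)
    then show ?thesis by (simp add: \<pi>_def mat_scale_def vec_eq_iff)
  qed
  have \<pi>lin: "\<pi> (X + Y) = \<pi> X + \<pi> Y" "\<pi> (mat_scale c X) = mat_scale c (\<pi> X)" for X Y c
    by (simp_all add: \<pi>_def \<tau>_def transpose_linear mat_mul_add_left matrix_add_ldistrib mat_mul_scale_left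
        mat_mul_scale_right mat_scale_add[symmetric] add_ac)
  have \<pi>sum: "\<pi> (\<Sum>z\<in>Z. mat_scale (f z) (u z)) = (\<Sum>z\<in>Z. mat_scale (f z) (\<pi> (u z)))" if "finite Z" for Z f u
    using that
  proof (induction Z rule: finite_induct)
    case empty
    show ?case using \<pi>lin(2)[of 0 0] by simp
  qed (simp add: \<pi>lin)
  define A where "A = (\<chi> q p. \<xi> (\<pi> (mat_unit p q)))"
  have 1: "\<xi> X = trace (A ** X)" if X: "X \<in> sp_algebra" for X
  proof -
    have "X = (\<Sum>z\<in>UNIV. mat_scale (X $ fst z $ snd z) (mat_unit (fst z) (snd z)))"
      unfolding mat_unit_sum by (simp add: vec_eq_iff)
    then have "\<pi> X = \<pi> (\<Sum>z\<in>UNIV. mat_scale (X $ fst z $ snd z) (mat_unit (fst z) (snd z)))" by (rule arg_cong)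
    also have "\<dots> = (\<Sum>z\<in>UNIV. mat_scale (X $ fst z $ snd z) (\<pi> (mat_unit (fst z) (snd z))))"
      by (rule \<pi>sum) simp
    finally have "\<pi> X = (\<Sum>z\<in>UNIV. mat_scale (X $ fst z $ snd z) (\<pi> (mat_unit (fst z) (snd z))))" .
    then have "\<xi> X = \<xi> (\<Sum>z\<in>UNIV. mat_scale (X $ fst z $ snd z) (\<pi> (mat_unit (fst z) (snd z))))"
      using \<pi>id[OF X] by simp
    also have "\<dots> = (\<Sum>z\<in>UNIV. \<xi> (mat_scale (X $ fst z $ snd z) (\<pi> (mat_unit (fst z) (snd z)))))"
      by (rule sp.dual_sum[OF \<xi>]) (rule mat.subspace_scale[OF sp.subspace_L \<pi>sp])
    also have "\<dots> = (\<Sum>z\<in>UNIV. A $ snd z $ fst z * X $ fst z $ snd z)"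
      by (simp add: sp.dual_scale[OF \<xi> \<pi>sp] A_def mult.commute)
    also have "\<dots> = (\<Sum>p\<in>UNIV. \<Sum>q\<in>UNIV. A $ q $ p * X $ p $ q)"
      by (simp add: sum.cartesian_product UNIV_Times_UNIV[symmetric] case_prod_beta del: UNIV_Times_UNIV)
    also have "\<dots> = trace (A ** X)"
      unfolding trace_def matrix_matrix_mult_def by (subst sum.swap) simp
    finally show ?thesis .
  qed
  have 2: "trace (\<tau> A ** X) = trace (A ** \<tau> X)" for X
  proof -
    have "trace (\<tau> A ** X) = trace (?J ** (transpose A ** (?J ** X)))"
      by (simp add: \<tau>_def matrix_mul_assoc)
    also have "\<dots> = trace (transpose A ** (?J ** X) ** ?J)" by (rule trace_mul_sym)
    also have "\<dots> = trace (transpose (transpose A ** (?J ** X) ** ?J))" by (rule trace_transpose[symmetric])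
    also have "\<dots> = trace (\<tau> X ** A)"
      by (simp add: \<tau>_def matrix_transpose_mul form_transpose mat_mul_minus transpose_transpose matrix_mul_assoc)
    also have "\<dots> = trace (A ** \<tau> X)" by (rule trace_mul_sym)
    finally show ?thesis .
  qed
  have tr: "trace (mat_scale c M) = c * trace M" for c and M :: "'k ^ ('n + 'n) ^ ('n + 'n)"
    by (simp add: trace_def mat_scale_def sum_distrib_left)
  have "trace (\<pi> A ** X) = trace (A ** X)" if X: "X \<in> sp_algebra" for X
  proof -
    have "trace (\<pi> A ** X) = trace (A ** \<pi> X)"
      using 2[of X] by (simp add: \<pi>_def mat_mul_scale_left mat_mul_scale_right mat_mul_add_left matrix_add_ldistrib tr trace_add)
    then show ?thesis using \<pi>id[OF X] by simp
  qed
  then show ?thesis by (intro that[OF \<pi>sp, of A]) (simp add: 1)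
qed

text \<open>Nothing is known about the odd powers of the matrix \<open>A\<close> of a form that
  attains the index. Adding a generic multiple of a diagonal matrix makes them independent without
  enlarging the stabiliser.\<close>

lemma index_sp_ge:
  "CARD('n) \<le> lie_algebra.index mat_scale (sp_algebra :: ('k::field_char_0 ^ ('n::finite + 'n) ^ ('n + 'n)) set) commutator"
proof -
  let ?sp = "sp_algebra :: ('k ^ ('n + 'n) ^ ('n + 'n)) set"
  obtain \<xi> :: "'k ^ ('n + 'n) ^ ('n + 'n) \<Rightarrow> 'k" where \<xi>: "\<xi> \<in> sp.dual" "lie_algebra.index mat_scale ?sp commutator = mat.dim (sp.stabiliser \<xi>)"
    by (rule sp.index_attained)
  obtain A where A: "A \<in> ?sp" "\<And>X. X \<in> ?sp \<Longrightarrow> \<xi> X = trace (A ** X)" using dual_trace[OF \<xi>(1)] by blast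
  obtain e :: "'n \<Rightarrow> nat" where e: "inj e" using finite_imp_inj_to_nat_seg[of "UNIV :: 'n set"] by auto
  \<comment> \<open>Distinct positive integers, so that also their squares, the nodes of the
    Vandermonde argument, are distinct.\<close>
  define x :: "'n \<Rightarrow> 'k" where "x a = of_nat (Suc (e a))" for a
  define d :: "'n + 'n \<Rightarrow> 'k" where "d p = (case p of Inl a \<Rightarrow> x a | Inr a \<Rightarrow> - x a)" for p
  have ds: "d (swap_index p) = - d p" for p by (cases p) (simp_all add: d_def)
  have Dsp: "diag d \<in> ?sp" unfolding sp_iff_om
    by (simp add: om_def diag_mv ds sum_negf[symmetric] mult_ac)
  define M where "M s = diag d + mat_scale s A" for s
  define pm where "pm i j = (\<lambda>(p, q). mpow (\<chi> p q. [:diag d $ p $ q, A $ p $ q:]) (2 * i + 1) $ p $ q) j" for i j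
  \<comment> \<open>At \<open>s = 0\<close> the odd powers of \<open>diag d\<close> are independent by Vandermonde.\<close>
  have fin2: "finite {s. \<exists>c. (\<forall>j\<in>UNIV. (\<Sum>i<CARD('n). c i * poly (pm i j) s) = 0) \<and> (\<exists>i\<in>{..<CARD('n)}. c i \<noteq> 0)}"
  proof (rule finite_nonindependent_rows)
    fix c assume c: "\<forall>j\<in>UNIV. (\<Sum>i<CARD('n). c i * poly (pm i j) 0) = 0"
    define P where "P = (\<Sum>i<CARD('n). monom (c i) i)"
    have P0: "poly P (x a ^ 2) = 0" for a
    proof -
      have "mat_scale 0 A = 0" by (simp add: mat_scale_def vec_eq_iff)
      then have "(\<Sum>i<CARD('n). c i * diag (\<lambda>i'. d i' ^ (2 * i + 1)) $ Inl a $ Inl a) = 0"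
        using bspec[OF c, of "(Inl a, Inl a)"] by (simp only: pm_def case_prod_conv mpow_poly UNIV_I mpow_diag add_0_right)
      then have "(\<Sum>i<CARD('n). x a * (c i * (x a ^ 2) ^ i)) = 0"
        by (simp add: diag_def d_def power_mult[symmetric] mult_ac)
      then have "x a * poly P (x a ^ 2) = 0" by (simp add: P_def poly_sum poly_monom sum_distrib_left)
      then show ?thesis by (simp add: x_def del: of_nat_Suc)
    qed
    have "P = 0"
    proof (rule ccontr)
      assume P: "P \<noteq> 0"
      have "inj (\<lambda>a. x a ^ 2)"
      proof (rule injI)
        fix a b assume "x a ^ 2 = x b ^ 2"
        then have "Suc (e a) ^ 2 = Suc (e b) ^ 2" unfolding x_def of_nat_power[symmetric] of_nat_eq_iff .
        then have "Suc (e a) = Suc (e b)" by (rule power_eq_imp_eq_base) simp_all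
        then show "a = b" using e by (simp add: inj_def)
      qed
      then have "CARD('n) = card (range (\<lambda>a. x a ^ 2))" by (simp add: card_image)
      also have "\<dots> \<le> card {y. poly P y = 0}" using P0 poly_roots_finite[OF P] by (intro card_mono) auto
      also have "\<dots> \<le> degree P" by (rule card_poly_roots_bound[OF P])
      also have "degree P < CARD('n)"
      proof -
        have "degree P \<le> CARD('n) - 1" unfolding P_def
          by (rule degree_sum_le) (auto intro: order_trans[OF degree_monom_le])
        then show ?thesis using zero_less_card_finite[where 'a = 'n] by linarith
      qed
      finally show False by simp
    qed
    then have "coeff P i = 0" for i by simp
    then have 0: "(if i < CARD('n) then c i else 0) = 0" for i by (simp add: P_def coeff_sum coeff_monom)
    show "\<forall>i\<in>{..<CARD('n)}. c i = 0"
    proof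
      fix i assume "i \<in> {..<CARD('n)}"
      then show "c i = 0" using 0[of i] by simp
    qed
  qed simp
  define f where "f X Y = trace (A ** commutator X Y)" for X Y
  define g where "g X Y = trace (diag d ** commutator X Y)" for X Y
  have tr: "trace (mat_scale c M) = c * trace M" for c and M :: "'k ^ ('n + 'n) ^ ('n + 'n)"
    by (simp add: trace_def mat_scale_def sum_distrib_left)
  have fin1: "finite {t. mat.dim {X \<in> ?sp. \<forall>Y\<in>?sp. f X Y + t * g X Y = 0} > mat.dim {X \<in> ?sp. \<forall>Y\<in>?sp. f X Y = 0}}"
  proof (rule mat.radical_dim_generic[OF sp.subspace_L])
  qed (simp_all add: f_def g_def sp.br_add_left sp.br_scale_left matrix_add_ldistrib mat_mul_scale_right trace_add tr)
  \<comment> \<open>\<open>A + t D\<close> has no larger stabiliser than \<open>A\<close> for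
    generic \<open>t\<close>, and its multiple \<open>D + inverse t A\<close> has independent odd
    powers for generic \<open>inverse t\<close>.\<close>
  obtain t where t: "t \<notin> {t. mat.dim {X \<in> ?sp. \<forall>Y\<in>?sp. f X Y + t * g X Y = 0} > mat.dim {X \<in> ?sp. \<forall>Y\<in>?sp. f X Y = 0}}"
    "t \<noteq> 0" and s: "inverse t \<notin> {s. \<exists>c. (\<forall>j\<in>UNIV. (\<Sum>i<CARD('n). c i * poly (pm i j) s) = 0) \<and> (\<exists>i\<in>{..<CARD('n)}. c i \<noteq> 0)}"
    by (rule avoid_finite_sets[OF fin1 fin2])
  let ?M = "M (inverse t)"
  have Msp: "?M \<in> ?sp" unfolding M_def
    by (intro mat.subspace_add[OF sp.subspace_L] mat.subspace_scale[OF sp.subspace_L] Dsp A)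
  have "card {..<CARD('n)} \<le> mat.dim {X \<in> ?sp. \<forall>Y\<in>?sp. f X Y + t * g X Y = 0}"
  proof (rule mat.independent_family_card[of _ "\<lambda>i. mpow ?M (2 * i + 1)"])
    fix i
    have "f (mpow ?M (2 * i + 1)) Y + t * g (mpow ?M (2 * i + 1)) Y = 0" for Y
    proof -
      have "mat_scale t ?M = A + mat_scale t (diag d)"
        using t(2) by (simp add: M_def mat_scale_def vec_eq_iff algebra_simps)
      then have "f (mpow ?M (2 * i + 1)) Y + t * g (mpow ?M (2 * i + 1)) Y
          = trace (mat_scale t ?M ** commutator (mpow ?M (2 * i + 1)) Y)"
        by (simp only: f_def g_def mat_mul_add_left trace_add mat_mul_scale_left tr)
      also have "\<dots> = t * trace (commutator ?M (mpow ?M (2 * i + 1)) ** Y)"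
        by (simp only: mat_mul_scale_left tr trace_commutator)
      also have "commutator ?M (mpow ?M (2 * i + 1)) = 0"
        unfolding commutator_def by (simp only: mpow_commute diff_self)
      finally show ?thesis by (simp add: trace_def)
    qed
    then show "mpow ?M (2 * i + 1) \<in> {X \<in> ?sp. \<forall>Y\<in>?sp. f X Y + t * g X Y = 0}"
      using mpow_sp[OF Msp, of "2 * i + 1"] by simp
  next
    fix c i assume c: "(\<Sum>i<CARD('n). mat_scale (c i) (mpow ?M (2 * i + 1))) = 0" and i: "i \<in> {..<CARD('n)}"
    have "(\<Sum>i<CARD('n). c i * poly (pm i j) (inverse t)) = 0" for j
    proof -
      have "(\<Sum>i<CARD('n). mat_scale (c i) (mpow ?M (2 * i + 1))) $ fst j $ snd j = 0" using c by simp
      then show ?thesis by (simp only: pm_def case_prod_beta mpow_poly M_def[symmetric]) (simp add: mat_scale_def)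
    qed
    then show "c i = 0" using s i by blast
  qed simp
  also have "\<dots> \<le> mat.dim {X \<in> ?sp. \<forall>Y\<in>?sp. f X Y = 0}" using t(1) by simp
  also have "{X \<in> ?sp. \<forall>Y\<in>?sp. f X Y = 0} = sp.stabiliser \<xi>"
    by (auto simp: sp.stabiliser_eq f_def A(2) commutator_sp)
  finally show ?thesis using \<xi>(2) by simp
qed

section \<open>The upper bound in a basis of eigenvectors\<close>

lemma primitive_root_power_inj:
  fixes \<zeta> :: "'k::field_char_0"
  assumes "primitive_root \<zeta> m" "i < m" "j < m" "\<zeta> ^ i = \<zeta> ^ j" shows "i = j"
proof (rule ccontr)
  assume ne: "i \<noteq> j"
  have nz: "\<zeta> \<noteq> 0" using primitive_root_nz[OF assms(1)] .
  have "inverse (\<zeta> ^ (j * k)) * \<zeta> ^ (i * k) = 1" for k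
    using nz assms(4) by (simp add: power_mult)
  then have "(\<Sum>k<m. inverse (\<zeta> ^ (j * k)) * \<zeta> ^ (i * k)) = of_nat m" by simp
  then show False using primitive_root_sum[OF assms(1-3)] ne assms(2) by simp
qed

lemma primitive_root_powi:
  fixes \<zeta> :: "'k::field_char_0"
  assumes "primitive_root \<zeta> m" shows "\<zeta> powi k = \<zeta> ^ nat (k mod int m)"
proof -
  have nz: "\<zeta> \<noteq> 0" and m: "0 < m" "\<zeta> ^ m = 1" using primitive_root_nz[OF assms] assms by (auto simp: primitive_root_def)
  have "\<zeta> powi k = \<zeta> powi (int m * (k div int m) + k mod int m)" by simp
  also have "\<dots> = \<zeta> powi (k mod int m)" using nz m(2) by (subst power_int_add) (simp_all add: power_int_mult)
  also have "\<dots> = \<zeta> ^ nat (k mod int m)" using m(1) by (simp add: power_int_def)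
  finally show ?thesis .
qed

text \<open>The matrix with columns \<open>g p\<close> preserves the form, so it is invertible;
  pairing with the dual vectors gives the coefficients.\<close>

lemma symplectic_basis_expand:
  fixes g :: "'n::finite + 'n \<Rightarrow> 'k::field_char_0 ^ ('n + 'n)"
  assumes g: "\<And>p q. om (g p) (g q) = (if q = swap_index p then index_sign p else 0)"
  shows "v = (\<Sum>p\<in>UNIV. (index_sign p * om v (g (swap_index p))) *s g p)"
proof -
  define G :: "'k ^ ('n + 'n) ^ ('n + 'n)" where "G = (\<chi> i j. g j $ i)"
  have G: "G *v x = (\<Sum>j\<in>UNIV. x $ j *s g j)" for x
    by (simp add: G_def vec_eq_iff matrix_vector_mult_def sum_component mult.commute)
  have "om (G *v x) (G *v y) = om x y" for x y
  proof -
    have "om (G *v x) (G *v y) = (\<Sum>p\<in>UNIV. \<Sum>q\<in>UNIV. x $ p * y $ q * om (g p) (g q))"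
      unfolding G om_sum_left unfolding om_sum_right by (simp add: mult_ac)
    also have "\<dots> = (\<Sum>p\<in>UNIV. \<Sum>q\<in>UNIV. if q = swap_index p then index_sign p * x $ p * y $ swap_index p else 0)"
      by (intro sum.cong refl) (simp add: g)
    finally show ?thesis by (simp add: om_def)
  qed
  then have "symp G" by (simp add: symp_def)
  then obtain G' where "G ** G' = mat 1" using symp_inverse by blast
  then have "v = G *v (G' *v v)" by (simp add: matrix_vector_mul_assoc)
  then obtain c where c: "v = (\<Sum>j\<in>UNIV. c $ j *s g j)" using G by metis
  have "index_sign p * om v (g (swap_index p)) = c $ p" for p
  proof -
    have "om v (g (swap_index p)) = (\<Sum>j\<in>UNIV. if j = p then c $ p * index_sign p else 0)"
      unfolding c om_sum_left by (intro sum.cong refl) (auto simp: g swap_eq_iff)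
    then show ?thesis by (simp add: mult_ac)
  qed
  then show ?thesis using c by simp
qed

text \<open>\<open>Phi\<close> without the factor \<open>kap\<close>: up to the factor
  \<open>- 2\<close>, the form evaluated at the original bracket.\<close>

definition triple :: "('n::finite + 'n \<Rightarrow> 'n + 'n \<Rightarrow> 'k::comm_ring_1) \<Rightarrow> ('n + 'n \<Rightarrow> 'n + 'n \<Rightarrow> 'k)
    \<Rightarrow> ('n + 'n \<Rightarrow> 'n + 'n \<Rightarrow> 'k) \<Rightarrow> 'k" where
  "triple \<xi> x y = (\<Sum>p\<in>UNIV. \<Sum>q\<in>UNIV. \<xi> p q * (\<Sum>r\<in>UNIV. index_sign r * x p r * y (swap_index r) q))"

lemma triple_skew:
  assumes "\<And>p q. \<xi> p q = \<xi> q p" "\<And>p q. x p q = x q p" "\<And>p q. y p q = y q p"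
  shows "triple \<xi> y x = - triple \<xi> x y"
proof -
  have "(\<Sum>r\<in>UNIV. index_sign r * y p r * x (swap_index r) q)
      = - (\<Sum>r\<in>UNIV. index_sign r * x q r * y (swap_index r) p)" for p q
  proof -
    have "(\<Sum>r\<in>UNIV. index_sign r * y p r * x (swap_index r) q)
        = (\<Sum>r\<in>UNIV. index_sign (swap_index r) * y p (swap_index r) * x (swap_index (swap_index r)) q)"
      by (rule sum.reindex_bij_betw[OF bij_swap, symmetric])
    also have "\<dots> = (\<Sum>r\<in>UNIV. - (index_sign r * x q r * y (swap_index r) p))"
      using assms(2)[of q] assms(3)[of p] by (intro sum.cong refl) simp
    finally show ?thesis by (simp add: sum_negf)
  qed
  then have "triple \<xi> y x = (\<Sum>p\<in>UNIV. \<Sum>q\<in>UNIV. - (\<xi> q p * (\<Sum>r\<in>UNIV. index_sign r * x q r * y (swap_index r) p)))"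
    unfolding triple_def using assms(1) by (intro sum.cong refl) simp
  also have "\<dots> = - triple \<xi> x y" unfolding triple_def by (subst sum.swap) (simp add: sum_negf)
  finally show ?thesis .
qed

lemma triple_expand:
  "triple \<xi> x y = (\<Sum>r\<in>UNIV. \<Sum>q\<in>UNIV. \<Sum>p\<in>UNIV. \<xi> p q * (index_sign r * x p r * y (swap_index r) q))"
proof -
  have "triple \<xi> x y = (\<Sum>p\<in>UNIV. \<Sum>q\<in>UNIV. \<Sum>r\<in>UNIV. \<xi> p q * (index_sign r * x p r * y (swap_index r) q))"
    by (simp add: triple_def sum_distrib_left)
  also have "\<dots> = (\<Sum>q\<in>UNIV. \<Sum>p\<in>UNIV. \<Sum>r\<in>UNIV. \<xi> p q * (index_sign r * x p r * y (swap_index r) q))"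
    by (rule sum.swap)
  also have "\<dots> = (\<Sum>q\<in>UNIV. \<Sum>r\<in>UNIV. \<Sum>p\<in>UNIV. \<xi> p q * (index_sign r * x p r * y (swap_index r) q))"
    by (intro sum.cong refl sum.swap)
  also have "\<dots> = (\<Sum>r\<in>UNIV. \<Sum>q\<in>UNIV. \<Sum>p\<in>UNIV. \<xi> p q * (index_sign r * x p r * y (swap_index r) q))"
    by (rule sum.swap)
  finally show ?thesis .
qed

text \<open>In coordinates the stabiliser of \<open>Xi\<close> becomes part of
  \<open>kern UNIV \<xi>\<close>, where zeros at the entries of \<open>Z\<close> force everything to
  vanish.\<close>

lemma index_contraction_le:
  fixes \<theta> :: "'k::{alg_closed_field, field_char_0} ^ ('n::finite + 'n) ^ ('n + 'n)
      \<Rightarrow> 'k ^ ('n + 'n) ^ ('n + 'n)"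
  assumes \<theta>: "sp.automorphism \<theta>" "sp.has_order \<theta> m" and m: "odd m" and \<zeta>: "primitive_root \<zeta> m"
  shows "lie_algebra.index mat_scale (sp_algebra :: ('k ^ ('n + 'n) ^ ('n + 'n)) set)
        (sp.contraction \<theta> m \<zeta>) \<le> CARD('n)"
proof -
  let ?sp = "sp_algebra :: ('k ^ ('n + 'n) ^ ('n + 'n)) set"
  interpret P: periodic_lie_algebra mat_scale ?sp commutator \<theta> m \<zeta>
    by unfold_locales (fact \<theta> \<zeta>)+
  have per: "(\<theta> ^^ m) X = X" if "X \<in> ?sp" for X using \<theta>(2) that by (simp add: sp.has_order_def)
  obtain S where S: "symp S" "\<And>X v. X \<in> ?sp \<Longrightarrow> \<theta> X *v (S *v v) = S *v (X *v v)"
    "\<And>v. (((*v) S) ^^ m) v = v"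
    using periodic_automorphism_inner[OF \<theta>(1) per m] by blast
  obtain g :: "'n + 'n \<Rightarrow> 'k ^ ('n + 'n)" and a where
    g: "\<And>p q. om (g p) (g q) = (if q = swap_index p then index_sign p else 0)"
    and a: "\<And>p. S *v g p = \<zeta> powi a p *s g p" "\<And>p. a (swap_index p) = - a p" "\<And>p. 2 * \<bar>a p\<bar> < int m"
    using symplectic_eigenbasis[OF S(1,3) \<zeta> m] by blast
  interpret L: symplectic_levels "swap_index :: 'n + 'n \<Rightarrow> 'n + 'n" "index_sign :: 'n + 'n \<Rightarrow> 'k" a
    by unfold_locales (simp_all add: swap_neq a(2))
  have m0: "0 < m" using P.m_pos .
  have nz: "\<zeta> \<noteq> 0" using primitive_root_nz[OF \<zeta>] .
  have "L.half_rigid UNIV" by (rule L.half_rigid_star_closed) simp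
  then obtain \<xi> Z where \<xi>: "\<xi> \<in> L.symm UNIV" and Z: "finite Z" "2 * card Z \<le> CARD('n + 'n)"
    and k: "L.rigid UNIV \<xi> Z"
    unfolding L.half_rigid_def by blast
  \<comment> \<open>The symmetric matrix of \<open>X\<close> as an element of
    \<open>S\<^sup>2V\<close> in the basis \<open>g\<close>, up to signs; see
    \<open>A_qm\<close>.\<close>
  define A where "A X p q = om (X *v g (swap_index p)) (g (swap_index q))" for X :: "'k ^ ('n + 'n) ^ ('n + 'n)" and p q
  have A_add: "A (X + Y) p q = A X p q + A Y p q" for X Y p q
    by (simp add: A_def matrix_vector_mult_add_rdistrib om_add_left)
  have A_scale: "A (mat_scale c X) p q = c * A X p q" for c X p q by (simp add: A_def mat_scale_mv)
  have A_zero: "A 0 p q = 0" for p q using A_scale[of 0 0] by simp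
  have A_sum: "A (\<Sum>i\<in>I. f i) p q = (\<Sum>i\<in>I. A (f i) p q)" for I and f :: "nat \<Rightarrow> _" and p q
    by (induction I rule: infinite_finite_induct) (simp_all add: A_add A_zero)
  have A_sym: "A X p q = A X q p" if "X \<in> ?sp" for X p q
    unfolding A_def using spD[OF that, of "g (swap_index p)" "g (swap_index q)"] om_skew[of "g (swap_index p)"] by simp
  have A_symm: "A X \<in> L.symm UNIV" if "X \<in> ?sp" for X
    using A_sym[OF that] by (auto simp: L.symm_def)
  have A_inj: "X = 0" if "A X = (\<lambda>_ _. 0)" for X
  proof -
    have "om (X *v g p) (g q) = 0" for p q
      using fun_cong[OF fun_cong[OF that, of "swap_index p"], of "swap_index q"] by (simp add: A_def)
    then have "X *v g p = 0" for p using symplectic_basis_expand[OF g, of "X *v g p"] by simp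
    then have "X *v v = 0" for v
      by (subst symplectic_basis_expand[OF g, of v]) (simp add: mv_sum mv_scale)
    then show ?thesis by (simp add: matrix_eq)
  qed
  have A_br: "A (commutator X Y) p q = (\<Sum>r\<in>UNIV. index_sign r * A Y p r * A X (swap_index r) q)
      - (\<Sum>r\<in>UNIV. index_sign r * A X p r * A Y (swap_index r) q)"
    if XY: "X \<in> ?sp" "Y \<in> ?sp" for X Y p q
  proof -
    have e: "om (X *v v) (Y *v w) = - (\<Sum>r\<in>UNIV. index_sign r * om (X *v v) (g (swap_index r)) * om (Y *v g r) w)"
      if "Y \<in> ?sp" for X Y v w
    proof -
      have "om (X *v v) (Y *v w) = (\<Sum>r\<in>UNIV. index_sign r * om (X *v v) (g (swap_index r)) * om (g r) (Y *v w))"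
        by (subst symplectic_basis_expand[OF g, of "X *v v"]) (simp add: om_sum_left)
      then show ?thesis using spD[OF that] by (simp add: sum_negf)
    qed
    have "A (commutator X Y) p q = om (X *v g (swap_index p)) (Y *v g (swap_index q)) - om (Y *v g (swap_index p)) (X *v g (swap_index q))"
      by (simp add: A_def commutator_mv om_diff_left spD[OF XY(1)] spD[OF XY(2)])
    then show ?thesis by (simp add: e XY A_def)
  qed
  define Xi where "Xi X = (\<Sum>p\<in>UNIV. \<Sum>q\<in>UNIV. \<xi> p q * A X p q)" for X
  have Xi_add: "Xi (X + Y) = Xi X + Xi Y" for X Y by (simp add: Xi_def A_add algebra_simps sum.distrib)
  have Xi_scale: "Xi (mat_scale c X) = c * Xi X" for c X by (simp add: Xi_def A_scale algebra_simps sum_distrib_left)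
  have Xi_dual: "Xi \<in> P.contr.dual" by (simp add: P.contr.dual_def Xi_add Xi_scale)
  have Xi_br: "Xi (commutator X Y) = - 2 * triple \<xi> (A X) (A Y)" if XY: "X \<in> ?sp" "Y \<in> ?sp" for X Y
  proof -
    have "Xi (commutator X Y) = triple \<xi> (A Y) (A X) - triple \<xi> (A X) (A Y)"
      by (simp add: Xi_def A_br XY triple_def right_diff_distrib sum_subtractf)
    moreover have "triple \<xi> (A Y) (A X) = - triple \<xi> (A X) (A Y)"
      by (rule triple_skew) (use A_sym XY L.symmD[OF \<xi>] in blast)+
    ultimately show ?thesis by simp
  qed
  \<comment> \<open>The degree of the product of \<open>g p\<close> and \<open>g q\<close> in the
    grading by \<open>\<theta>\<close>. As levels lie strictly between \<open>- m / 2\<close> and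
    \<open>m / 2\<close>, it is the level sum, raised by \<open>m\<close> exactly if this sum is
    negative; \<open>lev\<close> is this carry.\<close>
  define dg where "dg p q = nat ((a p + a q) mod int m)" for p q
  have dg_m: "dg p q < m" for p q using m0 by (simp add: dg_def nat_less_iff)
  have dg_lev: "int (dg p q) = a p + a q + int m * int (L.lev p q)" for p q
  proof (cases "a p + a q < 0")
    case True
    have "(a p + a q) mod int m = (a p + a q + int m) mod int m" by simp
    also have "\<dots> = a p + a q + int m" using True a(3)[of p] a(3)[of q] by (intro mod_pos_pos_trivial) auto
    finally show ?thesis using True a(3)[of p] a(3)[of q] by (simp add: dg_def L.lev_def)
  next
    case False
    then have "(a p + a q) mod int m = a p + a q" using a(3)[of p] a(3)[of q] by (intro mod_pos_pos_trivial) auto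
    then show ?thesis using False by (simp add: dg_def L.lev_def)
  qed
  \<comment> \<open>The two degrees add up to \<open>dg p r\<close> plus a multiple of
    \<open>m\<close>, and the sum stays below \<open>m\<close> exactly if this multiple is 0. So the
    contraction only depends on the carries.\<close>
  have dg_kap: "L.kap p q r = (if dg p q + dg (swap_index q) r \<le> m - 1 then 1 else 0)" for p q r
  proof -
    let ?d = "int (L.lev p q) + int (L.lev (swap_index q) r) - int (L.lev p r)"
    have e: "int (dg p q + dg (swap_index q) r) = int (dg p r) + int m * ?d"
      using dg_lev[of p q] dg_lev[of "swap_index q" r] dg_lev[of p r] a(2)[of q] by (simp add: algebra_simps)
    have "dg p q + dg (swap_index q) r \<le> m - 1 \<longleftrightarrow> ?d = 0"
    proof
      assume "?d = 0"
      then have "dg p q + dg (swap_index q) r = dg p r" using e by simp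
      then show "dg p q + dg (swap_index q) r \<le> m - 1" using dg_m[of p r] by linarith
    next
      assume le: "dg p q + dg (swap_index q) r \<le> m - 1"
      have "int m * ?d < int m * 1" using e le m0 by linarith
      moreover have "int m * (- 1) < int m * ?d" using e dg_m[of p r] by linarith
      ultimately have "?d < 1" "- 1 < ?d" using m0 by (simp_all only: mult_less_cancel_left_pos of_nat_0_less_iff)
      then show "?d = 0" by simp
    qed
    then show ?thesis unfolding L.kap_def by auto
  qed
  \<comment> \<open>\<open>\<theta>\<close> is conjugation by \<open>S\<close>, which is diagonal in
    the basis \<open>g\<close>; hence an eigenvector only has entries of its own degree.\<close>
  have A_eig: "A X p q = 0" if X: "X \<in> P.eig i" and i: "i < m" and ne: "i \<noteq> dg p q" for X i p q
  proof (rule ccontr)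
    assume nzA: "A X p q \<noteq> 0"
    have Xsp: "X \<in> ?sp" and Xt: "\<theta> X = mat_scale (\<zeta> ^ i) X" using X by (auto simp: sp.eigenspace_def)
    have "om (\<theta> X *v (S *v g (swap_index p))) (S *v g (swap_index q)) = om (S *v (X *v g (swap_index p))) (S *v g (swap_index q))"
      by (simp only: S(2)[OF Xsp])
    also have "\<dots> = A X p q" using S(1) by (simp add: symp_def A_def)
    finally have "\<zeta> powi (- a q) * (\<zeta> powi (- a p) * (\<zeta> ^ i * A X p q)) = A X p q"
      by (simp add: a(1,2) Xt mat_scale_mv mv_scale A_def mult_ac)
    then have "\<zeta> powi (- a q) * (\<zeta> powi (- a p) * \<zeta> ^ i) = 1" using nzA by (metis mult.assoc mult_cancel_right1)
    then have "\<zeta> ^ i = \<zeta> powi (a p + a q)" using nz by (simp add: power_int_minus power_int_add field_simps)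
    also have "\<dots> = \<zeta> ^ dg p q" by (simp add: primitive_root_powi[OF \<zeta>] dg_def)
    finally show False using primitive_root_power_inj[OF \<zeta> i dg_m] ne by blast
  qed
  have A_cpt: "A (P.cpt i X) p q = (if i = dg p q then A X p q else 0)" if X: "X \<in> ?sp" and i: "i < m" for X i p q
  proof (cases "i = dg p q")
    case True
    have "A X p q = (\<Sum>j<m. A (P.cpt j X) p q)"
      by (subst P.component_decomposition(1)[OF X]) (rule A_sum)
    also have "\<dots> = (\<Sum>j<m. if j = i then A (P.cpt i X) p q else 0)"
      using A_eig[OF P.component_decomposition(2)[OF X]] True by (intro sum.cong) auto
    also have "\<dots> = A (P.cpt i X) p q" using i by simp
    finally show ?thesis using True by simp
  next
    case False
    then show ?thesis using A_eig[OF P.component_decomposition(2)[OF X i] i] by simp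
  qed
  have Xi_sum: "Xi (\<Sum>i\<in>I. f i) = (\<Sum>i\<in>I. Xi (f i))" for I and f :: "nat \<Rightarrow> _"
    using Xi_scale[of 0 0] by (induction I rule: infinite_finite_induct) (simp_all add: Xi_add)
  have Xi_br0: "Xi (P.br0 X Y) = - 2 * L.Phi \<xi> (A X) (A Y)" if XY: "X \<in> ?sp" "Y \<in> ?sp" for X Y
  proof -
    let ?t = "\<lambda>i j r q p. index_sign r * \<xi> p q * A (P.cpt i X) p r * A (P.cpt j Y) (swap_index r) q"
    have "Xi (P.br0 X Y) = (\<Sum>i<m. \<Sum>j<m. if i + j \<le> m - 1 then Xi (commutator (P.cpt i X) (P.cpt j Y)) else 0)"
      unfolding sp.contraction_def Xi_sum using Xi_scale[of 0 0] by (intro sum.cong refl) simp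
    also have "\<dots> = (\<Sum>i<m. \<Sum>j<m. \<Sum>r\<in>UNIV. \<Sum>q\<in>UNIV. \<Sum>p\<in>UNIV. if i + j \<le> m - 1 then - 2 * ?t i j r q p else 0)"
      by (intro sum.cong refl) (simp add: Xi_br P.comp_L XY triple_expand sum_distrib_left mult_ac)
    also have "\<dots> = (\<Sum>r\<in>UNIV. \<Sum>q\<in>UNIV. \<Sum>p\<in>UNIV. \<Sum>i<m. \<Sum>j<m. if i + j \<le> m - 1 then - 2 * ?t i j r q p else 0)"
      by (simp only: sum.swap[where A = "{..<m}" and B = UNIV])
    also have "\<dots> = (\<Sum>r\<in>UNIV. \<Sum>q\<in>UNIV. \<Sum>p\<in>UNIV. - 2 * (index_sign r * L.kap p r q * \<xi> p q * A X p r * A Y (swap_index r) q))"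
    proof (intro sum.cong refl)
      fix r q p
      let ?c = "- 2 * (index_sign r * L.kap p r q * \<xi> p q * A X p r * A Y (swap_index r) q)"
      have "(\<Sum>i<m. \<Sum>j<m. if i + j \<le> m - 1 then - 2 * ?t i j r q p else 0)
          = (\<Sum>i<m. \<Sum>j<m. if j = dg (swap_index r) q then if i = dg p r then ?c else 0 else 0)"
        using XY by (intro sum.cong refl) (auto simp: A_cpt dg_kap)
      also have "\<dots> = ?c" using dg_m by simp
      finally show "(\<Sum>i<m. \<Sum>j<m. if i + j \<le> m - 1 then - 2 * ?t i j r q p else 0) = ?c" .
    qed
    also have "\<dots> = - 2 * L.Phi \<xi> (A X) (A Y)" by (simp only: L.Phi_expand sum_distrib_left)
    finally show ?thesis .
  qed
  have A_qm: "A (qm (g r) (g s)) = (\<lambda>p q. index_sign r * index_sign s * L.symm_unit r s p q)" for r s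
  proof (intro ext)
    fix p q
    have gs: "om (g u) (g (swap_index v)) = (if v = u then index_sign u else 0)" for u v
      by (simp add: g) (metis swap_swap)
    show "A (qm (g r) (g s)) p q = index_sign r * index_sign s * L.symm_unit r s p q"
      by (auto simp: A_def qm_mv om_add_left gs L.symm_unit_def)
  qed
  have stab: "A X \<in> L.kern UNIV \<xi>" if X: "X \<in> P.contr.stabiliser Xi" for X
  proof -
    have Xsp: "X \<in> ?sp" and X0: "\<And>Y. Y \<in> ?sp \<Longrightarrow> Xi (P.br0 X Y) = 0" using X by (auto simp: P.contr.stabiliser_eq)
    have "L.eqn \<xi> (A X) r s = 0" for r s
    proof -
      have "L.Phi \<xi> (A X) (A (qm (g r) (g s))) = 0" using X0[OF qm_sp, of "g r" "g s"] Xi_br0[OF Xsp qm_sp, of "g r" "g s"] by simp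
      moreover have "L.Phi \<xi> (A X) (A (qm (g r) (g s))) = index_sign r * index_sign s * L.Phi \<xi> (A X) (L.symm_unit r s)"
        unfolding A_qm L.Phi_def by (simp add: sum_distrib_left mult_ac)
      ultimately show ?thesis by (simp add: L.Phi_symm_unit)
    qed
    then show ?thesis using A_symm[OF Xsp] by (simp add: L.kern_def)
  qed
  \<comment> \<open>Reads off the entries at \<open>Z\<close>. The result is again a matrix because
    \<open>dim_le_injective\<close> compares subspaces of one ambient space.\<close>
  define h :: "'k ^ ('n + 'n) ^ ('n + 'n) \<Rightarrow> 'k ^ ('n + 'n) ^ ('n + 'n)"
    where "h X = (\<chi> p q. if (p, q) \<in> Z then A X p q else 0)" for X
  define V where "V = mat.span ((\<lambda>z. mat_unit (fst z) (snd z) :: 'k ^ ('n + 'n) ^ ('n + 'n)) ` Z)"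
  have "P.contr.index \<le> mat.dim (P.contr.stabiliser Xi)" by (rule P.contr.index_le[OF Xi_dual])
  also have "\<dots> \<le> mat.dim V"
  proof (rule mat.dim_le_injective[OF P.contr.stabiliser_subspace[OF Xi_dual], of h])
    fix X assume X: "X \<in> P.contr.stabiliser Xi"
    show "h X \<in> V"
    proof -
      have "h X = (\<Sum>z\<in>UNIV. mat_scale (if z \<in> Z then A X (fst z) (snd z) else 0) (mat_unit (fst z) (snd z)))"
        unfolding mat_unit_sum by (simp only: h_def fst_conv snd_conv)
      also have "\<dots> \<in> V" unfolding V_def
      proof (intro mat.span_sum)
        fix z
        show "mat_scale (if z \<in> Z then A X (fst z) (snd z) else 0) (mat_unit (fst z) (snd z))
            \<in> mat.span ((\<lambda>z. mat_unit (fst z) (snd z) :: 'k ^ ('n + 'n) ^ ('n + 'n)) ` Z)"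
        proof (cases "z \<in> Z")
          case True
          then show ?thesis by (intro mat.span_scale mat.span_base) (rule imageI)
        next
          case False
          then show ?thesis by (simp add: mat.span_zero)
        qed
      qed
      finally show ?thesis .
    qed
    show "h (mat_scale c X) = mat_scale c (h X)" for c
      unfolding h_def A_scale by (simp add: mat_scale_def vec_eq_iff)
    show "h (X + Y) = h X + h Y" for Y by (simp add: h_def A_add vec_eq_iff)
    show "X = 0" if "h X = 0"
    proof -
      have "A X p q = 0" if "(p, q) \<in> Z" for p q
      proof -
        have "h X $ p $ q = 0" using \<open>h X = 0\<close> by simp
        then show ?thesis using that by (simp add: h_def)
      qed
      then have "A X = (\<lambda>_ _. 0)" using k stab[OF X] unfolding L.rigid_def by blast
      then show ?thesis by (rule A_inj)
    qed
  qed
  also have "\<dots> \<le> card ((\<lambda>z. mat_unit (fst z) (snd z) :: 'k ^ ('n + 'n) ^ ('n + 'n)) ` Z)"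
    unfolding V_def by (rule mat.dim_le_card) (use Z(1) in auto)
  also have "\<dots> \<le> card Z" by (rule card_image_le[OF Z(1)])
  also have "\<dots> \<le> CARD('n)" using Z(2) by simp
  finally show ?thesis .
qed

theorem proposition4p11:
  fixes \<theta> :: "'k::{alg_closed_field, field_char_0} ^ ('n::finite + 'n) ^ ('n + 'n)
      \<Rightarrow> 'k ^ ('n + 'n) ^ ('n + 'n)"
    and \<zeta> :: 'k and m :: nat
  assumes "sp.automorphism \<theta>" and "sp.has_order \<theta> m" and "odd m" and "primitive_root \<zeta> m"
  shows "lie_algebra.index mat_scale (sp_algebra :: ('k ^ ('n + 'n) ^ ('n + 'n)) set)
        (sp.contraction \<theta> m \<zeta>)
      = lie_algebra.index mat_scale (sp_algebra :: ('k ^ ('n + 'n) ^ ('n + 'n)) set) commutator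
    \<and> lie_algebra.index mat_scale (sp_algebra :: ('k ^ ('n + 'n) ^ ('n + 'n)) set) commutator
      = CARD('n)"
proof -
  let ?sp = "sp_algebra :: ('k ^ ('n + 'n) ^ ('n + 'n)) set"
  have "periodic_lie_algebra mat_scale ?sp commutator \<theta> m \<zeta>"
    by unfold_locales (fact assms)+
  then have "lie_algebra.index mat_scale ?sp commutator
      \<le> lie_algebra.index mat_scale ?sp (sp.contraction \<theta> m \<zeta>)"
    by (rule index_contraction_ge)
  moreover have "lie_algebra.index mat_scale ?sp (sp.contraction \<theta> m \<zeta>) \<le> CARD('n)"
    by (rule index_contraction_le[OF assms])
  moreover have "CARD('n) \<le> lie_algebra.index mat_scale ?sp commutator"
    by (rule index_sp_ge)
  ultimately show ?thesis by linarith
qed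

end
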